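(* Suppose that $P_0$ is a Borel probability measure on $\mathbb R^d$ supported in the ball $B_R(0)$ and satisfying the doubling condition (UD) with constant $D_{\mathrm{UD}}$. For every integer $j\geq1$ there is a constant $C_j$, depending only on $j$ and $D_{\mathrm{UD}}$ (in particular independent of the ambient dimension $d$), such that for every $t>0$ and every $x\in\mathbb R^d$, $$|L^jx(t,x)|\leq C_j\left[e^{-t}(1-e^{-t})^{-j}|x|+e^{-t/2}\left(\frac{1+R}{1-e^{-t}}\right)^{2j-1}\right],$$ $$\lVert D_x(L^jx)(t,x)\rVert_{\mathrm{op}}\leq C_je^{-t}\left(\frac{1+R}{1-e^{-t}}\right)^{2j}.$$ If $t\geq\delta>0$, the same bounds hold with $(1-e^{-t})^{-1}$ replaced by $(1-e^{-\delta})^{-1}$. In particular, for $0<\delta\leq1$ and $t\geq\delta$ (with $C_j$ of the same dependence), $$|L^jx(t,x)|\leq C_j\left[e^{-t}\delta^{-j}|x|+e^{-t/2}\left(\frac{1+R}{\delta}\right)^{2j-1}\right],\qquad \lVert D_x(L^jx)(t,x)\rVert_{\mathrm{op}}\leq C_je^{-t}\left(\frac{1+R}{\delta}\right)^{2j}.$$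
   Context: Ornstein--Uhlenbeck setting. For $t>0$ let $P_t$ be the law of $X_t=e^{-t/2}X_0+\sqrt{1-e^{-t}}\,G$ with $X_0\sim P_0$ and $G\sim N(0,I_d)$ independent; $P_t$ has a smooth positive density $p_t$. The modified score is $\hat s(t,x)=x+D_x\log p_t(x)$. The material derivative is the first-order differential operator $$L:=-\partial_t+\tfrac12\hat s(t,x)\cdot D_x ,$$ acting componentwise on smooth vector fields of $(t,x)\in(0,\infty)\times\mathbb R^d$; $L^jx$ denotes $L$ applied $j$ times to the identity field $(t,x)\mapsto x$ (so $Lx=\frac12\hat s$). $\lVert\cdot\rVert_{\mathrm{op}}$ is the Euclidean operator norm. Doubling condition (UD). Let $M=\operatorname{supp}P_0$ (compact). For $\theta\in\mathbb S^{d-1}$ set $U_\theta(y)=\sup_{y'\in M}\langle\theta,y'\rangle-\langle\theta,y\rangle$ and $F_\theta(u)=P_0(\{y:U_\theta(y)\leq u\})$, $u>0$. (UD) with constant $D_{\mathrm{UD}}\geq1$ means $F_\theta(2u)\leq D_{\mathrm{UD}}F_\theta(u)$ for all $\theta\in\mathbb S^{d-1}$ and all $u>0$. *)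

theory Defs
  imports "HOL-Probability.Probability"
begin

text \<open>The constants in the theorem must not depend on the dimension \<open>d\<close>, so \<open>d\<close> has to be quantified
  inside the formula and cannot be a type. Points of \<open>d\<close>-dimensional Euclidean space are therefore
  functions in \<open>{..<d} \<rightarrow>\<^sub>E UNIV\<close>, i.e. functions on \<open>nat\<close> that are \<open>undefined\<close> outside \<open>{..<d}\<close>.\<close>

abbreviation leb :: "nat \<Rightarrow> (nat \<Rightarrow> real) measure" where
  "leb d \<equiv> Pi\<^sub>M {..<d} (\<lambda>_. lborel)"

abbreviation Rd :: "nat \<Rightarrow> (nat \<Rightarrow> real) set" where
  "Rd d \<equiv> {..<d} \<rightarrow>\<^sub>E UNIV"

definition inner_d :: "nat \<Rightarrow> (nat \<Rightarrow> real) \<Rightarrow> (nat \<Rightarrow> real) \<Rightarrow> real" where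
  "inner_d d x y = (\<Sum>i<d. x i * y i)"

definition norm_d :: "nat \<Rightarrow> (nat \<Rightarrow> real) \<Rightarrow> real" where
  "norm_d d x = L2_set x {..<d}"

definition cball_d :: "nat \<Rightarrow> real \<Rightarrow> (nat \<Rightarrow> real) set" where
  "cball_d d R = {x \<in> Rd d. norm_d d x \<le> R}"

definition sphere_d :: "nat \<Rightarrow> (nat \<Rightarrow> real) set" where
  "sphere_d d = {\<theta> \<in> Rd d. norm_d d \<theta> = 1}"

definition borel_prob :: "nat \<Rightarrow> (nat \<Rightarrow> real) measure \<Rightarrow> bool" where
  "borel_prob d P0 \<longleftrightarrow> prob_space P0 \<and> sets P0 = sets (leb d)"

definition supp :: "nat \<Rightarrow> (nat \<Rightarrow> real) measure \<Rightarrow> (nat \<Rightarrow> real) set" where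
  "supp d P0 =
     {x \<in> Rd d. \<forall>\<epsilon>>0. emeasure P0 {y \<in> Rd d. norm_d d (\<lambda>i. y i - x i) < \<epsilon>} > 0}"

definition cap_depth :: "nat \<Rightarrow> (nat \<Rightarrow> real) measure \<Rightarrow> (nat \<Rightarrow> real) \<Rightarrow> (nat \<Rightarrow> real) \<Rightarrow> real" where
  "cap_depth d P0 \<theta> y = (SUP y'\<in>supp d P0. inner_d d \<theta> y') - inner_d d \<theta> y"

definition cap_mass :: "nat \<Rightarrow> (nat \<Rightarrow> real) measure \<Rightarrow> (nat \<Rightarrow> real) \<Rightarrow> real \<Rightarrow> real" where
  "cap_mass d P0 \<theta> u = measure P0 {y \<in> Rd d. cap_depth d P0 \<theta> y \<le> u}"

definition UD :: "nat \<Rightarrow> (nat \<Rightarrow> real) measure \<Rightarrow> real \<Rightarrow> bool" where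
  "UD d P0 D \<longleftrightarrow> D \<ge> 1 \<and>
     (\<forall>\<theta>\<in>sphere_d d. \<forall>u>0. cap_mass d P0 \<theta> (2 * u) \<le> D * cap_mass d P0 \<theta> u)"

text \<open>The law of \<open>exp (-t/2) X\<^sub>0 + sqrt (1 - exp (-t)) G\<close>; independence of \<open>X\<^sub>0\<close> and \<open>G\<close> means that
  the pair has the product law.\<close>

definition ou_law :: "nat \<Rightarrow> (nat \<Rightarrow> real) measure \<Rightarrow> real \<Rightarrow> (nat \<Rightarrow> real) measure" where
  "ou_law d P0 t =
     distr (P0 \<Otimes>\<^sub>M Pi\<^sub>M {..<d} (\<lambda>_. std_normal_distribution)) (leb d)
       (\<lambda>(y, g). \<lambda>i\<in>{..<d}. exp (- t / 2) * y i + sqrt (1 - exp (- t)) * g i)"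

text \<open>A family of continuous positive densities of the laws, for \<open>t > 0\<close>. A continuous density is
  unique on \<open>Rd d\<close>, so this determines \<open>p t\<close> there; smoothness need not be required, being a
  property of that density. Existence is \<open>ou_density_exists\<close> below.\<close>

definition ou_density ::
  "nat \<Rightarrow> (nat \<Rightarrow> real) measure \<Rightarrow> (real \<Rightarrow> (nat \<Rightarrow> real) \<Rightarrow> real) \<Rightarrow> bool" where
  "ou_density d P0 p \<longleftrightarrow>
     (\<forall>t>0. continuous_on (Rd d) (p t) \<and> (\<forall>x\<in>Rd d. p t x > 0) \<and>
            ou_law d P0 t = density (leb d) (\<lambda>x. ennreal (p t x)))"

text \<open>Spatial derivatives are coordinatewise. \<open>deriv\<close> is total, but it is only ever applied to
  smooth functions: the density and everything built from it are smooth for \<open>t > 0\<close>.\<close>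

definition partial :: "nat \<Rightarrow> ((nat \<Rightarrow> real) \<Rightarrow> real) \<Rightarrow> (nat \<Rightarrow> real) \<Rightarrow> real" where
  "partial k f x = deriv (\<lambda>r. f (x(k := r))) (x k)"

definition mod_score ::
  "nat \<Rightarrow> (real \<Rightarrow> (nat \<Rightarrow> real) \<Rightarrow> real) \<Rightarrow> real \<Rightarrow> (nat \<Rightarrow> real) \<Rightarrow> nat \<Rightarrow> real" where
  "mod_score d p t x = (\<lambda>i\<in>{..<d}. x i + partial i (\<lambda>z. ln (p t z)) x)"

type_synonym vfield = "real \<Rightarrow> (nat \<Rightarrow> real) \<Rightarrow> nat \<Rightarrow> real"

definition material_deriv ::
  "nat \<Rightarrow> (real \<Rightarrow> (nat \<Rightarrow> real) \<Rightarrow> real) \<Rightarrow> vfield \<Rightarrow> vfield" where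
  "material_deriv d p f t x =
     (\<lambda>i\<in>{..<d}. - deriv (\<lambda>s. f s x i) t
        + 1/2 * (\<Sum>k<d. mod_score d p t x k * partial k (\<lambda>z. f t z i) x))"

definition Lx ::
  "nat \<Rightarrow> (real \<Rightarrow> (nat \<Rightarrow> real) \<Rightarrow> real) \<Rightarrow> nat \<Rightarrow> vfield" where
  "Lx d p j = (material_deriv d p ^^ j) (\<lambda>t x. x)"

definition jacobian_d :: "((nat \<Rightarrow> real) \<Rightarrow> nat \<Rightarrow> real) \<Rightarrow> (nat \<Rightarrow> real) \<Rightarrow> nat \<Rightarrow> nat \<Rightarrow> real" where
  "jacobian_d f x i k = partial k (\<lambda>z. f z i) x"

definition opnorm_d :: "nat \<Rightarrow> (nat \<Rightarrow> nat \<Rightarrow> real) \<Rightarrow> real" where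
  "opnorm_d d A = (SUP v\<in>cball_d d 1. norm_d d (\<lambda>i. \<Sum>k<d. A i k * v k))"


subsection \<open>Existence of the density\<close>

definition ou_pdf :: "nat \<Rightarrow> (nat \<Rightarrow> real) measure \<Rightarrow> real \<Rightarrow> (nat \<Rightarrow> real) \<Rightarrow> real" where
  "ou_pdf d P0 t x =
     (\<integral>y. (\<Prod>i<d. normal_density (exp (- t / 2) * y i) (sqrt (1 - exp (- t))) (x i)) \<partial>P0)"

lemma normal_density_le:
  assumes "0 < s"
  shows "normal_density m s x \<le> 1 / sqrt (2 * pi * s\<^sup>2)"
  unfolding normal_density_def using assms
  by (intro mult_left_le) auto

lemma distr_affine_std_normal:
  assumes "0 < s"
  shows "distr std_normal_distribution lborel (\<lambda>g. m + s * g) = density lborel (normal_density m s)"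
proof -
  interpret prob_space std_normal_distribution by (rule prob_space_normal_density) simp
  have "distributed std_normal_distribution lborel (\<lambda>x. x) (normal_density 0 1)"
    by (auto simp: distributed_def intro!: distr_id2)
  from normal_density_affine[OF this, of s m] assms show ?thesis
    by (simp add: distributed_def)
qed

lemma distr_affine_gaussian:
  assumes "0 < s"
  shows "distr (Pi\<^sub>M {..<d} (\<lambda>_. std_normal_distribution)) (leb d) (\<lambda>g. \<lambda>i\<in>{..<d}. m i + s * g i)
    = density (leb d) (\<lambda>x. ennreal (\<Prod>i<d. normal_density (m i) s (x i)))"
    (is "?A = ?B")
proof -
  let ?N = "\<lambda>i. density lborel (normal_density (m i) s)"
  have ps: "prob_space (?N i)" for i using assms by (rule prob_space_normal_density)
  interpret N: product_prob_space ?N "{..<d}"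
    by (intro product_prob_spaceI ps)
  have sg: "prob_space std_normal_distribution"
    by (rule prob_space_normal_density) simp
  interpret G: product_prob_space "\<lambda>_::nat. std_normal_distribution" "{..<d}"
    by (intro product_prob_spaceI sg)
  interpret B: product_sigma_finite "\<lambda>_::nat. lborel :: real measure" ..
  have setsN: "sets (leb d) = sets (Pi\<^sub>M {..<d} ?N)"
    by (intro sets_PiM_cong) auto
  have "?A = Pi\<^sub>M {..<d} ?N"
  proof (rule N.PiM_eqI)
    fix A assume "\<And>i. i \<in> {..<d} \<Longrightarrow> A i \<in> sets (?N i)"
    then have A[measurable]: "\<And>i. i \<in> {..<d} \<Longrightarrow> A i \<in> sets borel" by simp
    have "(\<lambda>g. \<lambda>i\<in>{..<d}. m i + s * g i) -` Pi\<^sub>E {..<d} A \<inter> space (Pi\<^sub>M {..<d} (\<lambda>_. std_normal_distribution))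
      = Pi\<^sub>E {..<d} (\<lambda>i. (\<lambda>g. m i + s * g) -` A i)"
      by (auto simp: space_PiM PiE_def Pi_def)
    moreover have "Pi\<^sub>E {..<d} A \<in> sets (leb d)"
      by (rule sets_PiM_I_finite) (use A in auto)
    moreover have "(\<lambda>g. \<lambda>i\<in>{..<d}. m i + s * g i)
      \<in> measurable (Pi\<^sub>M {..<d} (\<lambda>_. std_normal_distribution)) (leb d)"
      by (rule measurable_restrict) measurable
    moreover have v: "(\<lambda>g. m i + s * g) -` A i \<in> sets borel" if "i < d" for i
      using measurable_sets[of "\<lambda>g. m i + s * g" borel borel "A i"] A[of i] that by simp
    moreover have "emeasure (Pi\<^sub>M {..<d} (\<lambda>_. std_normal_distribution)) (Pi\<^sub>E {..<d} (\<lambda>i. (\<lambda>g. m i + s * g) -` A i))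
      = (\<Prod>i<d. emeasure std_normal_distribution ((\<lambda>g. m i + s * g) -` A i))"
      by (rule G.emeasure_PiM) (use v in auto)
    ultimately have "emeasure ?A (Pi\<^sub>E {..<d} A)
      = (\<Prod>i<d. emeasure std_normal_distribution ((\<lambda>g. m i + s * g) -` A i))"
      by (simp add: emeasure_distr)
    also have "\<dots> = (\<Prod>i<d. emeasure (?N i) (A i))"
      by (intro prod.cong refl, subst distr_affine_std_normal[OF assms, symmetric],
          subst emeasure_distr) (use A in auto)
    finally show "emeasure ?A (Pi\<^sub>E {..<d} A) = (\<Prod>i\<in>{..<d}. emeasure (?N i) (A i))" .
  qed (use setsN in auto)
  moreover have "?B = Pi\<^sub>M {..<d} ?N"
  proof (rule N.PiM_eqI)
    fix A assume "\<And>i. i \<in> {..<d} \<Longrightarrow> A i \<in> sets (?N i)"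
    then have A[measurable]: "\<And>i. i \<in> {..<d} \<Longrightarrow> A i \<in> sets borel" by simp
    have box: "Pi\<^sub>E {..<d} A \<in> sets (leb d)"
      by (rule sets_PiM_I_finite) (use A in auto)
    have "emeasure ?B (Pi\<^sub>E {..<d} A)
      = (\<integral>\<^sup>+x. ennreal (\<Prod>i<d. normal_density (m i) s (x i)) * indicator (Pi\<^sub>E {..<d} A) x \<partial>leb d)"
      using box by (intro emeasure_density) measurable
    also have "\<dots> = (\<integral>\<^sup>+x. (\<Prod>i<d. ennreal (normal_density (m i) s (x i)) * indicator (A i) (x i)) \<partial>leb d)"
    proof (intro nn_integral_cong)
      fix x assume "x \<in> space (leb d)"
      then have x: "x \<in> extensional {..<d}" by (auto simp: space_PiM PiE_def)
      have "(indicator (Pi\<^sub>E {..<d} A) x :: ennreal) = (\<Prod>i<d. indicator (A i) (x i))"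
      proof (cases "x \<in> Pi\<^sub>E {..<d} A")
        case True
        then have "\<And>i. i < d \<Longrightarrow> x i \<in> A i" by auto
        then show ?thesis using True by simp
      next
        case False
        then obtain i where "i < d" "x i \<notin> A i" using x by (auto simp: PiE_def)
        then show ?thesis using False by (auto intro!: prod_zero[symmetric] simp: indicator_def)
      qed
      then show "ennreal (\<Prod>i<d. normal_density (m i) s (x i)) * indicator (Pi\<^sub>E {..<d} A) x
        = (\<Prod>i<d. ennreal (normal_density (m i) s (x i)) * indicator (A i) (x i))"
        by (simp add: prod.distrib prod_ennreal)
    qed
    also have "\<dots> = (\<Prod>i<d. \<integral>\<^sup>+x. ennreal (normal_density (m i) s x) * indicator (A i) x \<partial>lborel)"
      by (rule B.product_nn_integral_prod) (auto simp: A)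
    also have "\<dots> = (\<Prod>i<d. emeasure (?N i) (A i))"
      by (intro prod.cong refl, subst emeasure_density) (use A in auto)
    finally show "emeasure ?B (Pi\<^sub>E {..<d} A) = (\<Prod>i\<in>{..<d}. emeasure (?N i) (A i))" .
  qed (use setsN in auto)
  ultimately show ?thesis by simp
qed

lemma ou_density_exists:
  assumes "borel_prob d P0"
  shows "ou_density d P0 (ou_pdf d P0)"
  unfolding ou_density_def
proof (intro allI impI)
  fix t :: real assume t: "0 < t"
  define a where "a = exp (- t / 2)"
  define s where "s = sqrt (1 - exp (- t))"
  have s: "0 < s" using t by (simp add: s_def)
  define k where "k = (\<lambda>y x. \<Prod>i<d. normal_density (a * y i) s (x i))"
  define c where "c = (1 / sqrt (2 * pi * s\<^sup>2)) ^ d"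
  have pdf: "ou_pdf d P0 t = (\<lambda>x. \<integral>y. k y x \<partial>P0)"
    by (simp add: fun_eq_iff ou_pdf_def k_def a_def s_def)
  interpret P: prob_space P0 using assms by (simp add: borel_prob_def)
  have setsP[measurable_cong]: "sets P0 = sets (leb d)" using assms by (simp add: borel_prob_def)
  have sg: "prob_space std_normal_distribution"
    by (rule prob_space_normal_density) simp
  interpret G: product_prob_space "\<lambda>_::nat. std_normal_distribution" "{..<d}"
    by (intro product_prob_spaceI sg)
  interpret B: product_sigma_finite "\<lambda>_::nat. lborel :: real measure" ..
  interpret leb: sigma_finite_measure "leb d" by (rule B.sigma_finite) simp
  interpret PL: pair_sigma_finite P0 "leb d" ..
  have k_pos: "0 < k y x" for y x
    unfolding k_def by (intro prod_pos ballI normal_density_pos s)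
  have k_le: "k y x \<le> c" for y x
    unfolding k_def c_def
    using prod_mono[of "{..<d}" "\<lambda>i. normal_density (a * y i) s (x i)"
        "\<lambda>_. 1 / sqrt (2 * pi * s\<^sup>2)"] normal_density_le[OF s]
    by simp
  have k_abs: "\<bar>k y x\<bar> \<le> c" for y x
    using k_le[of y x] k_pos[of y x] by simp
  have k_nd: "k = (\<lambda>y x. \<Prod>i<d. 1 / sqrt (2 * pi * s\<^sup>2) * exp (- (x i - a * y i)\<^sup>2 / (2 * s\<^sup>2)))"
    by (simp add: k_def normal_density_def)
  have k_meas[measurable]: "(\<lambda>(y, x). k y x) \<in> borel_measurable (P0 \<Otimes>\<^sub>M leb d)"
    unfolding k_nd by measurable
  have k_meas1: "(\<lambda>y. k y x) \<in> borel_measurable P0" for x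
    unfolding k_nd by measurable
  have k_int: "integrable P0 (\<lambda>y. k y x)" for x
    by (rule P.integrable_const_bound[of _ c]) (use k_abs k_meas1 in auto)
  have "continuous_on (Rd d) (\<lambda>x. \<integral>y. k y x \<partial>P0)"
  proof (rule continuous_on_sequentiallyI)
    fix u x assume "u \<longlonglongrightarrow> (x :: nat \<Rightarrow> real)"
    then have "(\<lambda>n. u n i) \<longlonglongrightarrow> x i" for i
      using continuous_on_tendsto_compose[OF continuous_on_product_coordinates] by auto
    then have lim: "(\<lambda>n. k y (u n)) \<longlonglongrightarrow> k y x" for y
      unfolding k_nd using s by (intro tendsto_intros) auto
    show "(\<lambda>n. \<integral>y. k y (u n) \<partial>P0) \<longlonglongrightarrow> (\<integral>y. k y x \<partial>P0)"
      by (rule integral_dominated_convergence[where w = "\<lambda>_. c"])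
        (use lim k_abs k_meas1 in auto)
  qed
  moreover have "0 < (\<integral>y. k y x \<partial>P0)" for x
    using P.integral_less_AE_space[of "\<lambda>_. 0" "\<lambda>y. k y x"] k_int[of x] k_pos
    by (simp add: P.emeasure_space_1)
  moreover have "ou_law d P0 t = density (leb d) (\<lambda>x. ennreal (\<integral>y. k y x \<partial>P0))"
  proof (rule measure_eqI)
    fix A assume "A \<in> sets (ou_law d P0 t)"
    then have A[measurable]: "A \<in> sets (leb d)" by (simp add: ou_law_def)
    let ?N = "Pi\<^sub>M {..<d} (\<lambda>_. std_normal_distribution)"
    let ?X = "\<lambda>(y, g). \<lambda>i\<in>{..<d}. a * y i + s * g i"
    have X[measurable]: "?X \<in> measurable (P0 \<Otimes>\<^sub>M ?N) (leb d)"
      by measurable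
    have "emeasure (ou_law d P0 t) A = emeasure (P0 \<Otimes>\<^sub>M ?N) (?X -` A \<inter> space (P0 \<Otimes>\<^sub>M ?N))"
      unfolding ou_law_def a_def[symmetric] s_def[symmetric] by (rule emeasure_distr) (use X A in auto)
    also have "\<dots> = (\<integral>\<^sup>+y. emeasure ?N (Pair y -` (?X -` A \<inter> space (P0 \<Otimes>\<^sub>M ?N))) \<partial>P0)"
      by (rule G.emeasure_pair_measure_alt) measurable
    also have "\<dots> = (\<integral>\<^sup>+y. emeasure (distr ?N (leb d) (\<lambda>g. \<lambda>i\<in>{..<d}. a * y i + s * g i)) A \<partial>P0)"
    proof (intro nn_integral_cong)
      fix y assume "y \<in> space P0"
      moreover have "(\<lambda>g. \<lambda>i\<in>{..<d}. a * y i + s * g i) \<in> measurable ?N (leb d)"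
        by (rule measurable_restrict) measurable
      ultimately show "emeasure ?N (Pair y -` (?X -` A \<inter> space (P0 \<Otimes>\<^sub>M ?N)))
        = emeasure (distr ?N (leb d) (\<lambda>g. \<lambda>i\<in>{..<d}. a * y i + s * g i)) A"
        by (subst emeasure_distr) (auto simp: space_pair_measure intro!: arg_cong2[where f = emeasure])
    qed
    also have "\<dots> = (\<integral>\<^sup>+y. \<integral>\<^sup>+x. ennreal (k y x) * indicator A x \<partial>leb d \<partial>P0)"
      unfolding distr_affine_gaussian[OF s] k_def by (intro nn_integral_cong emeasure_density) measurable
    also have "\<dots> = (\<integral>\<^sup>+x. \<integral>\<^sup>+y. ennreal (k y x) * indicator A x \<partial>P0 \<partial>leb d)"
      by (rule PL.Fubini'[symmetric]) measurable
    also have "\<dots> = (\<integral>\<^sup>+x. ennreal (\<integral>y. k y x \<partial>P0) * indicator A x \<partial>leb d)"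
      by (intro nn_integral_cong, subst nn_integral_multc)
        (use k_meas1 k_int k_pos in \<open>auto simp: nn_integral_eq_integral less_imp_le\<close>)
    also have "\<dots> = emeasure (density (leb d) (\<lambda>x. ennreal (\<integral>y. k y x \<partial>P0))) A"
      by (rule emeasure_density[symmetric]) measurable
    finally show "emeasure (ou_law d P0 t) A = \<dots>" .
  qed (simp add: ou_law_def)
  ultimately show "continuous_on (Rd d) (ou_pdf d P0 t) \<and> (\<forall>x\<in>Rd d. 0 < ou_pdf d P0 t x) \<and>
      ou_law d P0 t = density (leb d) (\<lambda>x. ennreal (ou_pdf d P0 t x))"
    by (simp add: pdf)
qed

end

theory Submission
  imports Defs
begin

text \<open>Put \<open>lam = exp (-t) / (1 - exp (-t))\<close>, \<open>bet = exp (-t/2) / (1 - exp (-t))\<close> and \<open>h = bet x\<close>. The law of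
  \<open>X\<^sub>0\<close> given \<open>X\<^sub>t = x\<close> is \<open>P\<^sub>0\<close> tilted by \<open>exp (\<langle>h, y\<rangle> - lam |y|\<^sup>2 / 2)\<close>, and with \<open>m\<close> its mean the
  modified score is \<open>- lam x + bet m\<close>. Along the flow, \<open>L lam = lam (1 + lam)\<close> and
  \<open>L h = (1 + lam) (h + lam m) / 2\<close>, and differentiating a tilted expectation produces a covariance,
  that is, an expectation with one more independent copy of \<open>Y\<close>. Hence \<open>L\<^sup>j x\<close> is a multiple of \<open>x\<close>
  plus \<open>bet\<close> times the expectation of \<open>Y\<^sub>0\<close> against a polynomial in \<open>1 + lam\<close>, \<open>\<langle>h, Y\<^sub>i - Y\<^sub>k\<rangle>\<close> and
  \<open>lam \<langle>Y\<^sub>i, Y\<^sub>k\<rangle>\<close>, whose degrees grow by one with each application of \<open>L\<close>. Only the gaps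
  \<open>\<langle>h, Y\<^sub>i - Y\<^sub>k\<rangle>\<close> could be large, and they are controlled by the depth \<open>V = sup \<langle>h, \<cdot>\<rangle> - \<langle>h, Y\<rangle>\<close>:
  writing exponential moments as integrals of the distribution function of \<open>V\<close>, doubling gives
  \<open>E exp (- V / 2) \<le> D E exp (- V)\<close>, so that \<open>V\<close> has tilted moments of order \<open>q\<close> at most
  \<open>C (1 + lam R\<^sup>2)\<^sup>q\<close>, whatever \<open>h\<close> and the dimension.\<close>

text \<open>Two demands shape the proof: |x| may occur only to the first power, although h = bet x
  enters every moment, and no constant may see d. For the first, (UD) holds at every scale u, so
  passing from a unit vector to h merely rescales u, and the moments of the depth do not feel |h|.
  Then x survives only in the explicit multiple of x, which the summand - lam x of the score
  regenerates at each step; it is carried along by a polynomial of its own. For the second,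
  integrands are kept as syntax, and vectors are measured by pairing them with themselves, never
  coordinate by coordinate. The exponents arise as follows. After j further applications of L both
  degrees are at most j, and (1 + lam)(1 + lam R^2) <= ((1 + R)(1 + lam))^2 turns them into the
  power 2j. The prefactor bet and the bound R of Y_0 add one to it; a spatial derivative adds
  another bet and another R. As index j describes the (j+1)-st power of L, these are the exponents
  2j - 1 and 2j of the theorem.\<close>

subsection \<open>Differentiation under the integral sign\<close>

text \<open>The difference quotients at \<open>r\<close> are bounded uniformly in \<open>x\<close>, as dominated convergence requires;
  nothing is asked of the derivative away from \<open>r\<close>.\<close>

definition uderiv :: "'a measure \<Rightarrow> (real \<Rightarrow> 'a \<Rightarrow> real) \<Rightarrow> ('a \<Rightarrow> real) \<Rightarrow> real \<Rightarrow> bool" where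
  "uderiv M f f' r \<longleftrightarrow> (\<forall>s. f s \<in> borel_measurable M) \<and> f' \<in> borel_measurable M \<and>
     (\<forall>x\<in>space M. ((\<lambda>s. f s x) has_real_derivative f' x) (at r)) \<and>
     (\<exists>B. (\<forall>x\<in>space M. \<bar>f r x\<bar> \<le> B) \<and>
          (\<forall>\<^sub>F s in at r. \<forall>x\<in>space M. \<bar>f s x - f r x\<bar> \<le> B * \<bar>s - r\<bar>))"

lemma uderivE:
  assumes "uderiv M f f' r"
  obtains B where "B \<ge> 1" "\<forall>x\<in>space M. \<bar>f r x\<bar> \<le> B"
    "\<forall>\<^sub>F s in at r. \<forall>x\<in>space M. \<bar>f s x - f r x\<bar> \<le> B * \<bar>s - r\<bar>"
proof -
  from assms obtain B where B: "\<forall>x\<in>space M. \<bar>f r x\<bar> \<le> B"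
    "\<forall>\<^sub>F s in at r. \<forall>x\<in>space M. \<bar>f s x - f r x\<bar> \<le> B * \<bar>s - r\<bar>"
    unfolding uderiv_def by blast
  show thesis
  proof (rule that[of "max 1 B"])
    show "\<forall>\<^sub>F s in at r. \<forall>x\<in>space M. \<bar>f s x - f r x\<bar> \<le> max 1 B * \<bar>s - r\<bar>"
      using B(2)
      by eventually_elim (meson abs_ge_zero max.cobounded2 mult_right_mono order_trans)
  qed (use B in \<open>auto simp: max.coboundedI2\<close>)
qed

lemma uderiv_integral:
  assumes "finite_measure M" and u: "uderiv M f f' r"
  shows "((\<lambda>s. \<integral>x. f s x \<partial>M) has_real_derivative (\<integral>x. f' x \<partial>M)) (at r)"
proof -
  interpret finite_measure M by fact
  obtain B where B: "B \<ge> 1" "\<forall>x\<in>space M. \<bar>f r x\<bar> \<le> B"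
    "\<forall>\<^sub>F s in at r. \<forall>x\<in>space M. \<bar>f s x - f r x\<bar> \<le> B * \<bar>s - r\<bar>"
    by (rule uderivE[OF u])
  have [measurable]: "f s \<in> borel_measurable M" "f' \<in> borel_measurable M" for s
    using u by (auto simp: uderiv_def)
  have int0: "integrable M (f r)"
    by (rule integrable_const_bound[of _ B]) (use B in auto)
  have "\<forall>\<^sub>F s in at r. ((\<integral>x. f s x \<partial>M) - (\<integral>x. f r x \<partial>M)) / (s - r) = (\<integral>x. (f s x - f r x) / (s - r) \<partial>M)"
    using B(3)
  proof eventually_elim
    case (elim s)
    have "integrable M (\<lambda>x. f s x - f r x)"
      by (rule integrable_const_bound[of _ "B * \<bar>s - r\<bar>"]) (use elim in auto)
    then have "integrable M (\<lambda>x. (f s x - f r x) + f r x)"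
      using int0 by (rule Bochner_Integration.integrable_add)
    then show ?case using int0 by simp
  qed
  moreover have "((\<lambda>s. \<integral>x. (f s x - f r x) / (s - r) \<partial>M) \<longlongrightarrow> (\<integral>x. f' x \<partial>M)) (at r)"
    unfolding tendsto_at_iff_sequentially comp_def
  proof (intro allI impI)
    fix X :: "nat \<Rightarrow> real" assume X: "\<forall>i. X i \<in> UNIV - {r}" "X \<longlonglongrightarrow> r"
    then have X': "filterlim X (at r) sequentially"
      by (auto simp: filterlim_at)
    have "\<forall>\<^sub>F n in sequentially. \<forall>x\<in>space M. \<bar>f (X n) x - f r x\<bar> \<le> B * \<bar>X n - r\<bar>"
      using B(3) X' by (rule eventually_compose_filterlim)
    then obtain N where N: "\<And>n x. n \<ge> N \<Longrightarrow> x \<in> space M \<Longrightarrow> \<bar>f (X n) x - f r x\<bar> \<le> B * \<bar>X n - r\<bar>"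
      by (auto simp: eventually_sequentially)
    \<comment> \<open>The quotients are bounded only close to \<open>r\<close>, that is from the
      term \<open>N\<close> on; the shift makes the bound hold along the whole sequence.\<close>
    have "(\<lambda>n. \<integral>x. (f (X (n + N)) x - f r x) / (X (n + N) - r) \<partial>M) \<longlonglongrightarrow> (\<integral>x. f' x \<partial>M)"
    proof (rule integral_dominated_convergence[where w = "\<lambda>_. B"])
      show "AE x in M. (\<lambda>n. (f (X (n + N)) x - f r x) / (X (n + N) - r)) \<longlonglongrightarrow> f' x"
      proof (rule AE_I2)
        fix x assume "x \<in> space M"
        then have "((\<lambda>s. (f s x - f r x) / (s - r)) \<longlongrightarrow> f' x) (at r)"
          using u by (auto simp: uderiv_def has_field_derivative_iff)
        from filterlim_compose[OF this X'] show "(\<lambda>n. (f (X (n + N)) x - f r x) / (X (n + N) - r)) \<longlonglongrightarrow> f' x"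
          by (rule LIMSEQ_ignore_initial_segment)
      qed
      show "AE x in M. norm ((f (X (i + N)) x - f r x) / (X (i + N) - r)) \<le> B" for i
        using N[of "i + N"] X(1) by (auto simp: divide_le_eq)
    qed auto
    then show "(\<lambda>n. \<integral>x. (f (X n) x - f r x) / (X n - r) \<partial>M) \<longlonglongrightarrow> (\<integral>x. f' x \<partial>M)"
      by (rule LIMSEQ_offset)
  qed
  ultimately show ?thesis
    unfolding has_field_derivative_iff by (subst tendsto_cong) 
qed

lemma uderiv_const:
  assumes "g \<in> borel_measurable M" "\<And>x. x \<in> space M \<Longrightarrow> \<bar>g x\<bar> \<le> B"
  shows "uderiv M (\<lambda>_. g) (\<lambda>_. 0) r"
  unfolding uderiv_def using assms
  by (auto intro!: exI[of _ "\<bar>B\<bar>"] intro: order_trans[OF _ abs_ge_self])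

lemma uderiv_real:
  assumes "(g has_real_derivative g') (at r)"
  shows "uderiv M (\<lambda>s _. g s) (\<lambda>_. g') r"
proof -
  define B where "B = max \<bar>g r\<bar> (\<bar>g'\<bar> + 1)"
  have "((\<lambda>s. \<bar>(g s - g r) / (s - r)\<bar>) \<longlongrightarrow> \<bar>g'\<bar>) (at r)"
    using assms unfolding has_field_derivative_iff by (intro tendsto_intros)
  then have "\<forall>\<^sub>F s in at r. \<bar>(g s - g r) / (s - r)\<bar> < \<bar>g'\<bar> + 1"
    by (rule order_tendstoD) simp
  moreover have "\<forall>\<^sub>F s in at r. s \<noteq> r" by (simp add: eventually_at_filter)
  ultimately have "\<forall>\<^sub>F s in at r. \<forall>x\<in>space M. \<bar>g s - g r\<bar> \<le> B * \<bar>s - r\<bar>"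
  proof eventually_elim
    case (elim s)
    then have "\<bar>g s - g r\<bar> \<le> (\<bar>g'\<bar> + 1) * \<bar>s - r\<bar>" by (simp add: divide_less_eq)
    also have "\<dots> \<le> B * \<bar>s - r\<bar>" by (intro mult_right_mono) (auto simp: B_def)
    finally show ?case by simp
  qed
  then show ?thesis unfolding uderiv_def using assms
    by (auto intro!: exI[of _ B] simp: B_def)
qed

lemma uderiv_add:
  assumes f: "uderiv M f f' r" and g: "uderiv M g g' r"
  shows "uderiv M (\<lambda>s x. f s x + g s x) (\<lambda>x. f' x + g' x) r"
proof -
  obtain B where B: "B \<ge> 1" "\<forall>x\<in>space M. \<bar>f r x\<bar> \<le> B"
    "\<forall>\<^sub>F s in at r. \<forall>x\<in>space M. \<bar>f s x - f r x\<bar> \<le> B * \<bar>s - r\<bar>"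
    by (rule uderivE[OF f])
  obtain C where C: "C \<ge> 1" "\<forall>x\<in>space M. \<bar>g r x\<bar> \<le> C"
    "\<forall>\<^sub>F s in at r. \<forall>x\<in>space M. \<bar>g s x - g r x\<bar> \<le> C * \<bar>s - r\<bar>"
    by (rule uderivE[OF g])
  have "\<forall>\<^sub>F s in at r. \<forall>x\<in>space M. \<bar>(f s x + g s x) - (f r x + g r x)\<bar> \<le> (B + C) * \<bar>s - r\<bar>"
    using B(3) C(3)
  proof eventually_elim
    case (elim s)
    show ?case
    proof
      fix x assume "x \<in> space M"
      then have "\<bar>f s x - f r x\<bar> \<le> B * \<bar>s - r\<bar>" "\<bar>g s x - g r x\<bar> \<le> C * \<bar>s - r\<bar>" using elim by auto
      then show "\<bar>(f s x + g s x) - (f r x + g r x)\<bar> \<le> (B + C) * \<bar>s - r\<bar>" 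
        unfolding distrib_right by linarith
    qed
  qed
  moreover have "\<forall>x\<in>space M. \<bar>f r x + g r x\<bar> \<le> B + C" using B(2) C(2) by fastforce
  ultimately show ?thesis using f g unfolding uderiv_def
    by (auto intro!: borel_measurable_add derivative_intros exI[of _ "B + C"])
qed

lemma uderiv_mult:
  assumes f: "uderiv M f f' r" and g: "uderiv M g g' r"
  shows "uderiv M (\<lambda>s x. f s x * g s x) (\<lambda>x. f' x * g r x + f r x * g' x) r"
proof -
  obtain B where B: "B \<ge> 1" "\<forall>x\<in>space M. \<bar>f r x\<bar> \<le> B"
    "\<forall>\<^sub>F s in at r. \<forall>x\<in>space M. \<bar>f s x - f r x\<bar> \<le> B * \<bar>s - r\<bar>"
    by (rule uderivE[OF f])
  obtain C where C: "C \<ge> 1" "\<forall>x\<in>space M. \<bar>g r x\<bar> \<le> C"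
    "\<forall>\<^sub>F s in at r. \<forall>x\<in>space M. \<bar>g s x - g r x\<bar> \<le> C * \<bar>s - r\<bar>"
    by (rule uderivE[OF g])
  have "\<forall>\<^sub>F s in at r. dist s r < 1" by (auto simp: eventually_at intro!: exI[of _ 1])
  with B(3) C(3) have "\<forall>\<^sub>F s in at r. \<forall>x\<in>space M. \<bar>f s x * g s x - f r x * g r x\<bar> \<le> (3 * B * C) * \<bar>s - r\<bar>"
  proof eventually_elim
    case (elim s)
    show ?case
    proof
      fix x assume x: "x \<in> space M"
      let ?u = "f s x - f r x" let ?v = "g s x - g r x" let ?e = "\<bar>s - r\<bar>"
      have u: "\<bar>?u\<bar> \<le> B * ?e" and v: "\<bar>?v\<bar> \<le> C * ?e" and fr: "\<bar>f r x\<bar> \<le> B" and gr: "\<bar>g r x\<bar> \<le> C"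
        using elim x B C by auto
      have e: "?e \<le> 1" using elim by (simp add: dist_real_def)
      have BC: "0 \<le> B" "0 \<le> C" using B C by auto
      \<comment> \<open>Expanding around \<open>r\<close> leaves three terms, hence the factor 3;
        the quadratic one becomes linear because |s - r| is at most 1.\<close>
      have "f s x * g s x - f r x * g r x = ?u * g r x + f r x * ?v + ?u * ?v"
        by (simp add: algebra_simps)
      moreover have "\<bar>?u * g r x\<bar> \<le> (B * ?e) * C" unfolding abs_mult using u gr BC by (intro mult_mono) auto
      moreover have "\<bar>f r x * ?v\<bar> \<le> B * (C * ?e)" unfolding abs_mult using v fr BC by (intro mult_mono) auto
      moreover have "\<bar>?u * ?v\<bar> \<le> (B * ?e) * (C * 1)" unfolding abs_mult 
        using u order_trans[OF v mult_left_mono[OF e]] BC by (intro mult_mono) auto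
      ultimately show "\<bar>f s x * g s x - f r x * g r x\<bar> \<le> (3 * B * C) * ?e"
        by (simp add: algebra_simps)
    qed
  qed
  moreover have "\<forall>x\<in>space M. \<bar>f r x * g r x\<bar> \<le> 3 * B * C"
  proof
    fix x assume "x \<in> space M"
    then have "\<bar>f r x * g r x\<bar> \<le> B * C" unfolding abs_mult using B C by (intro mult_mono) auto
    moreover have "0 \<le> B * C" using B(1) C(1) by simp
    ultimately show "\<bar>f r x * g r x\<bar> \<le> 3 * B * C" by linarith
  qed
  ultimately show ?thesis using f g unfolding uderiv_def
    by (auto intro!: borel_measurable_add borel_measurable_times derivative_eq_intros exI[of _ "3 * B * C"])
qed

lemma uderiv_sum:
  assumes "finite I" "\<And>i. i \<in> I \<Longrightarrow> uderiv M (f i) (f' i) r"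
  shows "uderiv M (\<lambda>s x. \<Sum>i\<in>I. f i s x) (\<lambda>x. \<Sum>i\<in>I. f' i x) r"
  using assms
proof (induction rule: finite_induct)
  case empty
  then show ?case using uderiv_const[of "\<lambda>_. 0" M 0] by simp
next
  case (insert i I)
  then show ?case using uderiv_add[of M "f i" "f' i"] by simp
qed

text \<open>The tangent at the larger argument lies below the graph, so the increment is at most the
  slope there, which is at most \<open>exp c\<close>, times the distance.\<close>

lemma abs_exp_diff_le:
  fixes a b c :: real
  assumes "a \<le> c" "b \<le> c"
  shows "\<bar>exp a - exp b\<bar> \<le> exp c * \<bar>a - b\<bar>"
proof -
  have *: "exp y - exp x \<le> exp c * (y - x)" if "x \<le> y" "y \<le> c" for x y :: real
  proof -
    have "exp y * (1 + (x - y)) \<le> exp y * exp (x - y)" by (intro mult_left_mono exp_ge_add_one_self) auto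
    then have "exp y - exp x \<le> exp y * (y - x)" by (simp add: exp_diff algebra_simps)
    also have "\<dots> \<le> exp c * (y - x)" using that by (intro mult_right_mono) auto
    finally show ?thesis .
  qed
  show ?thesis
    using *[of a b] *[of b a] assms by (cases "a \<le> b") auto
qed

lemma uderiv_exp:
  assumes f: "uderiv M f f' r"
  shows "uderiv M (\<lambda>s x. exp (f s x)) (\<lambda>x. exp (f r x) * f' x) r"
proof -
  obtain B where B: "B \<ge> 1" "\<forall>x\<in>space M. \<bar>f r x\<bar> \<le> B"
    "\<forall>\<^sub>F s in at r. \<forall>x\<in>space M. \<bar>f s x - f r x\<bar> \<le> B * \<bar>s - r\<bar>"
    by (rule uderivE[OF f])
  have "\<forall>\<^sub>F s in at r. dist s r < 1" by (auto simp: eventually_at intro!: exI[of _ 1])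
  with B(3) have "\<forall>\<^sub>F s in at r. \<forall>x\<in>space M. \<bar>exp (f s x) - exp (f r x)\<bar> \<le> (B * exp (2 * B)) * \<bar>s - r\<bar>"
  proof eventually_elim
    case (elim s)
    show ?case
    proof
      fix x assume x: "x \<in> space M"
      have u: "\<bar>f s x - f r x\<bar> \<le> B * \<bar>s - r\<bar>" and fr: "\<bar>f r x\<bar> \<le> B" using elim x B by auto
      \<comment> \<open>For |s - r| < 1 the exponent moves by at most \<open>B\<close>, so both
        exponents stay below \<open>2 * B\<close>; this explains the constant.\<close>
      have "B * \<bar>s - r\<bar> \<le> B * 1" using elim B(1) by (intro mult_left_mono) (auto simp: dist_real_def)
      then have "f s x \<le> 2 * B" "f r x \<le> 2 * B" using u fr B(1) by linarith+
      from abs_exp_diff_le[OF this] have "\<bar>exp (f s x) - exp (f r x)\<bar> \<le> exp (2 * B) * \<bar>f s x - f r x\<bar>" .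
      also have "\<dots> \<le> exp (2 * B) * (B * \<bar>s - r\<bar>)" using u by (intro mult_left_mono) auto
      finally show "\<bar>exp (f s x) - exp (f r x)\<bar> \<le> (B * exp (2 * B)) * \<bar>s - r\<bar>" by (simp add: algebra_simps)
    qed
  qed
  moreover have "\<forall>x\<in>space M. \<bar>exp (f r x)\<bar> \<le> B * exp (2 * B)"
  proof
    fix x assume "x \<in> space M"
    then have "f r x \<le> 2 * B" using B by fastforce
    then have "1 * exp (f r x) \<le> B * exp (2 * B)" using B(1) by (intro mult_mono) auto
    then show "\<bar>exp (f r x)\<bar> \<le> B * exp (2 * B)" by simp
  qed
  ultimately show ?thesis using f unfolding uderiv_def
    by (auto intro!: borel_measurable_times measurable_compose[OF _ borel_measurable_exp] derivative_eq_intros exI[of _ "B * exp (2 * B)"])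
qed

subsection \<open>Replicas of the tilted law\<close>

lemma norm_d_nonneg [simp]: "0 \<le> norm_d d x"
  by (simp add: norm_d_def)

lemma inner_d_self: "inner_d d x x = (norm_d d x)\<^sup>2"
  by (simp add: inner_d_def norm_d_def L2_set_def power2_eq_square[symmetric] sum_nonneg)

lemma abs_inner_d_le: "\<bar>inner_d d x y\<bar> \<le> norm_d d x * norm_d d y"
proof -
  have "\<bar>inner_d d x y\<bar> \<le> (\<Sum>i<d. \<bar>x i\<bar> * \<bar>y i\<bar>)"
    unfolding inner_d_def by (rule order_trans[OF sum_abs]) (simp add: abs_mult)
  also have "\<dots> \<le> norm_d d x * norm_d d y"
    unfolding norm_d_def by (rule L2_set_mult_ineq)
  finally show ?thesis .
qed

lemma inner_d_simps:
  "inner_d d (\<lambda>k. x k + x' k) y = inner_d d x y + inner_d d x' y"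
  "inner_d d (\<lambda>k. x k - x' k) y = inner_d d x y - inner_d d x' y"
  "inner_d d (\<lambda>k. c * x k) y = c * inner_d d x y"
  "inner_d d (\<lambda>k. - x k) y = - inner_d d x y"
  by (simp_all add: inner_d_def sum.distrib sum_subtractf algebra_simps sum_distrib_left sum_negf)

lemma abs_component_le_norm_d: "i < d \<Longrightarrow> \<bar>x i\<bar> \<le> norm_d d x"
  using member_le_L2_set[of "{..<d}" i "\<lambda>i. \<bar>x i\<bar>"] by (simp add: norm_d_def L2_set_def)

text \<open>\<open>Y\<close> is bounded at every point and not only almost everywhere, so that
  weights and integrands are bounded functions and integrable without further argument. For the law
  of the initial value, \<open>Y\<close> will be the identity altered on a null set.\<close>

locale tilt = prob_space M for M :: "'a measure" +
  fixes Y :: "'a \<Rightarrow> nat \<Rightarrow> real" and d :: nat and R :: real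
  assumes Y_measurable: "\<And>k. k < d \<Longrightarrow> (\<lambda>\<omega>. Y \<omega> k) \<in> borel_measurable M"
    and Y_bound: "\<And>\<omega>. norm_d d (Y \<omega>) \<le> R"
begin

abbreviation prodM :: "nat \<Rightarrow> (nat \<Rightarrow> 'a) measure" where
  "prodM n \<equiv> Pi\<^sub>M {..<n} (\<lambda>_. M)"

definition logw :: "real \<Rightarrow> (nat \<Rightarrow> real) \<Rightarrow> 'a \<Rightarrow> real" where
  "logw l h \<omega> = inner_d d h (Y \<omega>) - l / 2 * inner_d d (Y \<omega>) (Y \<omega>)"

definition wt :: "real \<Rightarrow> (nat \<Rightarrow> real) \<Rightarrow> 'a \<Rightarrow> real" where
  "wt l h \<omega> = exp (logw l h \<omega>)"

definition partition_fn :: "real \<Rightarrow> (nat \<Rightarrow> real) \<Rightarrow> real" where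
  "partition_fn l h = (\<integral>\<omega>. wt l h \<omega> \<partial>M)"

text \<open>The expectation under \<open>n\<close> independent copies of the tilted law. The
  reference measure stays untilted: \<open>l\<close> and \<open>h\<close> then occur only in the
  integrand and can be differentiated under the integral.\<close>

definition replica_mean :: "nat \<Rightarrow> real \<Rightarrow> (nat \<Rightarrow> real) \<Rightarrow> ((nat \<Rightarrow> 'a) \<Rightarrow> real) \<Rightarrow> real" where
  "replica_mean n l h G = (\<integral>ys. G ys * (\<Prod>i<n. wt l h (ys i)) \<partial>prodM n) / partition_fn l h ^ n"

definition tilt_mean :: "real \<Rightarrow> (nat \<Rightarrow> real) \<Rightarrow> ('a \<Rightarrow> real) \<Rightarrow> real" where
  "tilt_mean l h g = (\<integral>\<omega>. g \<omega> * wt l h \<omega> \<partial>M) / partition_fn l h"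

definition bounded_meas :: "('a \<Rightarrow> real) \<Rightarrow> bool" where
  "bounded_meas g \<longleftrightarrow> g \<in> borel_measurable M \<and> (\<exists>B. \<forall>\<omega>. \<bar>g \<omega>\<bar> \<le> B)"

text \<open>The last clause makes \<open>G\<close> a function of the first \<open>n\<close>
  coordinates even at arguments that are not extensional, so that the same \<open>G\<close> can be
  read over any larger number of replicas.\<close>

definition admissible :: "nat \<Rightarrow> ((nat \<Rightarrow> 'a) \<Rightarrow> real) \<Rightarrow> bool" where
  "admissible n G \<longleftrightarrow> G \<in> borel_measurable (prodM n) \<and> (\<exists>B. \<forall>ys. \<bar>G ys\<bar> \<le> B) \<and>
     (\<forall>ys zs. (\<forall>i<n. ys i = zs i) \<longrightarrow> G ys = G zs)"

lemma R_nonneg: "0 \<le> R"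
  using Y_bound[of undefined] norm_d_nonneg[of d "Y undefined"] by linarith

lemma abs_inner_Y_le: "\<bar>inner_d d h (Y \<omega>)\<bar> \<le> norm_d d h * R"
  by (rule order_trans[OF abs_inner_d_le]) (intro mult_left_mono Y_bound norm_d_nonneg)

lemma abs_inner_YY_le: "\<bar>inner_d d (Y \<omega>) (Y \<omega>')\<bar> \<le> R\<^sup>2"
proof -
  have "norm_d d (Y \<omega>) * norm_d d (Y \<omega>') \<le> R * R"
    by (intro mult_mono Y_bound R_nonneg norm_d_nonneg)
  then show ?thesis using abs_inner_d_le[of d "Y \<omega>" "Y \<omega>'"] by (simp add: power2_eq_square)
qed

lemma abs_Y_le: "k < d \<Longrightarrow> \<bar>Y \<omega> k\<bar> \<le> R"
  using abs_component_le_norm_d[of k d "Y \<omega>"] Y_bound[of \<omega>] by linarith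

section \<open>Bounded observables of one sample\<close>

lemma bounded_meas_const: "bounded_meas (\<lambda>_. c)" unfolding bounded_meas_def by auto

lemma bounded_meas_add: "bounded_meas f \<Longrightarrow> bounded_meas g \<Longrightarrow> bounded_meas (\<lambda>x. f x + g x)"
proof -
  assume a: "bounded_meas f" "bounded_meas g"
  then obtain B C where "\<And>x. \<bar>f x\<bar> \<le> B" "\<And>x. \<bar>g x\<bar> \<le> C" by (auto simp: bounded_meas_def)
  then have "\<bar>f x + g x\<bar> \<le> B + C" for x by (meson abs_triangle_ineq add_mono order_trans)
  then show ?thesis using a unfolding bounded_meas_def by (auto intro!: borel_measurable_add)
qed

lemma bounded_meas_mult: "bounded_meas f \<Longrightarrow> bounded_meas g \<Longrightarrow> bounded_meas (\<lambda>x. f x * g x)"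
proof -
  assume a: "bounded_meas f" "bounded_meas g"
  then obtain B C where B: "\<And>x. \<bar>f x\<bar> \<le> B" "\<And>x. \<bar>g x\<bar> \<le> C" by (auto simp: bounded_meas_def)
  then have "\<bar>f x * g x\<bar> \<le> B * C" for x
    unfolding abs_mult by (intro mult_mono) (auto intro: order_trans[OF abs_ge_zero])
  then show ?thesis using a unfolding bounded_meas_def by (auto intro!: borel_measurable_times)
qed

lemma bounded_meas_diff: "bounded_meas f \<Longrightarrow> bounded_meas g \<Longrightarrow> bounded_meas (\<lambda>x. f x - g x)"
  using bounded_meas_add[of f "\<lambda>x. - 1 * g x"] bounded_meas_mult[OF bounded_meas_const, of g "-1"] by simp

lemma bounded_meas_sum: "(\<And>i. i \<in> I \<Longrightarrow> bounded_meas (f i)) \<Longrightarrow> bounded_meas (\<lambda>x. \<Sum>i\<in>I. f i x)"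
  by (induction I rule: infinite_finite_induct) (auto intro: bounded_meas_add bounded_meas_const)

lemma bounded_meas_power: "bounded_meas f \<Longrightarrow> bounded_meas (\<lambda>x. f x ^ q)"
  by (induction q) (auto intro: bounded_meas_mult bounded_meas_const)

lemma bounded_meas_exp: "bounded_meas f \<Longrightarrow> bounded_meas (\<lambda>x. exp (f x))"
proof -
  assume a: "bounded_meas f"
  then obtain B where "\<And>x. \<bar>f x\<bar> \<le> B" by (auto simp: bounded_meas_def)
  then have "\<bar>exp (f x)\<bar> \<le> exp B" for x by (simp add: abs_le_D1)
  then show ?thesis using a unfolding bounded_meas_def by (auto intro: measurable_compose[OF _ borel_measurable_exp])
qed

lemma bounded_meas_Y: "k < d \<Longrightarrow> bounded_meas (\<lambda>\<omega>. Y \<omega> k)"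
  using Y_measurable abs_Y_le unfolding bounded_meas_def by blast

lemma bounded_meas_inner: "bounded_meas (\<lambda>\<omega>. inner_d d h (Y \<omega>))"
  unfolding inner_d_def by (intro bounded_meas_sum bounded_meas_mult bounded_meas_const bounded_meas_Y) auto

lemma bounded_meas_inner_YY: "bounded_meas (\<lambda>\<omega>. inner_d d (Y \<omega>) (Y \<omega>))"
  unfolding inner_d_def by (intro bounded_meas_sum bounded_meas_mult bounded_meas_const bounded_meas_Y) auto

lemma bounded_meas_logw: "bounded_meas (logw l h)"
  unfolding logw_def[abs_def] by (intro bounded_meas_diff bounded_meas_mult bounded_meas_const bounded_meas_inner bounded_meas_inner_YY)

lemma bounded_meas_wt: "bounded_meas (wt l h)"
  unfolding wt_def[abs_def] by (intro bounded_meas_exp bounded_meas_logw)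

lemma bounded_meas_integrable: "bounded_meas g \<Longrightarrow> integrable M g"
  unfolding bounded_meas_def by (auto intro!: integrable_const_bound AE_I2)

lemma partition_fn_pos: "0 < partition_fn l h"
  unfolding partition_fn_def using integral_less_AE_space[of "\<lambda>_. 0" "wt l h"] bounded_meas_integrable[OF bounded_meas_wt]
  by (simp add: emeasure_space_1 wt_def)

lemma product_prob_space_prodM: "product_prob_space (\<lambda>_::nat. M)"
  by (intro product_prob_spaceI prob_space_axioms)

lemma prob_space_prodM: "prob_space (prodM n)"
  by (intro prob_space_PiM prob_space_axioms)

section \<open>Bounded observables of finitely many replicas\<close>

lemma admissible_const: "admissible n (\<lambda>_. c)" unfolding admissible_def by auto

lemma admissible_add: "admissible n f \<Longrightarrow> admissible n g \<Longrightarrow> admissible n (\<lambda>x. f x + g x)"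
proof -
  assume a: "admissible n f" "admissible n g"
  then obtain B C where "\<And>x. \<bar>f x\<bar> \<le> B" "\<And>x. \<bar>g x\<bar> \<le> C" by (auto simp: admissible_def)
  then have "\<bar>f x + g x\<bar> \<le> B + C" for x by (meson abs_triangle_ineq add_mono order_trans)
  moreover have "f ys + g ys = f zs + g zs" if "\<forall>i<n. ys i = zs i" for ys zs
    using a that unfolding admissible_def by metis
  ultimately show ?thesis using a unfolding admissible_def by (auto intro!: borel_measurable_add)
qed

lemma admissible_mult: "admissible n f \<Longrightarrow> admissible n g \<Longrightarrow> admissible n (\<lambda>x. f x * g x)"
proof -
  assume a: "admissible n f" "admissible n g"
  then obtain B C where B: "\<And>x. \<bar>f x\<bar> \<le> B" "\<And>x. \<bar>g x\<bar> \<le> C" by (auto simp: admissible_def)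
  then have "\<bar>f x * g x\<bar> \<le> B * C" for x
    unfolding abs_mult by (intro mult_mono) (auto intro: order_trans[OF abs_ge_zero])
  moreover have "f ys * g ys = f zs * g zs" if "\<forall>i<n. ys i = zs i" for ys zs
    using a that unfolding admissible_def by metis
  ultimately show ?thesis using a unfolding admissible_def by (auto intro!: borel_measurable_times)
qed

lemma admissible_diff: "admissible n f \<Longrightarrow> admissible n g \<Longrightarrow> admissible n (\<lambda>x. f x - g x)"
  using admissible_add[of n f "\<lambda>x. - 1 * g x"] admissible_mult[OF admissible_const, of n g "-1"] by simp

lemma admissible_sum: "(\<And>i. i \<in> I \<Longrightarrow> admissible n (f i)) \<Longrightarrow> admissible n (\<lambda>x. \<Sum>i\<in>I. f i x)"
  by (induction I rule: infinite_finite_induct) (auto intro: admissible_add admissible_const)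

lemma admissible_prod: "(\<And>i. i \<in> I \<Longrightarrow> admissible n (f i)) \<Longrightarrow> admissible n (\<lambda>x. \<Prod>i\<in>I. f i x)"
  by (induction I rule: infinite_finite_induct) (auto intro: admissible_mult admissible_const)

lemma admissible_power: "admissible n f \<Longrightarrow> admissible n (\<lambda>x. f x ^ q)"
  by (induction q) (auto intro: admissible_mult admissible_const)

lemma admissible_coord: "bounded_meas g \<Longrightarrow> i < n \<Longrightarrow> admissible n (\<lambda>ys. g (ys i))"
  unfolding bounded_meas_def admissible_def
  by (auto intro: measurable_compose[OF measurable_component_singleton])

text \<open>Such a \<open>G\<close> factors through restriction to the first \<open>n\<close>
  coordinates, which is measurable between the two product spaces.\<close>

lemma admissible_mono:
  assumes "n \<le> m" "admissible n G" shows "admissible m G"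
proof -
  have eq: "G ys = G (restrict ys {..<n})" for ys
    using assms(2) unfolding admissible_def by (metis lessThan_iff restrict_apply)
  have "(\<lambda>ys. restrict ys {..<n}) \<in> measurable (prodM m) (prodM n)"
    using assms(1) by (intro measurable_restrict_subset) auto
  moreover have "G \<in> borel_measurable (prodM n)" using assms(2) by (simp add: admissible_def)
  ultimately have "(\<lambda>ys. G (restrict ys {..<n})) \<in> borel_measurable (prodM m)"
    by (rule measurable_compose)
  then have "G \<in> borel_measurable (prodM m)" using eq by (simp flip: eq)
  then show ?thesis using assms unfolding admissible_def by auto
qed

lemma admissible_integrable: "admissible n G \<Longrightarrow> integrable (prodM n) G"
proof -
  assume a: "admissible n G"
  interpret Pn: prob_space "prodM n" by (rule prob_space_prodM)
  show ?thesis using a unfolding admissible_def by (auto intro!: Pn.integrable_const_bound AE_I2)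
qed

lemma admissible_wprod: "n \<le> m \<Longrightarrow> admissible m (\<lambda>ys. \<Prod>i<n. wt l h (ys i))"
  by (intro admissible_prod admissible_coord bounded_meas_wt) auto

section \<open>Independence, linearity and monotonicity of replica means\<close>

lemma integral_Suc:
  assumes G: "admissible n G" and g: "bounded_meas g"
  shows "(\<integral>ys. G ys * g (ys n) \<partial>prodM (Suc n)) = (\<integral>ys. G ys \<partial>prodM n) * (\<integral>\<omega>. g \<omega> \<partial>M)"
proof -
  interpret P: product_prob_space "\<lambda>_::nat. M" "{..<n}" by (rule product_prob_space_prodM)
  have "admissible (Suc n) (\<lambda>ys. G ys * g (ys n))"
    by (intro admissible_mult admissible_mono[OF _ G] admissible_coord g) auto
  from admissible_integrable[OF this]
  have "integrable (Pi\<^sub>M (insert n {..<n}) (\<lambda>_. M)) (\<lambda>ys. G ys * g (ys n))"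
    by (simp add: lessThan_Suc)
  then have "(\<integral>ys. G ys * g (ys n) \<partial>prodM (Suc n))
      = (\<integral>ys. (\<integral>\<omega>. G (ys(n := \<omega>)) * g ((ys(n := \<omega>)) n) \<partial>M) \<partial>prodM n)"
    unfolding lessThan_Suc by (intro P.product_integral_insert) auto
  also have "\<dots> = (\<integral>ys. G ys * (\<integral>\<omega>. g \<omega> \<partial>M) \<partial>prodM n)"
  proof (intro Bochner_Integration.integral_cong refl)
    fix ys
    have "G (ys(n := \<omega>)) = G ys" for \<omega> using G unfolding admissible_def by (metis fun_upd_other less_irrefl)
    then show "(\<integral>\<omega>. G (ys(n := \<omega>)) * g ((ys(n := \<omega>)) n) \<partial>M) = G ys * (\<integral>\<omega>. g \<omega> \<partial>M)" by simp
  qed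
  also have "\<dots> = (\<integral>ys. G ys \<partial>prodM n) * (\<integral>\<omega>. g \<omega> \<partial>M)" by simp
  finally show ?thesis .
qed

text \<open>The replica with index \<open>n\<close> is independent of those that \<open>G\<close>
  sees. Read from right to left, this absorbs a product of expectations into a single one with a
  further replica, which keeps the calculus closed.\<close>

lemma replica_mean_Suc_mult:
  assumes G: "admissible n G" and g: "bounded_meas g"
  shows "replica_mean (Suc n) l h (\<lambda>ys. G ys * g (ys n)) = replica_mean n l h G * tilt_mean l h g"
proof -
  have "(\<integral>ys. G ys * g (ys n) * (\<Prod>i<Suc n. wt l h (ys i)) \<partial>prodM (Suc n))
      = (\<integral>ys. (G ys * (\<Prod>i<n. wt l h (ys i))) * (g (ys n) * wt l h (ys n)) \<partial>prodM (Suc n))"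
    by (simp add: mult_ac)
  also have "\<dots> = (\<integral>ys. G ys * (\<Prod>i<n. wt l h (ys i)) \<partial>prodM n) * (\<integral>\<omega>. g \<omega> * wt l h \<omega> \<partial>M)"
    by (rule integral_Suc[where g = "\<lambda>\<omega>. g \<omega> * wt l h \<omega>"]) (intro admissible_mult G admissible_wprod bounded_meas_mult g bounded_meas_wt; simp)+
  finally show ?thesis by (simp add: replica_mean_def tilt_mean_def)
qed

lemma tilt_mean_one [simp]: "tilt_mean l h (\<lambda>_. 1) = 1"
  using partition_fn_pos[of l h] by (simp add: tilt_mean_def partition_fn_def)

lemma replica_mean_Suc: "admissible n G \<Longrightarrow> replica_mean (Suc n) l h G = replica_mean n l h G"
  using replica_mean_Suc_mult[of n G "\<lambda>_. 1" l h] by (simp add: bounded_meas_const)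

lemma replica_mean_add: 
  assumes "admissible n F" "admissible n G"
  shows "replica_mean n l h (\<lambda>ys. F ys + G ys) = replica_mean n l h F + replica_mean n l h G"
proof -
  have "integrable (prodM n) (\<lambda>ys. F ys * (\<Prod>i<n. wt l h (ys i)))" "integrable (prodM n) (\<lambda>ys. G ys * (\<Prod>i<n. wt l h (ys i)))"
    by (intro admissible_integrable admissible_mult assms admissible_wprod order_refl)+
  then show ?thesis unfolding replica_mean_def by (simp add: distrib_right add_divide_distrib)
qed

lemma replica_mean_cmult: "replica_mean n l h (\<lambda>ys. c * G ys) = c * replica_mean n l h G"
  unfolding replica_mean_def by (simp add: mult.assoc)

lemma replica_mean_diff: 
  assumes "admissible n F" "admissible n G"
  shows "replica_mean n l h (\<lambda>ys. F ys - G ys) = replica_mean n l h F - replica_mean n l h G"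
  using replica_mean_add[of n F "\<lambda>ys. - 1 * G ys" l h] admissible_mult[OF admissible_const, of n G "-1"] assms
    replica_mean_cmult[of n l h "-1" G] by simp

lemma replica_mean_zero [simp]: "replica_mean n l h (\<lambda>_. 0) = 0"
  by (simp add: replica_mean_def)

lemma replica_mean_sum:
  assumes "finite I" "\<And>i. i \<in> I \<Longrightarrow> admissible n (F i)"
  shows "replica_mean n l h (\<lambda>ys. \<Sum>i\<in>I. F i ys) = (\<Sum>i\<in>I. replica_mean n l h (F i))"
  using assms by (induction rule: finite_induct) (simp_all add: replica_mean_add admissible_sum)

lemma replica_mean_mono:
  assumes "admissible n F" "admissible n G" "\<And>ys. F ys \<le> G ys"
  shows "replica_mean n l h F \<le> replica_mean n l h G"
  unfolding replica_mean_def using partition_fn_pos[of l h]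
  by (intro divide_right_mono integral_mono admissible_integrable admissible_mult assms admissible_wprod mult_right_mono)
    (auto simp: wt_def intro: prod_nonneg)

lemma replica_mean_abs_le:
  assumes "admissible n F" "admissible n G" "\<And>ys. \<bar>F ys\<bar> \<le> G ys"
  shows "\<bar>replica_mean n l h F\<bar> \<le> replica_mean n l h G"
proof -
  have "replica_mean n l h F \<le> replica_mean n l h G" using assms by (intro replica_mean_mono) (auto intro: abs_le_D1)
  moreover have "replica_mean n l h (\<lambda>ys. - 1 * F ys) \<le> replica_mean n l h G"
    using assms by (intro replica_mean_mono admissible_mult admissible_const) (auto intro: abs_le_D2)
  ultimately show ?thesis unfolding replica_mean_cmult by simp
qed

lemma replica_mean_const [simp]: "replica_mean n l h (\<lambda>_. c) = c"
proof (induction n)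
  case 0
  interpret Pn: prob_space "prodM 0" by (rule prob_space_prodM)
  show ?case using Pn.prob_space by (simp add: replica_mean_def)
qed (simp add: replica_mean_Suc admissible_const)

lemma replica_mean_coord:
  assumes "bounded_meas g" "i < n"
  shows "replica_mean n l h (\<lambda>ys. g (ys i)) = tilt_mean l h g"
  using assms(2)
proof (induction n)
  case (Suc n)
  show ?case
  proof (cases "i = n")
    case True
    then show ?thesis using replica_mean_Suc_mult[of n "\<lambda>_. 1" g l h] assms(1) by (simp add: admissible_const)
  next
    case False
    then show ?thesis using Suc assms(1) by (simp add: replica_mean_Suc admissible_coord)
  qed
qed simp

section \<open>Differentiating replica means in the parameters of the tilt\<close>

lemma uderiv_coord:
  assumes "bounded_meas g" "i < n" shows "uderiv (prodM n) (\<lambda>_ ys. g (ys i)) (\<lambda>_. 0) r"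
proof -
  from assms(1) obtain B where "\<And>\<omega>. \<bar>g \<omega>\<bar> \<le> B" by (auto simp: bounded_meas_def)
  then show ?thesis using admissible_coord[OF assms] unfolding admissible_def by (intro uderiv_const[of _ _ B]) auto
qed

lemma uderiv_inner:
  assumes H: "\<And>k. k < d \<Longrightarrow> ((\<lambda>s. H s k) has_real_derivative h' k) (at r)" and i: "i < n"
  shows "uderiv (prodM n) (\<lambda>s ys. inner_d d (H s) (Y (ys i))) (\<lambda>ys. inner_d d h' (Y (ys i))) r"
proof -
  have "uderiv (prodM n) (\<lambda>s ys. \<Sum>k<d. H s k * Y (ys i) k)
      (\<lambda>ys. \<Sum>k<d. h' k * Y (ys i) k + H r k * 0) r"
    by (intro uderiv_sum uderiv_mult uderiv_real H uderiv_coord[OF bounded_meas_Y] i) auto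
  then show ?thesis by (simp add: inner_d_def)
qed

text \<open>The logarithmic weight is linear in the pair (l, h), so its derivative is the same
  expression taken at the velocities.\<close>

lemma uderiv_logw:
  assumes L: "(L has_real_derivative l') (at r)"
    and H: "\<And>k. k < d \<Longrightarrow> ((\<lambda>s. H s k) has_real_derivative h' k) (at r)" and i: "i < n"
  shows "uderiv (prodM n) (\<lambda>s ys. logw (L s) (H s) (ys i)) (\<lambda>ys. logw l' h' (ys i)) r"
proof -
  have L': "((\<lambda>s. - L s / 2) has_real_derivative - l' / 2) (at r)"
    using L by (auto intro!: derivative_eq_intros)
  have "uderiv (prodM n) (\<lambda>s ys. inner_d d (H s) (Y (ys i)) + (- L s / 2) * inner_d d (Y (ys i)) (Y (ys i)))
      (\<lambda>ys. inner_d d h' (Y (ys i)) + ((- l' / 2) * inner_d d (Y (ys i)) (Y (ys i)) + (- L r / 2) * 0)) r"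
    by (intro uderiv_add uderiv_mult uderiv_inner uderiv_real H L' i uderiv_coord[OF bounded_meas_inner_YY])
  then show ?thesis by (simp add: logw_def)
qed

lemma wprod_exp: "(\<Prod>i<(n::nat). wt l h (ys i)) = exp (\<Sum>i<n. logw l h (ys i))"
  unfolding wt_def by (rule exp_sum[symmetric]) simp

lemma partition_fn_has_derivative:
  assumes L: "(L has_real_derivative l') (at r)"
    and H: "\<And>k. k < d \<Longrightarrow> ((\<lambda>s. H s k) has_real_derivative h' k) (at r)"
  shows "((\<lambda>s. partition_fn (L s) (H s)) has_real_derivative (\<integral>\<omega>. logw l' h' \<omega> * wt (L r) (H r) \<omega> \<partial>M)) (at r)"
proof -
  interpret M1: prob_space "prodM 1" by (rule prob_space_prodM)
  interpret P: product_prob_space "\<lambda>_::nat. M" "{..<1}" by (rule product_prob_space_prodM)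
  \<comment> \<open>The derivative of the weight is available on product spaces only, so the
    integral over \<open>M\<close> is computed as one over a single replica.\<close>
  have "uderiv (prodM 1) (\<lambda>s ys. exp (logw (L s) (H s) (ys 0)))
    (\<lambda>ys. exp (logw (L r) (H r) (ys 0)) * logw l' h' (ys 0)) r"
    by (intro uderiv_exp uderiv_logw L H) auto
  from uderiv_integral[OF M1.finite_measure_axioms this]
  have *: "((\<lambda>s. \<integral>ys. wt (L s) (H s) (ys 0) \<partial>prodM 1) has_real_derivative
      (\<integral>ys. logw l' h' (ys 0) * wt (L r) (H r) (ys 0) \<partial>prodM 1)) (at r)"
    by (simp add: wt_def mult.commute)
  have int1: "(\<integral>ys. g (ys 0) \<partial>prodM 1) = (\<integral>\<omega>. g \<omega> \<partial>M)" if "bounded_meas g" for g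
    using P.product_integral_singleton[of g 0] that by (simp add: bounded_meas_def lessThan_Suc)
  show ?thesis using * unfolding partition_fn_def
    by (subst (asm) (1 2) int1) (intro bounded_meas_mult bounded_meas_wt bounded_meas_logw)+
qed

text \<open>The derivative of the normalisation is absorbed by a fresh replica, the one with index \<open>n\<close>.\<close>

lemma replica_mean_has_derivative:
  assumes L: "(L has_real_derivative l') (at r)"
    and H: "\<And>k. k < d \<Longrightarrow> ((\<lambda>s. H s k) has_real_derivative h' k) (at r)"
    and G: "uderiv (prodM n) G G' r" and admG: "admissible n (G r)" and admG': "admissible n G'"
  shows "((\<lambda>s. replica_mean n (L s) (H s) (G s)) has_real_derivative
    replica_mean (Suc n) (L r) (H r) (\<lambda>ys. G' ys + G r ys * (\<Sum>i<n. logw l' h' (ys i) - logw l' h' (ys n)))) (at r)"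
proof -
  let ?W = "\<lambda>s ys. exp (\<Sum>i<n. logw (L s) (H s) (ys i))"
  let ?S = "\<lambda>ys. \<Sum>i<n. logw l' h' (ys i)"
  let ?E = "replica_mean n (L r) (H r)" 
  define N where "N = (\<integral>ys. G r ys * ?W r ys \<partial>prodM n)"
  define N' where "N' = (\<integral>ys. G' ys * ?W r ys + G r ys * (?W r ys * ?S ys) \<partial>prodM n)"
  define z where "z = partition_fn (L r) (H r)"
  define z' where "z' = (\<integral>\<omega>. logw l' h' \<omega> * wt (L r) (H r) \<omega> \<partial>M)"
  interpret Pn: prob_space "prodM n" by (rule prob_space_prodM)
  have admS: "admissible n ?S" by (intro admissible_sum admissible_coord bounded_meas_logw) auto
  have "uderiv (prodM n) (\<lambda>s ys. G s ys * ?W s ys) (\<lambda>ys. G' ys * ?W r ys + G r ys * (?W r ys * ?S ys)) r"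
    by (intro uderiv_mult uderiv_exp uderiv_sum G uderiv_logw L H) auto
  from uderiv_integral[OF Pn.finite_measure_axioms this]
  have dN: "((\<lambda>s. \<integral>ys. G s ys * ?W s ys \<partial>prodM n) has_real_derivative N') (at r)"
    unfolding N'_def .
  have dZ: "((\<lambda>s. partition_fn (L s) (H s)) has_real_derivative z') (at r)"
    unfolding z'_def by (rule partition_fn_has_derivative[OF L H])
  have zpos: "0 < z" unfolding z_def by (rule partition_fn_pos)
  have "((\<lambda>s. (\<integral>ys. G s ys * ?W s ys \<partial>prodM n) / partition_fn (L s) (H s) ^ n) has_real_derivative
      (N' * z ^ n - N * (of_nat n * z ^ (n - 1) * z')) / (z ^ n * z ^ n)) (at r)"
    using zpos by (auto intro!: derivative_eq_intros dN dZ simp: N_def z_def)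
  also have "(\<lambda>s. (\<integral>ys. G s ys * ?W s ys \<partial>prodM n) / partition_fn (L s) (H s) ^ n) = (\<lambda>s. replica_mean n (L s) (H s) (G s))"
    unfolding replica_mean_def wprod_exp ..
  also have "(N' * z ^ n - N * (of_nat n * z ^ (n - 1) * z')) / (z ^ n * z ^ n)
      = N' / z ^ n - of_nat n * (N / z ^ n) * (z' / z)"
    using zpos by (cases n) (auto simp: field_simps)
  also have "N' / z ^ n = ?E (\<lambda>ys. G' ys + G r ys * ?S ys)"
    unfolding replica_mean_def wprod_exp N'_def z_def by (simp add: algebra_simps)
  also have "N / z ^ n = ?E (G r)" unfolding replica_mean_def wprod_exp N_def z_def ..
  also have "z' / z = tilt_mean (L r) (H r) (logw l' h')" unfolding tilt_mean_def z_def z'_def ..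
  \<comment> \<open>The product of two means becomes one mean over \<open>n + 1\<close> replicas.
    The normalisation occurs to the power \<open>n\<close>, so the logarithmic weight of the fresh
    replica is subtracted once for each of the \<open>n\<close> others, which centres the
    sum.\<close>
  also have "?E (\<lambda>ys. G' ys + G r ys * ?S ys) - of_nat n * ?E (G r) * tilt_mean (L r) (H r) (logw l' h')
    = replica_mean (Suc n) (L r) (H r) (\<lambda>ys. (G' ys + G r ys * ?S ys) - of_nat n * (G r ys * logw l' h' (ys n)))"
  proof -
    have "admissible n (\<lambda>ys. G' ys + G r ys * ?S ys)" by (intro admissible_add admissible_mult admG admG' admS)
    moreover have "admissible (Suc n) (\<lambda>ys. G r ys * logw l' h' (ys n))"
      by (intro admissible_mult admissible_mono[OF _ admG] admissible_coord bounded_meas_logw) auto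
    ultimately show ?thesis
      by (subst replica_mean_diff) (simp_all add: replica_mean_Suc replica_mean_cmult replica_mean_Suc_mult admG bounded_meas_logw admissible_mult admissible_const
          admissible_mono[of n "Suc n"])
  qed
  also have "(\<lambda>ys. (G' ys + G r ys * ?S ys) - of_nat n * (G r ys * logw l' h' (ys n)))
    = (\<lambda>ys. G' ys + G r ys * (\<Sum>i<n. logw l' h' (ys i) - logw l' h' (ys n)))"
    by (simp add: sum_subtractf algebra_simps)
  finally show ?thesis .
qed

end

subsection \<open>Moment expressions\<close>

text \<open>Syntax for the integrands. An expression mentions neither \<open>d\<close> nor \<open>P\<^sub>0\<close>, so every constant computed
  from it is universal. A \<open>Pol\<close> is evaluated at \<open>1 + l = 1 / (1 - exp (-t))\<close>.\<close>

datatype moment_expr = Pol "real poly" | Gap nat nat | Gram nat nat | Add moment_expr moment_expr | Mul moment_expr moment_expr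

primrec expr_val :: "nat \<Rightarrow> real \<Rightarrow> (nat \<Rightarrow> real) \<Rightarrow> (nat \<Rightarrow> nat \<Rightarrow> real) \<Rightarrow> moment_expr \<Rightarrow> real" where
  "expr_val d l h y (Pol p) = poly p (1 + l)"
| "expr_val d l h y (Gap i j) = inner_d d h (y i) - inner_d d h (y j)"
| "expr_val d l h y (Gram i j) = l * inner_d d (y i) (y j)"
| "expr_val d l h y (Add a b) = expr_val d l h y a + expr_val d l h y b"
| "expr_val d l h y (Mul a b) = expr_val d l h y a * expr_val d l h y b"

primrec expr_deriv :: "nat \<Rightarrow> real \<Rightarrow> (nat \<Rightarrow> real) \<Rightarrow> real \<Rightarrow> (nat \<Rightarrow> real) \<Rightarrow> (nat \<Rightarrow> nat \<Rightarrow> real) \<Rightarrow> moment_expr \<Rightarrow> real" where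
  "expr_deriv d l h l' h' y (Pol p) = l' * poly (pderiv p) (1 + l)"
| "expr_deriv d l h l' h' y (Gap i j) = inner_d d h' (y i) - inner_d d h' (y j)"
| "expr_deriv d l h l' h' y (Gram i j) = l' * inner_d d (y i) (y j)"
| "expr_deriv d l h l' h' y (Add a b) = expr_deriv d l h l' h' y a + expr_deriv d l h l' h' y b"
| "expr_deriv d l h l' h' y (Mul a b) = expr_deriv d l h l' h' y a * expr_val d l h y b + expr_val d l h y a * expr_deriv d l h l' h' y b"

primrec replicas :: "moment_expr \<Rightarrow> nat set" where
  "replicas (Pol p) = {}"
| "replicas (Gap i j) = {i, j}"
| "replicas (Gram i j) = {i, j}"
| "replicas (Add a b) = replicas a \<union> replicas b"
| "replicas (Mul a b) = replicas a \<union> replicas b"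

text \<open>The degree in eta = 1 + l, or rather an upper bound for it, as cancellations in a sum
  are not seen.\<close>

primrec deg_eta :: "moment_expr \<Rightarrow> nat" where
  "deg_eta (Pol p) = degree p"
| "deg_eta (Gap i j) = 0"
| "deg_eta (Gram i j) = 0"
| "deg_eta (Add a b) = max (deg_eta a) (deg_eta b)"
| "deg_eta (Mul a b) = deg_eta a + deg_eta b"

text \<open>Gaps and Gram entries count alike because one random quantity, \<open>size_bd\<close>,
  will dominate both.\<close>

primrec deg_atom :: "moment_expr \<Rightarrow> nat" where
  "deg_atom (Pol p) = 0"
| "deg_atom (Gap i j) = 1"
| "deg_atom (Gram i j) = 1"
| "deg_atom (Add a b) = max (deg_atom a) (deg_atom b)"
| "deg_atom (Mul a b) = deg_atom a + deg_atom b"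

definition poly_norm :: "real poly \<Rightarrow> real" where
  "poly_norm p = (\<Sum>i\<le>degree p. \<bar>coeff p i\<bar>)"

primrec coef_bd :: "moment_expr \<Rightarrow> real" where
  "coef_bd (Pol p) = poly_norm p"
| "coef_bd (Gap i j) = 1"
| "coef_bd (Gram i j) = 1"
| "coef_bd (Add a b) = coef_bd a + coef_bd b"
| "coef_bd (Mul a b) = coef_bd a * coef_bd b"

text \<open>Only derivatives in h matter here, with l fixed, which is why polynomials and Gram
  entries contribute 0; a gap contributes 2 for its two inner products.\<close>

primrec grad_bd :: "moment_expr \<Rightarrow> real" where
  "grad_bd (Pol p) = 0"
| "grad_bd (Gap i j) = 2"
| "grad_bd (Gram i j) = 0"
| "grad_bd (Add a b) = grad_bd a + grad_bd b"
| "grad_bd (Mul a b) = grad_bd a * coef_bd b + coef_bd a * grad_bd b"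

text \<open>The derivative along \<open>L l = l (1 + l)\<close>, \<open>L h = (1 + l) (h + l m) / 2\<close>, where the mean \<open>m\<close> is
  represented by the replica with index \<open>k\<close>. Likewise \<open>flow_weight\<close> below is the centred derivative of
  the logarithmic weights.\<close>

primrec flow_deriv :: "nat \<Rightarrow> moment_expr \<Rightarrow> moment_expr" where
  "flow_deriv k (Pol p) = Pol ([:0, -1, 1:] * pderiv p)"
| "flow_deriv k (Gap i j) = Mul (Pol [:0, 1/2:]) (Add (Gap i j) (Add (Gram k i) (Mul (Pol [:-1:]) (Gram k j))))"
| "flow_deriv k (Gram i j) = Mul (Pol [:0, 1:]) (Gram i j)"
| "flow_deriv k (Add a b) = Add (flow_deriv k a) (flow_deriv k b)"
| "flow_deriv k (Mul a b) = Add (Mul (flow_deriv k a) b) (Mul a (flow_deriv k b))"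

primrec flow_weight :: "nat \<Rightarrow> nat \<Rightarrow> nat \<Rightarrow> moment_expr" where
  "flow_weight c k 0 = Pol 0"
| "flow_weight c k (Suc i) = Add (flow_weight c k i) (Mul (Pol [:0, 1/2:])
     (Add (Gap i c) (Add (Gram k i) (Add (Gram c c) (Mul (Pol [:-1:]) (Add (Gram k c) (Gram i i)))))))"

text \<open>The first summand comes from the prefactor: \<open>L bet = (1/2 + lam) bet\<close>.\<close>

definition flow_step :: "nat \<Rightarrow> moment_expr \<Rightarrow> moment_expr" where
  "flow_step n e = Add (Mul (Pol [:-1/2, 1:]) e) (Add (flow_deriv (Suc n) e) (Mul e (flow_weight n (Suc n) n)))"

text \<open>The logarithmic weight as a function of the vector, so that the identities for
  expressions can be proved without reference to any measure.\<close>

definition log_tilt :: "nat \<Rightarrow> real \<Rightarrow> (nat \<Rightarrow> real) \<Rightarrow> (nat \<Rightarrow> real) \<Rightarrow> real" where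
  "log_tilt d l h v = inner_d d h v - l / 2 * inner_d d v v"

text \<open>The integrand that differentiation of a replica mean along (l', h') produces when the
  observable is an expression; the sample with index \<open>n\<close> is the fresh one.\<close>

definition replica_deriv :: "nat \<Rightarrow> nat \<Rightarrow> real \<Rightarrow> (nat \<Rightarrow> real) \<Rightarrow> real \<Rightarrow> (nat \<Rightarrow> real) \<Rightarrow> (nat \<Rightarrow> nat \<Rightarrow> real) \<Rightarrow> moment_expr \<Rightarrow> real" where
  "replica_deriv n d l h l' h' y e = expr_deriv d l h l' h' y e + expr_val d l h y e * (\<Sum>i<n. log_tilt d l' h' (y i) - log_tilt d l' h' (y n))"

section \<open>Linearity of the derivatives and the meaning of the flow step\<close>

lemma inner_d_delta: "(\<Sum>k<d. c k * inner_d d (\<lambda>m. if m = k then 1 else 0) v) = inner_d d c v"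
  by (simp add: inner_d_def if_distrib[of "\<lambda>x. x * _"] cong: if_cong)

lemma expr_deriv_sum: "(\<Sum>k<d. c k * expr_deriv d l h 0 (\<lambda>m. if m = k then 1 else 0) y e) = expr_deriv d l h 0 c y e"
proof (induction e)
  case (Gap i j)
  then show ?case by (simp add: right_diff_distrib sum_subtractf inner_d_delta)
next
  case (Add a b)
  then show ?case by (simp add: distrib_left sum.distrib)
next
  case (Mul a b)
  have "(\<Sum>k<d. c k * expr_deriv d l h 0 (\<lambda>m. if m = k then 1 else 0) y (Mul a b))
    = (\<Sum>k<d. c k * expr_deriv d l h 0 (\<lambda>m. if m = k then 1 else 0) y a) * expr_val d l h y b
      + expr_val d l h y a * (\<Sum>k<d. c k * expr_deriv d l h 0 (\<lambda>m. if m = k then 1 else 0) y b)"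
    by (simp add: algebra_simps sum.distrib sum_distrib_left sum_distrib_right)
  then show ?case using Mul by simp
qed auto

lemma log_tilt_sum: "(\<Sum>k<d. c k * log_tilt d 0 (\<lambda>m. if m = k then 1 else 0) v) = log_tilt d 0 c v"
  by (simp add: log_tilt_def inner_d_delta)

text \<open>This gathers the sum over coordinates in the transport term, or in a Jacobian applied to
  a vector, into one derivative in direction \<open>c\<close>, so that no factor d is lost.\<close>

lemma replica_deriv_sum: "(\<Sum>k<d. c k * replica_deriv n d l h 0 (\<lambda>m. if m = k then 1 else 0) y e) = replica_deriv n d l h 0 c y e"
proof -
  have "(\<Sum>k<d. c k * replica_deriv n d l h 0 (\<lambda>m. if m = k then 1 else 0) y e)
    = (\<Sum>k<d. c k * expr_deriv d l h 0 (\<lambda>m. if m = k then 1 else 0) y e)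
     + expr_val d l h y e * (\<Sum>k<d. c k * (\<Sum>i<n. log_tilt d 0 (\<lambda>m. if m = k then 1 else 0) (y i) - log_tilt d 0 (\<lambda>m. if m = k then 1 else 0) (y n)))"
    unfolding replica_deriv_def by (simp add: algebra_simps sum.distrib sum_distrib_left)
  also have "(\<Sum>k<d. c k * (\<Sum>i<n. log_tilt d 0 (\<lambda>m. if m = k then 1 else 0) (y i) - log_tilt d 0 (\<lambda>m. if m = k then 1 else 0) (y n)))
    = (\<Sum>i<n. \<Sum>k<d. c k * (log_tilt d 0 (\<lambda>m. if m = k then 1 else 0) (y i) - log_tilt d 0 (\<lambda>m. if m = k then 1 else 0) (y n)))"
    unfolding sum_distrib_left by (rule sum.swap)
  also have "\<dots> = (\<Sum>i<n. log_tilt d 0 c (y i) - log_tilt d 0 c (y n))"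
    by (simp add: right_diff_distrib sum_subtractf log_tilt_sum)
  finally show ?thesis by (simp add: expr_deriv_sum replica_deriv_def)
qed

lemma expr_deriv_lincomb:
  "expr_deriv d l h (c * l1 + l2) (\<lambda>k. c * h1 k + h2 k) y e = c * expr_deriv d l h l1 h1 y e + expr_deriv d l h l2 h2 y e"
  by (induction e) (simp_all add: inner_d_simps algebra_simps)

lemma log_tilt_lincomb:
  "log_tilt d (c * l1 + l2) (\<lambda>k. c * h1 k + h2 k) v = c * log_tilt d l1 h1 v + log_tilt d l2 h2 v"
  by (simp add: log_tilt_def inner_d_simps algebra_simps add_divide_distrib)

text \<open>It serves to split the flow direction into the time part, with \<open>c = -1\<close> for
  the sign in L, and the spatial part.\<close>

lemma replica_deriv_lincomb:
  "replica_deriv n d l h (c * l1 + l2) (\<lambda>k. c * h1 k + h2 k) y e = c * replica_deriv n d l h l1 h1 y e + replica_deriv n d l h l2 h2 y e"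
  unfolding replica_deriv_def expr_deriv_lincomb log_tilt_lincomb
  by (simp add: algebra_simps sum.distrib sum_subtractf sum_distrib_left)

lemma inner_d_direction:
  "inner_d d (\<lambda>m. c * (h m + l * u m)) v = c * (inner_d d h v + l * inner_d d u v)"
  by (simp only: inner_d_simps)

lemma expr_val_flow_deriv:
  "expr_val d l h y (flow_deriv k e) = expr_deriv d l h (l * (1 + l)) (\<lambda>m. (1 + l) / 2 * (h m + l * y k m)) y e"
  by (induction e) (simp_all only: expr_val.simps expr_deriv.simps flow_deriv.simps inner_d_direction, simp_all add: algebra_simps add_divide_distrib)

lemma expr_val_flow_weight:
  "expr_val d l h y (flow_weight c k n) = (\<Sum>i<n. log_tilt d (l * (1 + l)) (\<lambda>m. (1 + l) / 2 * (h m + l * y k m)) (y i)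
      - log_tilt d (l * (1 + l)) (\<lambda>m. (1 + l) / 2 * (h m + l * y k m)) (y c))"
  by (induction n) (simp_all only: expr_val.simps flow_weight.simps sum.lessThan_Suc log_tilt_def inner_d_direction, simp_all add: algebra_simps add_divide_distrib)

text \<open>The velocity of h along the flow contains the tilted mean; here the sample with index
  \<open>n + 1\<close> stands in its place, while the one with index \<open>n\<close> centres the
  weights.\<close>

lemma expr_val_step:
  "expr_val d l h y (flow_step n e) = (l + 1/2) * expr_val d l h y e
     + replica_deriv n d l h (l * (1 + l)) (\<lambda>m. (1 + l) / 2 * (h m + l * y (Suc n) m)) y e"
  by (simp add: flow_step_def expr_val_flow_deriv expr_val_flow_weight replica_deriv_def algebra_simps)

text \<open>The factor x(x - 1), which is l(1 + l) at x = 1 + l, adds two to the degree and the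
  derivative removes one. Constants are treated apart because the degree cannot drop below
  0.\<close>

lemma degree_euler_le: "degree ([:0, -1, 1:] * pderiv (p :: real poly)) \<le> Suc (degree p)"
proof (cases "degree p = 0")
  case True
  then have "pderiv p = 0" by (simp add: pderiv_eq_0_iff)
  then show ?thesis by simp
next
  case False
  then show ?thesis using degree_mult_le[of "[:0, -1, 1:]" "pderiv p"] by (simp add: degree_pderiv)
qed

lemma deg_eta_flow_deriv: "deg_eta (flow_deriv k e) \<le> Suc (deg_eta e)"
proof (induction e)
  case (Pol p) then show ?case using degree_euler_le[of p] by simp
qed auto

text \<open>The flow sends each atom to a combination of atoms with coefficients of degree at most
  one in 1 + l. Hence the number of atoms grows only through the weights.\<close>

lemma deg_atom_flow_deriv: "deg_atom (flow_deriv k e) \<le> deg_atom e"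
  by (induction e) auto

lemma deg_eta_flow_weight: "deg_eta (flow_weight c k n) \<le> 1" and deg_atom_flow_weight: "deg_atom (flow_weight c k n) \<le> 1"
  by (induction n) auto

lemma deg_eta_step: "deg_eta (flow_step n e) \<le> Suc (deg_eta e)"
  using deg_eta_flow_deriv[of "Suc n" e] deg_eta_flow_weight[of n "Suc n" n] by (auto simp: flow_step_def)

lemma deg_atom_step: "deg_atom (flow_step n e) \<le> Suc (deg_atom e)"
  using deg_atom_flow_deriv[of "Suc n" e] deg_atom_flow_weight[of n "Suc n" n] by (auto simp: flow_step_def)

lemma replicas_flow_deriv: "replicas (flow_deriv k e) \<subseteq> insert k (replicas e)"
  by (induction e) auto

lemma replicas_flow_weight: "replicas (flow_weight c k n) \<subseteq> {c, k} \<union> {..<n}"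
  by (induction n) auto

text \<open>Each step uses two fresh indices, \<open>n\<close> to centre the weights and
  \<open>n + 1\<close> for the mean in the velocity; hence the 2j + 1 replicas after j steps from
  one.\<close>

lemma replicas_step: "replicas e \<subseteq> {..<n} \<Longrightarrow> replicas (flow_step n e) \<subseteq> {..<Suc (Suc n)}"
  using replicas_flow_deriv[of "Suc n" e] replicas_flow_weight[of n "Suc n" n] by (fastforce simp: flow_step_def)

text \<open>With \<open>p\<^sub>j = linear_seq j\<close> and \<open>e\<^sub>j = moment_seq j\<close> one has
  \<open>L\<^bsup>j+1\<^esup> x = lam p\<^sub>j(1 + lam) x + bet E[Y\<^sub>0 e\<^sub>j]\<close>, the expectation being over \<open>2j + 1\<close> replicas.\<close>

primrec linear_seq :: "nat \<Rightarrow> real poly" where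
  "linear_seq 0 = [:-1/2:]"
| "linear_seq (Suc j) = [:0, 1:] * linear_seq j + [:0, -1, 1:] * pderiv (linear_seq j) - smult (1/2) ([:-1, 1:] * linear_seq j)"

primrec moment_seq :: "nat \<Rightarrow> moment_expr" where
  "moment_seq 0 = Pol [:1/2:]"
| "moment_seq (Suc j) = Add (flow_step (2 * j + 1) (moment_seq j)) (Pol (smult (1/2) ([:-1, 1:] * linear_seq j)))"

lemma degree_linear_seq: "degree (linear_seq j) \<le> j"
proof (induction j)
  case (Suc j)
  have "degree ([:0, 1:] * linear_seq j) \<le> Suc j" "degree (smult (1/2) ([:-1, 1:] * linear_seq j)) \<le> Suc j"
    using Suc degree_mult_le[of "[:0, 1:]" "linear_seq j"] degree_mult_le[of "[:-1, 1:]" "linear_seq j"] by auto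
  moreover have "degree ([:0, -1, 1:] * pderiv (linear_seq j)) \<le> Suc j"
    using degree_euler_le[of "linear_seq j"] Suc by simp
  ultimately show ?case unfolding linear_seq.simps by (intro degree_diff_le degree_add_le)
qed simp

lemma deg_eta_moment_seq: "deg_eta (moment_seq j) \<le> j"
proof (induction j)
  case (Suc j)
  have "degree (smult (1/2) ([:-1, 1:] * linear_seq j)) \<le> Suc j"
    using degree_linear_seq[of j] degree_mult_le[of "[:-1, 1:]" "linear_seq j"] by auto
  then show ?case using Suc deg_eta_step[of "2 * j + 1" "moment_seq j"] by (simp del: mult_pCons_left)
qed simp

lemma deg_atom_moment_seq: "deg_atom (moment_seq j) \<le> j"
proof (induction j)
  case (Suc j)
  then show ?case using deg_atom_step[of "2 * j + 1" "moment_seq j"] by simp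
qed simp

lemma replicas_moment_seq: "replicas (moment_seq j) \<subseteq> {..<2 * j + 1}"
proof (induction j)
  case (Suc j)
  then show ?case using replicas_step[of "moment_seq j" "2 * j + 1"] by simp
qed simp

section \<open>Size of expressions and of their derivatives\<close>

lemma poly_norm_nonneg: "0 \<le> poly_norm p"
  by (simp add: poly_norm_def sum_nonneg)

lemma abs_poly_le:
  assumes "1 \<le> x" shows "\<bar>poly p x\<bar> \<le> poly_norm p * x ^ degree p"
proof -
  have "\<bar>poly p x\<bar> \<le> (\<Sum>i\<le>degree p. \<bar>coeff p i\<bar> * x ^ i)"
    unfolding poly_altdef by (rule order_trans[OF sum_abs]) (use assms in \<open>simp add: abs_mult\<close>)
  also have "\<dots> \<le> (\<Sum>i\<le>degree p. \<bar>coeff p i\<bar> * x ^ degree p)"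
    using assms by (intro sum_mono mult_left_mono power_increasing) auto
  finally show ?thesis by (simp add: poly_norm_def sum_distrib_right)
qed

lemma coef_bd_nonneg: "0 \<le> coef_bd e"
  by (induction e) (auto simp: poly_norm_nonneg)

lemma grad_bd_nonneg: "0 \<le> grad_bd e"
  by (induction e) (auto simp: coef_bd_nonneg)

lemma mult_le_degrees:
  fixes a b :: real
  assumes "\<bar>a\<bar> \<le> K * s ^ m * t ^ n" "\<bar>b\<bar> \<le> K' * s ^ m' * t ^ n'"
  shows "\<bar>a * b\<bar> \<le> K * K' * s ^ (m + m') * t ^ (n + n')"
proof -
  have "\<bar>a * b\<bar> \<le> (K * s ^ m * t ^ n) * (K' * s ^ m' * t ^ n')"
    unfolding abs_mult using assms by (intro mult_mono) (auto intro: order_trans[OF abs_ge_zero])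
  then show ?thesis by (simp add: power_add mult_ac)
qed

lemma le_degrees_mono:
  fixes a :: real
  assumes "\<bar>a\<bar> \<le> K * s ^ m * t ^ n" "m \<le> m'" "n \<le> n'" "1 \<le> s" "1 \<le> t" "0 \<le> K"
  shows "\<bar>a\<bar> \<le> K * s ^ m' * t ^ n'"
  using assms by (elim order_trans) (intro mult_mono power_increasing order_refl; simp)

lemma add_le_degrees:
  fixes a b :: real
  assumes "\<bar>a\<bar> \<le> K * s ^ m * t ^ n" "\<bar>b\<bar> \<le> K' * s ^ m' * t ^ n'" "1 \<le> s" "1 \<le> t" "0 \<le> K" "0 \<le> K'"
  shows "\<bar>a + b\<bar> \<le> (K + K') * s ^ max m m' * t ^ max n n'"
  using le_degrees_mono[OF assms(1), of "max m m'" "max n n'"] le_degrees_mono[OF assms(2), of "max m m'" "max n n'"] assms(3-)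
  by (auto simp: distrib_right intro: order_trans[OF abs_triangle_ineq])

text \<open>One common bound \<open>T\<close> for all atoms suffices; since \<open>T\<close> and
  \<open>1 + l\<close> are at least 1, lower powers are dominated by the highest ones, as sums
  require.\<close>

lemma abs_expr_val_le:
  assumes "replicas e \<subseteq> {..<n}" and l: "0 \<le> l" and T: "1 \<le> T"
    and gap: "\<And>i j. i < n \<Longrightarrow> j < n \<Longrightarrow> \<bar>inner_d d h (y i) - inner_d d h (y j)\<bar> \<le> T"
    and gram: "\<And>i j. i < n \<Longrightarrow> j < n \<Longrightarrow> \<bar>l * inner_d d (y i) (y j)\<bar> \<le> T"
  shows "\<bar>expr_val d l h y e\<bar> \<le> coef_bd e * (1 + l) ^ deg_eta e * T ^ deg_atom e"
  using assms(1)
proof (induction e)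
  case (Pol p)
  then show ?case using abs_poly_le[of "1 + l" p] l by simp
next
  case (Add a b)
  then show ?case using l T by (auto intro!: add_le_degrees coef_bd_nonneg)
next
  case (Mul a b)
  then show ?case by (auto intro!: mult_le_degrees)
qed (use gap gram in auto)

text \<open>Differentiating in h replaces one gap by inner products with h', of size \<rho>. The
  freed power of \<open>T\<close> is kept on the right, which is harmless as \<open>T\<close> is at
  least 1.\<close>

lemma abs_expr_deriv_le:
  assumes "replicas e \<subseteq> {..<n}" and l: "0 \<le> l" and T: "1 \<le> T" and \<rho>: "0 \<le> \<rho>"
    and gap: "\<And>i j. i < n \<Longrightarrow> j < n \<Longrightarrow> \<bar>inner_d d h (y i) - inner_d d h (y j)\<bar> \<le> T"
    and gram: "\<And>i j. i < n \<Longrightarrow> j < n \<Longrightarrow> \<bar>l * inner_d d (y i) (y j)\<bar> \<le> T"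
    and dir: "\<And>i. i < n \<Longrightarrow> \<bar>inner_d d h' (y i)\<bar> \<le> \<rho>"
  shows "\<bar>expr_deriv d l h 0 h' y e\<bar> \<le> (\<rho> * grad_bd e) * (1 + l) ^ deg_eta e * T ^ deg_atom e"
  using assms(1)
proof (induction e)
  case (Gap i j)
  then have "\<bar>inner_d d h' (y i) - inner_d d h' (y j)\<bar> \<le> 2 * \<rho>" using dir[of i] dir[of j] by auto
  also have "\<dots> \<le> 2 * \<rho> * T" using T \<rho> by (simp add: mult_le_cancel_left1)
  finally show ?case by (simp add: mult.commute)
next
  case (Gram i j)
  then show ?case by simp
next
  case (Add a b)
  then have "\<bar>expr_deriv d l h 0 h' y a + expr_deriv d l h 0 h' y b\<bar> \<le> (\<rho> * grad_bd a + \<rho> * grad_bd b) * (1 + l) ^ max (deg_eta a) (deg_eta b) * T ^ max (deg_atom a) (deg_atom b)"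
    using l T \<rho> by (intro add_le_degrees) (auto intro: grad_bd_nonneg mult_nonneg_nonneg)
  then show ?case by (simp add: distrib_left)
next
  case (Mul a b)
  have a: "\<bar>expr_val d l h y a\<bar> \<le> coef_bd a * (1 + l) ^ deg_eta a * T ^ deg_atom a" and b: "\<bar>expr_val d l h y b\<bar> \<le> coef_bd b * (1 + l) ^ deg_eta b * T ^ deg_atom b"
    using Mul.prems by (intro abs_expr_val_le[where n = n] l T gap gram; simp)+
  have "\<bar>expr_deriv d l h 0 h' y a * expr_val d l h y b\<bar> \<le> (\<rho> * grad_bd a) * coef_bd b * (1 + l) ^ (deg_eta a + deg_eta b) * T ^ (deg_atom a + deg_atom b)"
    using Mul by (intro mult_le_degrees b) auto
  moreover have "\<bar>expr_val d l h y a * expr_deriv d l h 0 h' y b\<bar> \<le> coef_bd a * (\<rho> * grad_bd b) * (1 + l) ^ (deg_eta a + deg_eta b) * T ^ (deg_atom a + deg_atom b)"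
    using Mul by (intro mult_le_degrees a) auto
  ultimately show ?case by (simp add: algebra_simps)
qed simp

section \<open>The time-dependent parameters\<close>

definition lam :: "real \<Rightarrow> real" where "lam t = exp (- t) / (1 - exp (- t))"

definition bet :: "real \<Rightarrow> real" where "bet t = exp (- t / 2) / (1 - exp (- t))"

lemma one_plus_lam: "t > 0 \<Longrightarrow> 1 + lam t = 1 / (1 - exp (- t))"
  by (simp add: lam_def field_simps)

lemma lam_nonneg: "t > 0 \<Longrightarrow> 0 \<le> lam t"
  by (simp add: lam_def)

lemma bet_eq: "t > 0 \<Longrightarrow> bet t = exp (- t / 2) * (1 + lam t)"
  by (simp add: bet_def one_plus_lam)

lemma exp_half_square: "exp (- t / 2) * exp (- t / 2) = exp (- t :: real)"
  by (simp add: exp_add[symmetric])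

text \<open>In the transport term one factor bet comes from the score and one from the chain rule
  for h = bet x; by this identity their product is again a polynomial in lam.\<close>

lemma bet_square: "t > 0 \<Longrightarrow> bet t * bet t = lam t * (1 + lam t)"
  unfolding bet_def one_plus_lam using exp_half_square[of t] by (simp add: lam_def)

lemma lam_has_derivative:
  assumes "t > 0"
  shows "(lam has_real_derivative - (lam t * (1 + lam t))) (at t)"
proof -
  have ne: "1 - exp (- t) \<noteq> 0" using assms by simp
  have "(lam has_real_derivative ((- exp (- t)) * (1 - exp (- t)) - exp (- t) * exp (- t)) / ((1 - exp (- t)) * (1 - exp (- t)))) (at t)"
    unfolding lam_def[abs_def] using ne by (auto intro!: derivative_eq_intros)
  also have "((- exp (- t)) * (1 - exp (- t)) - exp (- t) * exp (- t)) / ((1 - exp (- t)) * (1 - exp (- t))) = - (lam t * (1 + lam t))"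
    using ne unfolding one_plus_lam[OF assms] lam_def by (simp add: divide_simps) (simp add: algebra_simps)
  finally show ?thesis .
qed

lemma bet_has_derivative:
  assumes "t > 0"
  shows "(bet has_real_derivative - ((1/2 + lam t) * bet t)) (at t)"
proof -
  have ne: "1 - exp (- t) \<noteq> 0" using assms by simp
  have "(bet has_real_derivative ((- exp (- t / 2) / 2) * (1 - exp (- t)) - exp (- t / 2) * exp (- t)) / ((1 - exp (- t)) * (1 - exp (- t)))) (at t)"
    unfolding bet_def[abs_def] using ne by (auto intro!: derivative_eq_intros)
  also have "((- exp (- t / 2) / 2) * (1 - exp (- t)) - exp (- t / 2) * exp (- t)) / ((1 - exp (- t)) * (1 - exp (- t))) = - ((1/2 + lam t) * bet t)"
    using ne unfolding lam_def bet_def by (simp add: divide_simps) (simp add: algebra_simps)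
  finally show ?thesis .
qed

section \<open>Moment expressions under the replica mean\<close>

context tilt
begin

lemma logw_log_tilt: "logw l h \<omega> = log_tilt d l h (Y \<omega>)"
  by (simp add: logw_def log_tilt_def)

lemma admissible_inner: "i < n \<Longrightarrow> admissible n (\<lambda>ys. inner_d d h (Y (ys i)))"
  by (rule admissible_coord[OF bounded_meas_inner])

lemma admissible_Y: "i < n \<Longrightarrow> k < d \<Longrightarrow> admissible n (\<lambda>ys. Y (ys i) k)"
  by (rule admissible_coord[OF bounded_meas_Y])

lemma admissible_gram: "i < n \<Longrightarrow> j < n \<Longrightarrow> admissible n (\<lambda>ys. inner_d d (Y (ys i)) (Y (ys j)))"
  unfolding inner_d_def by (intro admissible_sum admissible_mult admissible_Y) auto

lemma admissible_expr_val: "replicas e \<subseteq> {..<n} \<Longrightarrow> admissible n (\<lambda>ys. expr_val d l h (\<lambda>i. Y (ys i)) e)"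
  by (induction e) (auto intro!: admissible_const admissible_diff admissible_inner admissible_mult admissible_add admissible_gram)

lemma admissible_expr_deriv: "replicas e \<subseteq> {..<n} \<Longrightarrow> admissible n (\<lambda>ys. expr_deriv d l h l' h' (\<lambda>i. Y (ys i)) e)"
  by (induction e) (auto intro!: admissible_const admissible_diff admissible_inner admissible_mult admissible_add admissible_gram admissible_expr_val)

lemma admissible_replica_deriv:
  assumes "replicas e \<subseteq> {..<n}" shows "admissible (Suc n) (\<lambda>ys. replica_deriv n d l h l' h' (\<lambda>i. Y (ys i)) e)"
proof -
  have "replicas e \<subseteq> {..<Suc n}" using assms by auto
  then show ?thesis unfolding replica_deriv_def logw_log_tilt[symmetric]
    by (intro admissible_add admissible_expr_deriv admissible_mult admissible_expr_val admissible_sum admissible_diff admissible_coord bounded_meas_logw) auto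
qed

lemma admissible_bounded: "admissible n G \<Longrightarrow> \<exists>B. \<forall>ys\<in>space (prodM n). \<bar>G ys\<bar> \<le> B"
  by (auto simp: admissible_def)

lemma uderiv_expr_val:
  assumes "replicas e \<subseteq> {..<n}" and L: "(L has_real_derivative l') (at r)"
    and H: "\<And>k. k < d \<Longrightarrow> ((\<lambda>s. H s k) has_real_derivative h' k) (at r)"
  shows "uderiv (prodM n) (\<lambda>s ys. expr_val d (L s) (H s) (\<lambda>i. Y (ys i)) e)
           (\<lambda>ys. expr_deriv d (L r) (H r) l' h' (\<lambda>i. Y (ys i)) e) r"
  using assms(1)
proof (induction e)
  case (Pol p)
  have "((\<lambda>s. poly p (1 + L s)) has_real_derivative l' * poly (pderiv p) (1 + L r)) (at r)"
    using DERIV_chain2[OF poly_DERIV, of "\<lambda>s. 1 + L s" l' r UNIV p] L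
    by (auto simp: mult.commute intro!: derivative_eq_intros)
  then show ?case by (simp add: uderiv_real)
next
  case (Gap i j)
  have "uderiv (prodM n) (\<lambda>s ys. inner_d d (H s) (Y (ys i)) + (- 1) * inner_d d (H s) (Y (ys j)))
      (\<lambda>ys. inner_d d h' (Y (ys i)) + (0 * inner_d d (H r) (Y (ys j)) + (- 1) * inner_d d h' (Y (ys j)))) r"
    using Gap by (intro uderiv_add uderiv_mult uderiv_real uderiv_inner H) auto
  then show ?case by simp
next
  case (Gram i j)
  from admissible_bounded[OF admissible_gram, of i n j] Gram obtain B where B: "\<forall>ys\<in>space (prodM n). \<bar>inner_d d (Y (ys i)) (Y (ys j))\<bar> \<le> B"
    by auto
  have "uderiv (prodM n) (\<lambda>s ys. L s * inner_d d (Y (ys i)) (Y (ys j)))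
      (\<lambda>ys. l' * inner_d d (Y (ys i)) (Y (ys j)) + L r * 0) r"
    using Gram admissible_gram[of i n j] B
    by (intro uderiv_mult uderiv_real L uderiv_const[of _ _ B]) (auto simp: admissible_def)
  then show ?case by simp
next
  case (Add a b)
  then show ?case by (auto intro: uderiv_add)
next
  case (Mul a b)
  then show ?case by (auto intro: uderiv_mult)
qed

lemma replica_mean_expr_val_has_derivative:
  assumes e: "replicas e \<subseteq> {..<n}" and n: "0 < n" and i: "i < d" and L: "(L has_real_derivative l') (at r)"
    and H: "\<And>k. k < d \<Longrightarrow> ((\<lambda>s. H s k) has_real_derivative h' k) (at r)"
  shows "((\<lambda>s. replica_mean n (L s) (H s) (\<lambda>ys. Y (ys 0) i * expr_val d (L s) (H s) (\<lambda>i. Y (ys i)) e)) has_real_derivative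
    replica_mean (Suc n) (L r) (H r) (\<lambda>ys. Y (ys 0) i * replica_deriv n d (L r) (H r) l' h' (\<lambda>i. Y (ys i)) e)) (at r)"
proof -
  have "uderiv (prodM n) (\<lambda>s ys. Y (ys 0) i * expr_val d (L s) (H s) (\<lambda>i. Y (ys i)) e)
     (\<lambda>ys. 0 * expr_val d (L r) (H r) (\<lambda>i. Y (ys i)) e + Y (ys 0) i * expr_deriv d (L r) (H r) l' h' (\<lambda>i. Y (ys i)) e) r"
    by (intro uderiv_mult uderiv_coord[OF bounded_meas_Y] n i uderiv_expr_val e L H)
  then have u: "uderiv (prodM n) (\<lambda>s ys. Y (ys 0) i * expr_val d (L s) (H s) (\<lambda>i. Y (ys i)) e)
     (\<lambda>ys. Y (ys 0) i * expr_deriv d (L r) (H r) l' h' (\<lambda>i. Y (ys i)) e) r" by simp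
  have "((\<lambda>s. replica_mean n (L s) (H s) (\<lambda>ys. Y (ys 0) i * expr_val d (L s) (H s) (\<lambda>i. Y (ys i)) e)) has_real_derivative
    replica_mean (Suc n) (L r) (H r) (\<lambda>ys. Y (ys 0) i * expr_deriv d (L r) (H r) l' h' (\<lambda>i. Y (ys i)) e
      + Y (ys 0) i * expr_val d (L r) (H r) (\<lambda>i. Y (ys i)) e * (\<Sum>i<n. logw l' h' (ys i) - logw l' h' (ys n)))) (at r)"
    by (rule replica_mean_has_derivative[OF L H u]) (auto intro!: admissible_mult admissible_Y n i admissible_expr_val admissible_expr_deriv e)
  then show ?thesis by (simp add: replica_deriv_def logw_log_tilt distrib_left mult.assoc)
qed

text \<open>The left side is L applied to bet times a replica mean, divided by bet: the prefactor
  contributes 1/2 + l, the next line is the time derivative with its sign, and the sum is the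
  transport by half the score. The tilted mean in the score turns into the coordinate of one more
  replica.\<close>

lemma material_replica_mean:
  assumes e: "replicas e \<subseteq> {..<n}" and n: "0 < n" and i: "i < d" and b: "b * b = l * (1 + l)"
    and h: "h = (\<lambda>k. b * x k)"
  shows "(1/2 + l) * replica_mean n l h (\<lambda>ys. Y (ys 0) i * expr_val d l h (\<lambda>i. Y (ys i)) e)
      - replica_mean (Suc n) l h (\<lambda>ys. Y (ys 0) i * replica_deriv n d l h (- (l * (1 + l))) (\<lambda>k. - ((1/2 + l) * h k)) (\<lambda>i. Y (ys i)) e)
      + 1/2 * (\<Sum>k<d. (- l * x k + b * tilt_mean l h (\<lambda>\<omega>. Y \<omega> k)) * (b *
          replica_mean (Suc n) l h (\<lambda>ys. Y (ys 0) i * replica_deriv n d l h 0 (\<lambda>m. if m = k then 1 else 0) (\<lambda>i. Y (ys i)) e)))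
    = replica_mean (Suc (Suc n)) l h (\<lambda>ys. Y (ys 0) i * expr_val d l h (\<lambda>i. Y (ys i)) (flow_step n e))"
proof -
  define y where "y = (\<lambda>(ys :: nat \<Rightarrow> 'a) i. Y (ys i))"
  define F where "F = (\<lambda>ys. Y (ys 0) i * expr_val d l h (y ys) e)"
  define T where "T = (\<lambda>ys. Y (ys 0) i * replica_deriv n d l h (- (l * (1 + l))) (\<lambda>k. - ((1/2 + l) * h k)) (y ys) e)"
  define U where "U = (\<lambda>k ys. Y (ys 0) i * replica_deriv n d l h 0 (\<lambda>m. if m = k then 1 else 0) (y ys) e)"
  have aF: "admissible n F" unfolding F_def y_def by (intro admissible_mult admissible_Y n i admissible_expr_val e)
  have aT: "admissible (Suc n) T" unfolding T_def y_def by (intro admissible_mult admissible_Y i admissible_replica_deriv e) auto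
  have aU: "admissible (Suc n) (U k)" for k unfolding U_def y_def by (intro admissible_mult admissible_Y i admissible_replica_deriv e) auto
  let ?E = "replica_mean (Suc (Suc n)) l h"
  have aF1: "admissible (Suc n) F" and aF2: "admissible (Suc (Suc n)) F" and aT2: "admissible (Suc (Suc n)) T"
    and aU2: "admissible (Suc (Suc n)) (U k)" for k
    by (rule admissible_mono[OF _ aF] admissible_mono[OF _ aT] admissible_mono[OF _ aU]; simp)+
  \<comment> \<open>Replica \<open>n + 1\<close> occurs in no \<open>U k\<close>, so the mean of the
    product factors.\<close>
  have UY: "?E (\<lambda>ys. U k ys * Y (ys (Suc n)) k) = replica_mean (Suc n) l h (U k) * tilt_mean l h (\<lambda>\<omega>. Y \<omega> k)"
    if "k < d" for k
    by (rule replica_mean_Suc_mult[where g = "\<lambda>\<omega>. Y \<omega> k"]) (intro aU bounded_meas_Y that)+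
  have point: "Y (ys 0) i * expr_val d l h (y ys) (flow_step n e) = (1/2 + l) * F ys - T ys
      + (\<Sum>k<d. - (l * x k * b / 2) * U k ys + (b * b / 2) * (U k ys * Y (ys (Suc n)) k))" for ys
  proof -
    let ?D = "\<lambda>l' h'. replica_deriv n d l h l' h' (y ys) e"
    \<comment> \<open>The velocity of h is assembled from its parts: (1/2 + l) h from time and - l h
      / 2 from the score's linear part add up to (1 + l) h / 2, and b^2 / 2 = l (1 + l) / 2 is the
      coefficient of the mean.\<close>
    have "?D (l * (1 + l)) (\<lambda>m. (1 + l) / 2 * (h m + l * y ys (Suc n) m))
      = ?D ((- 1) * (- (l * (1 + l))) + 0) (\<lambda>k. (- 1) * (- ((1/2 + l) * h k)) + (- (l * x k * b / 2) + (b * b / 2) * y ys (Suc n) k))"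
      unfolding b h by (rule arg_cong2[where f = "\<lambda>u v. replica_deriv n d l (\<lambda>k. b * x k) u v (y ys) e"]) (simp_all add: fun_eq_iff field_simps)
    also have "\<dots> = (- 1) * ?D (- (l * (1 + l))) (\<lambda>k. - ((1/2 + l) * h k)) + ?D 0 (\<lambda>k. - (l * x k * b / 2) + (b * b / 2) * y ys (Suc n) k)"
      by (rule replica_deriv_lincomb)
    also have "?D 0 (\<lambda>k. - (l * x k * b / 2) + (b * b / 2) * y ys (Suc n) k)
      = (\<Sum>k<d. (- (l * x k * b / 2) + (b * b / 2) * y ys (Suc n) k) * ?D 0 (\<lambda>m. if m = k then 1 else 0))"
      by (rule replica_deriv_sum[symmetric])
    finally have D: "?D (l * (1 + l)) (\<lambda>m. (1 + l) / 2 * (h m + l * y ys (Suc n) m))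
      = - 1 * ?D (- (l * (1 + l))) (\<lambda>k. - ((1/2 + l) * h k))
        + (\<Sum>k<d. (- (l * x k * b / 2) + (b * b / 2) * y ys (Suc n) k) * ?D 0 (\<lambda>m. if m = k then 1 else 0))" .
    have "q * ((l + 1/2) * u + (- 1 * A + S)) = (1/2 + l) * (q * u) - q * A + q * S" for q u A S :: real
      by (simp add: algebra_simps)
    then have "Y (ys 0) i * expr_val d l h (y ys) (flow_step n e) = (1/2 + l) * F ys - T ys
      + Y (ys 0) i * (\<Sum>k<d. (- (l * x k * b / 2) + (b * b / 2) * y ys (Suc n) k) * ?D 0 (\<lambda>m. if m = k then 1 else 0))"
      unfolding expr_val_step D F_def T_def .
    also have "Y (ys 0) i * (\<Sum>k<d. (- (l * x k * b / 2) + (b * b / 2) * y ys (Suc n) k) * ?D 0 (\<lambda>m. if m = k then 1 else 0))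
       = (\<Sum>k<d. - (l * x k * b / 2) * U k ys + (b * b / 2) * (U k ys * Y (ys (Suc n)) k))"
      unfolding sum_distrib_left by (rule sum.cong) (simp_all add: U_def y_def algebra_simps)
    finally show ?thesis .
  qed
  have "replica_mean (Suc (Suc n)) l h (\<lambda>ys. Y (ys 0) i * expr_val d l h (y ys) (flow_step n e))
    = replica_mean (Suc (Suc n)) l h (\<lambda>ys. (1/2 + l) * F ys - T ys
      + (\<Sum>k<d. - (l * x k * b / 2) * U k ys + (b * b / 2) * (U k ys * Y (ys (Suc n)) k)))"
    unfolding point ..
  also have "\<dots> = (1/2 + l) * ?E F - ?E T
      + (\<Sum>k<d. - (l * x k * b / 2) * ?E (U k) + (b * b / 2) * ?E (\<lambda>ys. U k ys * Y (ys (Suc n)) k))"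
  proof -
    have aUY: "admissible (Suc (Suc n)) (\<lambda>ys. c * U k ys + c' * (U k ys * Y (ys (Suc n)) k))" if "k < d" for k c c'
      using that by (intro admissible_add admissible_mult admissible_const aU2 admissible_Y) simp_all
    have aFT: "admissible (Suc (Suc n)) (\<lambda>ys. (1/2 + l) * F ys - T ys)"
      by (intro admissible_diff admissible_mult admissible_const aF2 aT2)
    have U: "?E (\<lambda>ys. c * U k ys + c' * (U k ys * Y (ys (Suc n)) k))
        = c * ?E (U k) + c' * ?E (\<lambda>ys. U k ys * Y (ys (Suc n)) k)" if "k < d" for k c c'
      using that by (subst replica_mean_add) (simp_all add: replica_mean_cmult admissible_mult admissible_const aU2 admissible_Y)
    have FT: "?E (\<lambda>ys. (1/2 + l) * F ys - T ys) = (1/2 + l) * ?E F - ?E T"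
      by (subst replica_mean_diff) (simp_all add: replica_mean_cmult admissible_mult admissible_const aF2 aT2)
    have "?E (\<lambda>ys. (1/2 + l) * F ys - T ys + (\<Sum>k<d. c k * U k ys + c' * (U k ys * Y (ys (Suc n)) k)))
        = (1/2 + l) * ?E F - ?E T + (\<Sum>k<d. ?E (\<lambda>ys. c k * U k ys + c' * (U k ys * Y (ys (Suc n)) k)))" for c c'
      by (subst replica_mean_add[OF aFT admissible_sum], simp only: aUY lessThan_iff, subst replica_mean_sum, simp,
          simp only: aUY lessThan_iff, simp only: FT)
    also have "(\<Sum>k<d. ?E (\<lambda>ys. c k * U k ys + c' * (U k ys * Y (ys (Suc n)) k)))
        = (\<Sum>k<d. c k * ?E (U k) + c' * ?E (\<lambda>ys. U k ys * Y (ys (Suc n)) k))" for c c'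
      by (intro sum.cong refl U) simp
    finally show ?thesis .
  qed
  also have "\<dots> = (1/2 + l) * replica_mean n l h F - replica_mean (Suc n) l h T
      + (\<Sum>k<d. - (l * x k * b / 2) * replica_mean (Suc n) l h (U k) + (b * b / 2) * (replica_mean (Suc n) l h (U k) * tilt_mean l h (\<lambda>\<omega>. Y \<omega> k)))"
    by (simp add: replica_mean_Suc aF aF1 aT aU UY cong: sum.cong_simp)
  also have "(\<Sum>k<d. - (l * x k * b / 2) * replica_mean (Suc n) l h (U k) + (b * b / 2) * (replica_mean (Suc n) l h (U k) * tilt_mean l h (\<lambda>\<omega>. Y \<omega> k)))
    = 1/2 * (\<Sum>k<d. (- l * x k + b * tilt_mean l h (\<lambda>\<omega>. Y \<omega> k)) * (b * replica_mean (Suc n) l h (U k)))"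
    unfolding sum_distrib_left by (rule sum.cong) (simp_all add: algebra_simps)
  finally show ?thesis by (simp add: F_def T_def U_def y_def)
qed

end

subsection \<open>Moments under the doubling condition\<close>

lemma power_le_fact_exp:
  fixes x :: real
  assumes "0 \<le> x" shows "x ^ q \<le> fact q * exp x"
proof -
  have "(\<Sum>n\<in>{q}. x ^ n /\<^sub>R fact n) \<le> (\<Sum>n. x ^ n /\<^sub>R fact n)"
    using assms by (intro sum_le_suminf summable_exp_generic) auto
  then have "x ^ q /\<^sub>R fact q \<le> exp x" by (simp add: exp_def)
  then show ?thesis by (simp add: field_simps)
qed

lemma sum_power_le:
  fixes a :: "nat \<Rightarrow> real"
  assumes "\<And>i. i < n \<Longrightarrow> 0 \<le> a i" "0 < n"
  shows "(\<Sum>i<n. a i) ^ q \<le> real n ^ q * (\<Sum>i<n. a i ^ q)"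
proof -
  have "Max (a ` {..<n}) \<in> a ` {..<n}" using assms(2) by (intro Max_in) auto
  then obtain m where m: "m < n" "a m = Max (a ` {..<n})" by auto
  then have le: "a i \<le> a m" if "i < n" for i using that by simp
  have "(\<Sum>i<n. a i) \<le> real n * a m"
    using sum_bounded_above[of "{..<n}" a "a m"] le by simp
  then have "(\<Sum>i<n. a i) ^ q \<le> (real n * a m) ^ q"
    using assms(1) by (intro power_mono sum_nonneg) auto
  also have "a m ^ q \<le> (\<Sum>i<n. a i ^ q)"
    using assms(1) m by (intro member_le_sum) auto
  then have "(real n * a m) ^ q \<le> real n ^ q * (\<Sum>i<n. a i ^ q)"
    unfolding power_mult_distrib by (intro mult_left_mono) auto
  finally show ?thesis .
qed

lemma norm_d_add_le: "norm_d d (\<lambda>i. x i + y i) \<le> norm_d d x + norm_d d y"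
  unfolding norm_d_def by (rule L2_set_triangle_ineq)

lemma norm_d_scale: "norm_d d (\<lambda>i. c * x i) = \<bar>c\<bar> * norm_d d x"
  by (simp add: norm_d_def L2_set_def power_mult_distrib sum_distrib_left[symmetric] real_sqrt_mult)

section \<open>Exponential moments from doubling\<close>

context prob_space
begin

text \<open>exp (- W) is the integral of exp (- u) over u >= W; Tonelli then exchanges the two
  integrals.\<close>

lemma nn_integral_exp_layer:
  assumes [measurable]: "W \<in> borel_measurable M"
  shows "(\<integral>\<^sup>+\<omega>. ennreal (exp (- W \<omega>)) \<partial>M)
    = (\<integral>\<^sup>+u. ennreal (exp (- u)) * emeasure M {\<omega> \<in> space M. W \<omega> \<le> u} \<partial>lborel)"
proof -
  interpret pair_sigma_finite M "lborel :: real measure" ..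
  have FTC: "ennreal (exp (- a)) = (\<integral>\<^sup>+u. ennreal (exp (- u)) * indicator {a..} u \<partial>lborel)" for a :: real
  proof -
    have "((\<lambda>u. - exp (- u)) \<longlongrightarrow> 0) (at_top :: real filter)"
      using tendsto_minus[OF filterlim_compose[OF exp_at_bot filterlim_uminus_at_bot_at_top]] by simp
    then have "(\<integral>\<^sup>+u. ennreal (exp (- u)) * indicator {a..} u \<partial>lborel) = ennreal (0 - (- exp (- a)))"
      by (intro nn_integral_FTC_atLeast) (auto intro!: derivative_eq_intros)
    then show ?thesis by simp
  qed
  have "(\<integral>\<^sup>+\<omega>. ennreal (exp (- W \<omega>)) \<partial>M)
    = (\<integral>\<^sup>+\<omega>. \<integral>\<^sup>+u. ennreal (exp (- u)) * indicator {\<omega>' \<in> space M. W \<omega>' \<le> u} \<omega> \<partial>lborel \<partial>M)"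
    by (intro nn_integral_cong, subst FTC, intro nn_integral_cong) (auto simp: indicator_def)
  also have "\<dots> = (\<integral>\<^sup>+u. \<integral>\<^sup>+\<omega>. ennreal (exp (- u)) * indicator {\<omega>' \<in> space M. W \<omega>' \<le> u} \<omega> \<partial>M \<partial>lborel)"
  proof (rule Fubini'[symmetric])
    have "(\<lambda>(\<omega>, u). ennreal (exp (- u)) * indicator {\<omega>' \<in> space M. W \<omega>' \<le> u} \<omega>)
      \<in> borel_measurable (M \<Otimes>\<^sub>M lborel)"
      unfolding indicator_def by measurable
    then show "(\<lambda>(\<omega>, u). ennreal (exp (- u)) * indicator {\<omega>' \<in> space M. W \<omega>' \<le> u} \<omega>)
      \<in> borel_measurable (M \<Otimes>\<^sub>M lborel)" .
  qed
  also have "\<dots> = (\<integral>\<^sup>+u. ennreal (exp (- u)) * emeasure M {\<omega> \<in> space M. W \<omega> \<le> u} \<partial>lborel)"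
    by (intro nn_integral_cong) (simp add: nn_integral_cmult_indicator)
  finally show ?thesis .
qed

text \<open>Both sides are integrals against \<open>exp (- u) du\<close>, of \<open>F (2 u)\<close> and \<open>D F u\<close> respectively.\<close>

lemma exp_moment_doubling:
  assumes V[measurable]: "V \<in> borel_measurable M" and V0: "\<And>\<omega>. 0 \<le> V \<omega>" and D: "1 \<le> D"
    and F: "\<And>u. 0 < u \<Longrightarrow> prob {\<omega> \<in> space M. V \<omega> \<le> 2 * u} \<le> D * prob {\<omega> \<in> space M. V \<omega> \<le> u}"
  shows "(\<integral>\<omega>. exp (- V \<omega> / 2) \<partial>M) \<le> D * (\<integral>\<omega>. exp (- V \<omega>) \<partial>M)"
proof -
  have int: "integrable M (\<lambda>\<omega>. exp (- V \<omega> / 2))" "integrable M (\<lambda>\<omega>. exp (- V \<omega>))"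
    by (rule integrable_const_bound[of _ 1]; use V0 in simp)+
  have le: "emeasure M {\<omega> \<in> space M. V \<omega> / 2 \<le> u} \<le> ennreal D * emeasure M {\<omega> \<in> space M. V \<omega> \<le> u}" for u
  proof -
    have "prob {\<omega> \<in> space M. V \<omega> \<le> 2 * u} \<le> D * prob {\<omega> \<in> space M. V \<omega> \<le> u}"
    \<comment> \<open>Doubling is assumed for positive \<open>u\<close> only. Below 0 the left event
      is empty because \<open>V\<close> is nonnegative, and at 0 the two events coincide.\<close>
    proof (cases u "0 :: real" rule: linorder_cases)
      case less
      then have "\<not> V \<omega> \<le> 2 * u" for \<omega> using V0[of \<omega>] by linarith
      then have "{\<omega> \<in> space M. V \<omega> \<le> 2 * u} = {}" by blast
      then have "prob {\<omega> \<in> space M. V \<omega> \<le> 2 * u} = 0" by (simp only: measure_empty)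
      then show ?thesis using D by simp
    next
      case equal
      then show ?thesis using D by (simp add: mult_le_cancel_right1)
    qed (rule F)
    then show ?thesis using D by (simp add: emeasure_eq_measure ennreal_mult'[symmetric] mult.commute)
  qed
  have "ennreal (\<integral>\<omega>. exp (- V \<omega> / 2) \<partial>M) = (\<integral>\<^sup>+\<omega>. ennreal (exp (- (V \<omega> / 2))) \<partial>M)"
    using int by (subst nn_integral_eq_integral) auto
  also have "\<dots> = (\<integral>\<^sup>+u. ennreal (exp (- u)) * emeasure M {\<omega> \<in> space M. V \<omega> / 2 \<le> u} \<partial>lborel)"
    by (rule nn_integral_exp_layer) simp
  also have "\<dots> \<le> (\<integral>\<^sup>+u. ennreal D * (ennreal (exp (- u)) * emeasure M {\<omega> \<in> space M. V \<omega> \<le> u}) \<partial>lborel)"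
    by (intro nn_integral_mono, subst mult.left_commute, rule mult_left_mono[OF le]) simp
  also have "\<dots> = ennreal D * (\<integral>\<^sup>+u. ennreal (exp (- u)) * emeasure M {\<omega> \<in> space M. V \<omega> \<le> u} \<partial>lborel)"
    by (intro nn_integral_cmult) measurable
  also have "(\<integral>\<^sup>+u. ennreal (exp (- u)) * emeasure M {\<omega> \<in> space M. V \<omega> \<le> u} \<partial>lborel) = (\<integral>\<^sup>+\<omega>. ennreal (exp (- V \<omega>)) \<partial>M)"
    by (rule nn_integral_exp_layer[symmetric]) simp
  also have "\<dots> = ennreal (\<integral>\<omega>. exp (- V \<omega>) \<partial>M)"
    using int by (subst nn_integral_eq_integral) auto
  also have "ennreal D * ennreal (\<integral>\<omega>. exp (- V \<omega>) \<partial>M) = ennreal (D * (\<integral>\<omega>. exp (- V \<omega>) \<partial>M))"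
    using D by (simp add: ennreal_mult')
  finally show ?thesis
    using D by (simp add: integral_nonneg)
qed

end

text \<open>\<open>real n ^ q\<close> is the cost of pulling a power inside a sum of
  \<open>n\<close> terms, the second \<open>real n\<close> counts those terms, and the rest bounds
  the moment of a single replica. Neither l nor R nor d enters.\<close>

definition moment_const :: "real \<Rightarrow> nat \<Rightarrow> nat \<Rightarrow> real" where
  "moment_const D n q = real n ^ q * (real n * (2 ^ q * fact q * exp 1 * (1 + D)))"

text \<open>Doubling is required for every vector h rather than for unit vectors, as the tilt has
  arbitrary length. The number \<open>S\<close> stands for the supremum of the linear form over the
  support, to which the locale does not refer.\<close>

locale doubling_tilt = tilt +
  fixes D :: real
  assumes D_ge_1: "1 \<le> D"
    and doubling: "\<And>h. \<exists>S. (\<forall>\<omega>. inner_d d h (Y \<omega>) \<le> S) \<and>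
      (\<forall>u>0. prob {\<omega> \<in> space M. S - inner_d d h (Y \<omega>) \<le> 2 * u}
             \<le> D * prob {\<omega> \<in> space M. S - inner_d d h (Y \<omega>) \<le> u})"
begin

lemma tilt_mean_mono:
  assumes "bounded_meas f" "bounded_meas g" "\<And>\<omega>. f \<omega> \<le> g \<omega>" shows "tilt_mean l h f \<le> tilt_mean l h g"
  unfolding tilt_mean_def using partition_fn_pos[of l h]
  by (intro divide_right_mono integral_mono bounded_meas_integrable bounded_meas_mult bounded_meas_wt assms mult_right_mono)
    (auto simp: wt_def)

lemma tilt_mean_add: "bounded_meas f \<Longrightarrow> bounded_meas g \<Longrightarrow> tilt_mean l h (\<lambda>\<omega>. f \<omega> + g \<omega>) = tilt_mean l h f + tilt_mean l h g"
  unfolding tilt_mean_def by (simp add: distrib_right add_divide_distrib bounded_meas_integrable bounded_meas_mult bounded_meas_wt)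

lemma tilt_mean_cmult: "tilt_mean l h (\<lambda>\<omega>. c * f \<omega>) = c * tilt_mean l h f"
  unfolding tilt_mean_def by (simp add: mult.assoc)

lemma tilt_mean_const [simp]: "tilt_mean l h (\<lambda>_. c) = c"
  using tilt_mean_cmult[of l h c "\<lambda>_. 1"] by simp

definition depth_top :: "(nat \<Rightarrow> real) \<Rightarrow> real" where
  "depth_top h = (SOME S. (\<forall>\<omega>. inner_d d h (Y \<omega>) \<le> S) \<and>
      (\<forall>u>0. prob {\<omega> \<in> space M. S - inner_d d h (Y \<omega>) \<le> 2 * u}
             \<le> D * prob {\<omega> \<in> space M. S - inner_d d h (Y \<omega>) \<le> u}))"

definition depth :: "(nat \<Rightarrow> real) \<Rightarrow> 'a \<Rightarrow> real" where
  "depth h \<omega> = depth_top h - inner_d d h (Y \<omega>)"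

lemma depth_nonneg: "0 \<le> depth h \<omega>"
  and depth_doubling: "0 < u \<Longrightarrow> prob {\<omega> \<in> space M. depth h \<omega> \<le> 2 * u} \<le> D * prob {\<omega> \<in> space M. depth h \<omega> \<le> u}"
  using someI_ex[OF doubling[of h]] unfolding depth_def depth_top_def by auto

lemma bounded_meas_depth: "bounded_meas (depth h)"
  unfolding depth_def[abs_def] by (intro bounded_meas_diff bounded_meas_const bounded_meas_inner)

text \<open>Up to a constant that cancels in the quotient, the weight is exp (- V) times a Gaussian
  factor between exp (- l R^2 / 2) and 1. Taking the upper bound in the numerator and the lower one
  in the partition function leaves the comparison of exp (- V / 2) with exp (- V).\<close>

lemma tilt_mean_exp_depth_le:
  assumes l: "0 \<le> l"
  shows "tilt_mean l h (\<lambda>\<omega>. exp (depth h \<omega> / 2)) \<le> D * exp (l * R\<^sup>2 / 2)"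
proof -
  have bmV: "bounded_meas (\<lambda>\<omega>. exp (c * depth h \<omega>))" for c by (intro bounded_meas_exp bounded_meas_mult bounded_meas_const bounded_meas_depth)
  have yy: "0 \<le> inner_d d (Y \<omega>) (Y \<omega>)" "inner_d d (Y \<omega>) (Y \<omega>) \<le> R\<^sup>2" for \<omega>
    using abs_inner_YY_le[of \<omega> \<omega>] by (auto simp: inner_d_self)
  have wt: "wt l h \<omega> = exp (depth_top h) * exp (- depth h \<omega> - l / 2 * inner_d d (Y \<omega>) (Y \<omega>))" for \<omega>
    unfolding wt_def logw_def depth_def by (simp add: exp_add[symmetric])
  define s where "s = exp (depth_top h)"
  have s: "0 < s" by (simp add: s_def)
  have "(\<integral>\<omega>. exp (depth h \<omega> / 2) * wt l h \<omega> \<partial>M) \<le> (\<integral>\<omega>. s * exp (- depth h \<omega> / 2) \<partial>M)"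
  proof (rule integral_mono)
    show "integrable M (\<lambda>\<omega>. exp (depth h \<omega> / 2) * wt l h \<omega>)" "integrable M (\<lambda>\<omega>. s * exp (- depth h \<omega> / 2))"
      using bmV[of "1/2"] bmV[of "-1/2"] by (auto intro!: bounded_meas_integrable bounded_meas_mult bounded_meas_wt bounded_meas_const)
    show "exp (depth h \<omega> / 2) * wt l h \<omega> \<le> s * exp (- depth h \<omega> / 2)" for \<omega>
    proof -
      have "0 \<le> l / 2 * inner_d d (Y \<omega>) (Y \<omega>)" using l yy by simp
      then show ?thesis unfolding wt s_def by (simp add: exp_add[symmetric])
    qed
  qed
  also have "\<dots> \<le> s * (D * (\<integral>\<omega>. exp (- depth h \<omega>) \<partial>M))"
    using exp_moment_doubling[of "depth h" D] bounded_meas_depth[of h] depth_nonneg depth_doubling D_ge_1 s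
    by (simp add: bounded_meas_def)
  also have "\<dots> \<le> D * exp (l * R\<^sup>2 / 2) * partition_fn l h"
  proof -
    have "s * exp (- (l * R\<^sup>2 / 2)) * (\<integral>\<omega>. exp (- depth h \<omega>) \<partial>M) = (\<integral>\<omega>. s * exp (- (l * R\<^sup>2 / 2)) * exp (- depth h \<omega>) \<partial>M)"
      by simp
    also have "\<dots> \<le> partition_fn l h" unfolding partition_fn_def
    proof (rule integral_mono)
      show "integrable M (\<lambda>\<omega>. s * exp (- (l * R\<^sup>2 / 2)) * exp (- depth h \<omega>))" "integrable M (wt l h)"
        using bmV[of "-1"] by (auto intro!: bounded_meas_integrable bounded_meas_mult bounded_meas_wt bounded_meas_const)
      show "s * exp (- (l * R\<^sup>2 / 2)) * exp (- depth h \<omega>) \<le> wt l h \<omega>" for \<omega>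
        unfolding wt s_def using mult_left_mono[OF yy(2) l, of \<omega>] by (simp add: exp_add[symmetric])
    qed
    finally have "D * exp (l * R\<^sup>2 / 2) * (s * exp (- (l * R\<^sup>2 / 2)) * (\<integral>\<omega>. exp (- depth h \<omega>) \<partial>M))
      \<le> D * exp (l * R\<^sup>2 / 2) * partition_fn l h"
      using D_ge_1 by (intro mult_left_mono) auto
    moreover have "D * exp (l * R\<^sup>2 / 2) * (s * exp (- (l * R\<^sup>2 / 2)) * (\<integral>\<omega>. exp (- depth h \<omega>) \<partial>M))
      = s * (D * (\<integral>\<omega>. exp (- depth h \<omega>) \<partial>M)) * (exp (l * R\<^sup>2 / 2) * exp (- (l * R\<^sup>2 / 2)))"
      by (simp add: mult_ac)
    moreover have "exp (l * R\<^sup>2 / 2) * exp (- (l * R\<^sup>2 / 2)) = 1" by (simp add: exp_add[symmetric])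
    ultimately show ?thesis by simp
  qed
  finally show ?thesis unfolding tilt_mean_def using partition_fn_pos[of l h] by (simp add: divide_le_eq)
qed

text \<open>Comparing with \<open>exp (V / 2 - l R\<^sup>2 / 2)\<close> instead of \<open>exp (V / 2)\<close> keeps the bound polynomial in
  \<open>l R\<^sup>2\<close>, although the exponential moment is exponentially large.\<close>

lemma tilt_mean_depth_power_le:
  assumes l: "0 \<le> l"
  shows "tilt_mean l h (\<lambda>\<omega>. (1 + l * R\<^sup>2 + depth h \<omega>) ^ q) \<le> 2 ^ q * fact q * exp 1 * (1 + D) * (1 + l * R\<^sup>2) ^ q"
proof -
  define A where "A = 1 + l * R\<^sup>2"
  define r where "r = l * R\<^sup>2 / 2"
  define c where "c = (2 * A) ^ q * fact q * exp 1"
  have A: "1 \<le> A" "0 \<le> r" "2 * r \<le> A" using l by (auto simp: A_def r_def)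
  have c: "0 \<le> c" using A by (simp add: c_def)
  have bmV: "bounded_meas (\<lambda>\<omega>. exp (depth h \<omega> / 2))" using bounded_meas_exp[OF bounded_meas_mult[OF bounded_meas_const[of "1/2"] bounded_meas_depth[of h]]] by simp
  have pt: "(A + depth h \<omega>) ^ q \<le> c * 1 + c * exp (- r) * exp (depth h \<omega> / 2)" for \<omega>
  proof -
    \<comment> \<open>\<open>z\<close> is the excess of V / 2 over \<open>r\<close>. From V <= 2z +
      2r and 2r <= A follows A + V <= 2A (1 + z), and the power of 1 + z is absorbed by an
      exponential, which explains \<open>c\<close>.\<close>
    define z where "z = max 0 (depth h \<omega> / 2 - r)"
    have z: "0 \<le> z" "depth h \<omega> \<le> 2 * z + 2 * r" by (auto simp: z_def max_def field_simps)
    have "A + depth h \<omega> \<le> 2 * A + 2 * z * 1" using z A by linarith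
    also have "\<dots> \<le> 2 * A + 2 * z * A" using z A by (intro add_left_mono mult_left_mono) auto
    finally have "(A + depth h \<omega>) ^ q \<le> (2 * A * (1 + z)) ^ q"
      using A depth_nonneg[of h \<omega>] by (intro power_mono) (auto simp: algebra_simps)
    also have "\<dots> \<le> (2 * A) ^ q * (fact q * exp (1 + z))"
      unfolding power_mult_distrib[of "2 * A"] using power_le_fact_exp[of "1 + z" q] z A by (intro mult_left_mono) auto
    also have "\<dots> = c * exp z" by (simp add: c_def exp_add)
    also have "exp z \<le> 1 + exp (depth h \<omega> / 2 - r)" by (auto simp: z_def max_def)
    also have "exp (depth h \<omega> / 2 - r) = exp (- r) * exp (depth h \<omega> / 2)" by (simp add: exp_add[symmetric])
    finally show ?thesis using c by (simp add: distrib_left mult.assoc mult_left_mono)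
  qed
  have "tilt_mean l h (\<lambda>\<omega>. (A + depth h \<omega>) ^ q) \<le> tilt_mean l h (\<lambda>\<omega>. c * 1 + c * exp (- r) * exp (depth h \<omega> / 2))"
    by (intro tilt_mean_mono bounded_meas_power bounded_meas_add bounded_meas_const bounded_meas_depth bounded_meas_mult bmV pt)
  also have "\<dots> = c + c * exp (- r) * tilt_mean l h (\<lambda>\<omega>. exp (depth h \<omega> / 2))"
    by (subst tilt_mean_add) (simp_all only: tilt_mean_cmult tilt_mean_const mult_1_right bounded_meas_mult bounded_meas_const bmV)
  \<comment> \<open>The factor exp (- r) cancels exactly the exponential growth in l R^2 of the
    moment just bounded.\<close>
  also have "\<dots> \<le> c + c * exp (- r) * (D * exp r)"
    using tilt_mean_exp_depth_le[OF l, of h] c by (intro add_left_mono mult_left_mono) (auto simp: r_def)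
  also have "\<dots> = 2 ^ q * fact q * exp 1 * (1 + D) * A ^ q"
    by (simp add: c_def algebra_simps power_mult_distrib exp_minus)
  finally show ?thesis by (simp add: A_def)
qed

text \<open>A sum over the replicas, so that its powers reduce to moments of single replicas and no
  joint estimate is required.\<close>

definition size_bd :: "nat \<Rightarrow> real \<Rightarrow> (nat \<Rightarrow> real) \<Rightarrow> (nat \<Rightarrow> 'a) \<Rightarrow> real" where
  "size_bd n l h ys = (\<Sum>i<n. 1 + l * R\<^sup>2 + depth h (ys i))"

lemma admissible_size_bd: "admissible n (size_bd n l h)"
  unfolding size_bd_def[abs_def] by (intro admissible_sum admissible_add admissible_const admissible_coord bounded_meas_depth) auto

lemma size_bd_ge:
  assumes "0 \<le> l" "i < n" shows "1 + l * R\<^sup>2 + depth h (ys i) \<le> size_bd n l h ys"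
  unfolding size_bd_def using assms depth_nonneg[of h] by (intro member_le_sum) auto

text \<open>In a gap the common supremum cancels: it is a difference of two nonnegative depths. A
  Gram entry is at most l R^2 by Cauchy-Schwarz.\<close>

lemma size_bd_bounds:
  assumes l: "0 \<le> l" and n: "0 < n"
  shows "1 \<le> size_bd n l h ys"
    and "i < n \<Longrightarrow> j < n \<Longrightarrow> \<bar>inner_d d h (Y (ys i)) - inner_d d h (Y (ys j))\<bar> \<le> size_bd n l h ys"
    and "\<bar>l * inner_d d (Y (ys i)) (Y (ys j))\<bar> \<le> size_bd n l h ys"
proof -
  have lR: "0 \<le> l * R\<^sup>2" using l by simp
  show "1 \<le> size_bd n l h ys"
    using size_bd_ge[OF l n, of h ys] lR depth_nonneg[of h "ys 0"] by linarith
  show "\<bar>inner_d d h (Y (ys i)) - inner_d d h (Y (ys j))\<bar> \<le> size_bd n l h ys" if "i < n" "j < n"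
    using size_bd_ge[OF l that(1), of h ys] size_bd_ge[OF l that(2), of h ys] lR
      depth_nonneg[of h "ys i"] depth_nonneg[of h "ys j"] unfolding depth_def by linarith
  have "\<bar>l * inner_d d (Y (ys i)) (Y (ys j))\<bar> \<le> l * R\<^sup>2"
    unfolding abs_mult using l abs_inner_YY_le by (simp add: mult_left_mono)
  then show "\<bar>l * inner_d d (Y (ys i)) (Y (ys j))\<bar> \<le> size_bd n l h ys"
    using size_bd_ge[OF l n, of h ys] depth_nonneg[of h "ys 0"] by linarith
qed

lemma replica_mean_size_bd_le:
  assumes l: "0 \<le> l" and n: "0 < n"
  shows "replica_mean n l h (\<lambda>ys. size_bd n l h ys ^ q) \<le> moment_const D n q * (1 + l * R\<^sup>2) ^ q"
proof -
  let ?a = "\<lambda>\<omega>. 1 + l * R\<^sup>2 + depth h \<omega>"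
  have bma: "bounded_meas (\<lambda>\<omega>. ?a \<omega> ^ q)" by (intro bounded_meas_power bounded_meas_add bounded_meas_const bounded_meas_depth)
  have "replica_mean n l h (\<lambda>ys. size_bd n l h ys ^ q) \<le> replica_mean n l h (\<lambda>ys. real n ^ q * (\<Sum>i<n. ?a (ys i) ^ q))"
  proof (rule replica_mean_mono)
    show "admissible n (\<lambda>ys. real n ^ q * (\<Sum>i<n. ?a (ys i) ^ q))"
      by (intro admissible_mult admissible_const admissible_sum admissible_coord[OF bma]) auto
    show "size_bd n l h ys ^ q \<le> real n ^ q * (\<Sum>i<n. ?a (ys i) ^ q)" for ys
      unfolding size_bd_def using l depth_nonneg n by (intro sum_power_le) auto
  qed (intro admissible_power admissible_size_bd)
  also have "\<dots> = real n ^ q * (\<Sum>i<n. replica_mean n l h (\<lambda>ys. ?a (ys i) ^ q))"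
    unfolding replica_mean_cmult by (subst replica_mean_sum) (auto intro: admissible_coord[OF bma])
  also have "(\<Sum>i<n. replica_mean n l h (\<lambda>ys. ?a (ys i) ^ q)) = real n * tilt_mean l h (\<lambda>\<omega>. ?a \<omega> ^ q)"
    by (simp add: replica_mean_coord[OF bma] cong: sum.cong_simp)
  also have "real n ^ q * (real n * tilt_mean l h (\<lambda>\<omega>. ?a \<omega> ^ q))
      \<le> real n ^ q * (real n * (2 ^ q * fact q * exp 1 * (1 + D) * (1 + l * R\<^sup>2) ^ q))"
    by (intro mult_left_mono tilt_mean_depth_power_le l) auto
  also have "\<dots> = moment_const D n q * (1 + l * R\<^sup>2) ^ q" by (simp add: moment_const_def mult_ac)
  finally show ?thesis .
qed

text \<open>Duality: pairing the vector with itself puts only its inner product with Y_0 under the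
  mean, and one factor of its norm is cancelled. Bounding each coordinate would cost a power of
  d.\<close>

lemma norm_replica_mean_le:
  assumes G: "admissible n G" and F: "admissible n F" and n: "0 < n" and GF: "\<And>ys. \<bar>G ys\<bar> \<le> F ys"
  shows "norm_d d (\<lambda>i. replica_mean n l h (\<lambda>ys. Y (ys 0) i * G ys)) \<le> R * replica_mean n l h F"
proof -
  define v where "v = (\<lambda>i. replica_mean n l h (\<lambda>ys. Y (ys 0) i * G ys))"
  have admY: "admissible n (\<lambda>ys. Y (ys 0) i * G ys)" if "i < d" for i
    using n that by (intro admissible_mult admissible_Y G)
  have "0 \<le> F ys" for ys using GF[of ys] abs_ge_zero[of "G ys"] by linarith
  then have "0 \<le> replica_mean n l h F"
    using replica_mean_mono[OF admissible_const F, of 0 l h] by simp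
  have "(norm_d d v)\<^sup>2 = (\<Sum>i<d. replica_mean n l h (\<lambda>ys. v i * (Y (ys 0) i * G ys)))"
    unfolding inner_d_self[symmetric] replica_mean_cmult by (simp add: inner_d_def v_def)
  also have "\<dots> = replica_mean n l h (\<lambda>ys. \<Sum>i<d. v i * (Y (ys 0) i * G ys))"
    by (subst replica_mean_sum) (auto intro!: admissible_mult admissible_const admY)
  also have "\<dots> = replica_mean n l h (\<lambda>ys. inner_d d v (Y (ys 0)) * G ys)"
    by (simp add: inner_d_def sum_distrib_right mult.assoc)
  also have "\<dots> \<le> replica_mean n l h (\<lambda>ys. norm_d d v * R * F ys)"
  proof (rule order_trans[OF abs_ge_self replica_mean_abs_le])
    show "\<bar>inner_d d v (Y (ys 0)) * G ys\<bar> \<le> norm_d d v * R * F ys" for ys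
      unfolding abs_mult by (intro mult_mono abs_inner_Y_le GF) (auto intro: mult_nonneg_nonneg R_nonneg)
  qed (use n in \<open>intro admissible_mult admissible_inner admissible_const G F; simp\<close>)+
  also have "\<dots> = norm_d d v * (R * replica_mean n l h F)" by (simp only: replica_mean_cmult mult.assoc)
  finally have "norm_d d v * norm_d d v \<le> norm_d d v * (R * replica_mean n l h F)"
    by (simp add: power2_eq_square)
  moreover have "0 \<le> R * replica_mean n l h F" using \<open>0 \<le> replica_mean n l h F\<close> R_nonneg by simp
  ultimately show ?thesis unfolding v_def[symmetric]
    using norm_d_nonneg[of d v] by (metis mult_le_cancel_left_pos order_le_less)
qed

lemma norm_replica_mean_expr_val_le:
  assumes l: "0 \<le> l" and n: "0 < n" and e: "replicas e \<subseteq> {..<n}"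
  shows "norm_d d (\<lambda>i. replica_mean n l h (\<lambda>ys. Y (ys 0) i * expr_val d l h (\<lambda>i. Y (ys i)) e))
    \<le> R * (coef_bd e * moment_const D n (deg_atom e) * ((1 + l) ^ deg_eta e * (1 + l * R\<^sup>2) ^ deg_atom e))"
proof -
  let ?F = "\<lambda>ys. coef_bd e * (1 + l) ^ deg_eta e * size_bd n l h ys ^ deg_atom e"
  have "norm_d d (\<lambda>i. replica_mean n l h (\<lambda>ys. Y (ys 0) i * expr_val d l h (\<lambda>i. Y (ys i)) e)) \<le> R * replica_mean n l h ?F"
    by (intro norm_replica_mean_le admissible_expr_val e n admissible_mult admissible_const admissible_power admissible_size_bd
        abs_expr_val_le[OF e l] size_bd_bounds l)
  also have "replica_mean n l h ?F \<le> coef_bd e * (1 + l) ^ deg_eta e * (moment_const D n (deg_atom e) * (1 + l * R\<^sup>2) ^ deg_atom e)"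
    unfolding replica_mean_cmult using l by (intro mult_left_mono replica_mean_size_bd_le n mult_nonneg_nonneg coef_bd_nonneg) auto
  then have "R * replica_mean n l h ?F \<le> R * (coef_bd e * (1 + l) ^ deg_eta e * (moment_const D n (deg_atom e) * (1 + l * R\<^sup>2) ^ deg_atom e))"
    by (rule mult_left_mono[OF _ R_nonneg])
  finally show ?thesis by (simp add: mult_ac)
qed

text \<open>The direction enters through its inner products with samples, each at most \<rho> R.
  Every one of the \<open>n\<close> centred weights holds two of them, whence the 2n beside
  \<open>grad_bd\<close>; the outer R belongs to Y_0.\<close>

lemma norm_replica_mean_replica_deriv_le:
  assumes l: "0 \<le> l" and e: "replicas e \<subseteq> {..<n}" and w: "norm_d d w \<le> \<rho>"
  shows "norm_d d (\<lambda>i. replica_mean (Suc n) l h (\<lambda>ys. Y (ys 0) i * replica_deriv n d l h 0 w (\<lambda>i. Y (ys i)) e))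
    \<le> R * (\<rho> * R * ((grad_bd e + 2 * real n * coef_bd e) * moment_const D (Suc n) (deg_atom e) * ((1 + l) ^ deg_eta e * (1 + l * R\<^sup>2) ^ deg_atom e)))"
proof -
  define c where "c = \<rho> * R * (grad_bd e + 2 * real n * coef_bd e) * (1 + l) ^ deg_eta e"
  let ?F = "\<lambda>ys. c * size_bd (Suc n) l h ys ^ deg_atom e"
  have \<rho>: "0 \<le> \<rho>" using w norm_d_nonneg[of d w] by linarith
  have \<rho>R: "0 \<le> \<rho> * R" using \<rho> R_nonneg by simp
  have c: "0 \<le> c" unfolding c_def using \<rho> R_nonneg l by (auto intro!: mult_nonneg_nonneg add_nonneg_nonneg grad_bd_nonneg coef_bd_nonneg)
  have e': "replicas e \<subseteq> {..<Suc n}" using e by auto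
  have dir: "\<bar>inner_d d w (Y \<omega>)\<bar> \<le> \<rho> * R" for \<omega>
    by (rule order_trans[OF abs_inner_Y_le]) (intro mult_right_mono w R_nonneg)
  have "norm_d d (\<lambda>i. replica_mean (Suc n) l h (\<lambda>ys. Y (ys 0) i * replica_deriv n d l h 0 w (\<lambda>i. Y (ys i)) e)) \<le> R * replica_mean (Suc n) l h ?F"
  proof (rule norm_replica_mean_le)
    fix ys :: "nat \<Rightarrow> 'a"
    let ?y = "\<lambda>i. Y (ys i)" let ?T = "size_bd (Suc n) l h ys"
    have T: "0 \<le> (1 + l) ^ deg_eta e * ?T ^ deg_atom e" using l size_bd_bounds(1)[OF l, of "Suc n" h ys] by simp
    have "\<bar>expr_deriv d l h 0 w ?y e\<bar> \<le> (\<rho> * R * grad_bd e) * (1 + l) ^ deg_eta e * ?T ^ deg_atom e"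
      by (intro abs_expr_deriv_le[OF e' l] size_bd_bounds l \<rho>R dir) auto
    moreover have "\<bar>expr_val d l h ?y e * (\<Sum>i<n. log_tilt d 0 w (?y i) - log_tilt d 0 w (?y n))\<bar>
        \<le> (coef_bd e * (1 + l) ^ deg_eta e * ?T ^ deg_atom e) * (real n * (2 * (\<rho> * R)))"
      unfolding abs_mult
    proof (intro mult_mono)
      show "\<bar>expr_val d l h ?y e\<bar> \<le> coef_bd e * (1 + l) ^ deg_eta e * ?T ^ deg_atom e"
        by (intro abs_expr_val_le[OF e' l] size_bd_bounds l) auto
      have "\<bar>\<Sum>i<n. log_tilt d 0 w (?y i) - log_tilt d 0 w (?y n)\<bar> \<le> (\<Sum>i<n. \<bar>log_tilt d 0 w (?y i) - log_tilt d 0 w (?y n)\<bar>)"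
        by (rule sum_abs)
      also have "\<dots> \<le> real (card {..<n}) * (2 * (\<rho> * R))"
      proof (rule sum_bounded_above)
        show "\<bar>log_tilt d 0 w (?y i) - log_tilt d 0 w (?y n)\<bar> \<le> 2 * (\<rho> * R)" for i
          using dir[of "ys i"] dir[of "ys n"] unfolding log_tilt_def by simp
      qed
      finally show "\<bar>\<Sum>i<n. log_tilt d 0 w (?y i) - log_tilt d 0 w (?y n)\<bar> \<le> real n * (2 * (\<rho> * R))" by simp
    qed (use T coef_bd_nonneg[of e] in \<open>auto simp: mult.assoc\<close>)
    ultimately show "\<bar>replica_deriv n d l h 0 w ?y e\<bar> \<le> c * ?T ^ deg_atom e"
      unfolding replica_deriv_def c_def by (simp add: algebra_simps)
  qed (auto intro!: admissible_replica_deriv e admissible_mult admissible_const admissible_power admissible_size_bd)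
  also have "replica_mean (Suc n) l h ?F \<le> c * (moment_const D (Suc n) (deg_atom e) * (1 + l * R\<^sup>2) ^ deg_atom e)"
    unfolding replica_mean_cmult by (intro mult_left_mono replica_mean_size_bd_le l c) auto
  then have "R * replica_mean (Suc n) l h ?F \<le> R * (c * (moment_const D (Suc n) (deg_atom e) * (1 + l * R\<^sup>2) ^ deg_atom e))"
    by (rule mult_left_mono[OF _ R_nonneg])
  finally show ?thesis unfolding c_def by (simp add: mult_ac)
qed

end

subsection \<open>The iterated material derivative\<close>

lemma replica_deriv_zero: "replica_deriv n d l h 0 (\<lambda>_. 0) y e = 0"
  using replica_deriv_lincomb[of n d l h 1 0 0 "\<lambda>_. 0" "\<lambda>_. 0" y e] by simp

lemma replica_deriv_scale: "replica_deriv n d l h 0 (\<lambda>m. c * w m) y e = c * replica_deriv n d l h 0 w y e"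
  using replica_deriv_lincomb[of n d l h c 0 0 w "\<lambda>_. 0" y e] by (simp add: replica_deriv_zero)

lemma norm_d_cong: "(\<And>i. i < d \<Longrightarrow> x i = y i) \<Longrightarrow> norm_d d x = norm_d d y"
  unfolding norm_d_def by (rule L2_set_cong) auto

lemma opnorm_d_le:
  assumes "\<And>v. norm_d d v \<le> 1 \<Longrightarrow> norm_d d (\<lambda>i. \<Sum>k<d. A i k * v k) \<le> B"
  shows "opnorm_d d A \<le> B"
  unfolding opnorm_d_def
proof (rule cSUP_least)
  have "restrict (\<lambda>_. 0) {..<d} \<in> cball_d d 1"
    unfolding cball_d_def by (auto simp: norm_d_def L2_set_def)
  then show "cball_d d 1 \<noteq> {}" by auto
qed (auto simp: cball_d_def intro: assms)

lemma fun_upd_Rd: "x \<in> Rd d \<Longrightarrow> k < d \<Longrightarrow> x(k := r) \<in> Rd d"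
  by (auto simp: PiE_def extensional_def)

text \<open>The source of the exponent 2m: 1 + l R^2 <= (1 + R)^2 (1 + l), so one power of 1 + l
  together with one atom costs the square of (1 + R)(1 + l).\<close>

lemma tilt_growth_le:
  assumes l: "0 \<le> l" and R: "0 \<le> (R :: real)"
  shows "(1 + l) ^ m * (1 + l * R\<^sup>2) ^ m \<le> ((1 + R) * (1 + l)) ^ (2 * m)"
proof -
  have "1 + l * R\<^sup>2 \<le> (1 + R)\<^sup>2 * (1 + l)"
    using l R by (simp add: power2_eq_square algebra_simps)
  then have "(1 + l * R\<^sup>2) ^ m \<le> ((1 + R)\<^sup>2 * (1 + l)) ^ m"
    using l by (intro power_mono) auto
  then have "(1 + l) ^ m * (1 + l * R\<^sup>2) ^ m \<le> (1 + l) ^ m * ((1 + R)\<^sup>2 * (1 + l)) ^ m"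
    using l by (intro mult_left_mono) auto
  also have "\<dots> = ((1 + R) * (1 + l)) ^ (2 * m)"
    by (simp add: power_mult_distrib[symmetric] power_mult) (simp add: power2_eq_square mult_ac)
  finally show ?thesis .
qed

text \<open>The three summands belong to the multiple of x, to the expectation and to its spatial
  derivative; their sum serves both estimates.\<close>

definition Lx_const :: "real \<Rightarrow> nat \<Rightarrow> real" where
  "Lx_const D j = poly_norm (linear_seq j) + coef_bd (moment_seq j) * moment_const D (2 * j + 1) (deg_atom (moment_seq j))
     + (grad_bd (moment_seq j) + 2 * real (2 * j + 1) * coef_bd (moment_seq j)) * moment_const D (Suc (2 * j + 1)) (deg_atom (moment_seq j))"

text \<open>The formula for the score is all that the iteration has to know about the
  density.\<close>

locale ou_tilt = doubling_tilt +
  fixes p :: "real \<Rightarrow> (nat \<Rightarrow> real) \<Rightarrow> real"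
  assumes score: "\<And>t x i. 0 < t \<Longrightarrow> x \<in> Rd d \<Longrightarrow> i < d \<Longrightarrow>
    mod_score d p t x i = - lam t * x i + bet t * tilt_mean (lam t) (\<lambda>k. bet t * x k) (\<lambda>\<omega>. Y \<omega> i)"
begin

definition Phi :: "nat \<Rightarrow> real \<Rightarrow> (nat \<Rightarrow> real) \<Rightarrow> nat \<Rightarrow> real" where
  "Phi j t x i = replica_mean (2 * j + 1) (lam t) (\<lambda>k. bet t * x k)
     (\<lambda>ys. Y (ys 0) i * expr_val d (lam t) (\<lambda>k. bet t * x k) (\<lambda>i. Y (ys i)) (moment_seq j))"

text \<open>The derivative of \<open>Phi\<close> along a velocity (l', h') of the pair (lam, h);
  time and space derivatives are both instances.\<close>

definition DPhi :: "nat \<Rightarrow> real \<Rightarrow> (nat \<Rightarrow> real) \<Rightarrow> nat \<Rightarrow> real \<Rightarrow> (nat \<Rightarrow> real) \<Rightarrow> real" where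
  "DPhi j t x i l' h' = replica_mean (Suc (2 * j + 1)) (lam t) (\<lambda>k. bet t * x k)
     (\<lambda>ys. Y (ys 0) i * replica_deriv (2 * j + 1) d (lam t) (\<lambda>k. bet t * x k) l' h' (\<lambda>i. Y (ys i)) (moment_seq j))"

definition Lx_field :: "nat \<Rightarrow> real \<Rightarrow> (nat \<Rightarrow> real) \<Rightarrow> nat \<Rightarrow> real" where
  "Lx_field j t x i = lam t * poly (linear_seq j) (1 + lam t) * x i + bet t * Phi j t x i"

lemma Phi_has_derivative_time:
  assumes "0 < t" "i < d"
  shows "((\<lambda>s. Phi j s x i) has_real_derivative
    DPhi j t x i (- (lam t * (1 + lam t))) (\<lambda>k. - ((1/2 + lam t) * (bet t * x k)))) (at t)"
proof -
  have "((\<lambda>s. bet s * x k) has_real_derivative - ((1/2 + lam t) * (bet t * x k))) (at t)" for k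
    using DERIV_cmult_right[OF bet_has_derivative[OF assms(1)], of "x k"] by (simp add: mult.assoc)
  then show ?thesis unfolding Phi_def DPhi_def
    using replica_mean_expr_val_has_derivative[OF replicas_moment_seq _ assms(2) lam_has_derivative[OF assms(1)],
        where H = "\<lambda>s k. bet s * x k" and h' = "\<lambda>k. - ((1/2 + lam t) * (bet t * x k))"]
    by simp
qed

lemma Phi_has_derivative_space:
  assumes "k < d" "i < d"
  shows "((\<lambda>r. Phi j t (x(k := r)) i) has_real_derivative
    bet t * DPhi j t x i 0 (\<lambda>m. if m = k then 1 else 0)) (at (x k))"
proof -
  have H: "((\<lambda>r. bet t * (x(k := r)) m) has_real_derivative bet t * (if m = k then 1 else 0)) (at (x k))" for m
    by (cases "m = k") (auto intro!: derivative_eq_intros)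
  have "((\<lambda>r. Phi j t (x(k := r)) i) has_real_derivative
      DPhi j t (x(k := x k)) i 0 (\<lambda>m. bet t * (if m = k then 1 else 0))) (at (x k))"
    unfolding Phi_def DPhi_def
    by (rule replica_mean_expr_val_has_derivative[OF replicas_moment_seq _ assms(2) DERIV_const, where H = "\<lambda>r m. bet t * (x(k := r)) m"])
      (use H in auto)
  also have "DPhi j t (x(k := x k)) i 0 (\<lambda>m. bet t * (if m = k then 1 else 0))
      = bet t * DPhi j t x i 0 (\<lambda>m. if m = k then 1 else 0)"
    unfolding DPhi_def fun_upd_triv replica_mean_cmult[symmetric] by (subst replica_deriv_scale) (simp add: mult_ac)
  finally show ?thesis .
qed

lemma partial_Lx_field:
  assumes "k < d" "i < d"
  shows "partial k (\<lambda>z. Lx_field j t z i) x = lam t * poly (linear_seq j) (1 + lam t) * (if k = i then 1 else 0)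
    + bet t * (bet t * DPhi j t x i 0 (\<lambda>m. if m = k then 1 else 0))"
proof -
  have "((\<lambda>r. (x(k := r)) i) has_real_derivative (if k = i then 1 else 0)) (at (x k))"
    by (cases "k = i") (auto intro!: derivative_eq_intros)
  then show ?thesis unfolding partial_def Lx_field_def
    by (intro DERIV_imp_deriv DERIV_add DERIV_cmult Phi_has_derivative_space assms)
qed

lemma deriv_Lx_field:
  assumes "0 < t" "i < d"
  shows "deriv (\<lambda>s. Lx_field j s x i) t
    = - (lam t * (1 + lam t)) * (poly (linear_seq j) (1 + lam t) + lam t * poly (pderiv (linear_seq j)) (1 + lam t)) * x i
      - (1/2 + lam t) * bet t * Phi j t x i
      + bet t * DPhi j t x i (- (lam t * (1 + lam t))) (\<lambda>k. - ((1/2 + lam t) * (bet t * x k)))"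
proof -
  have "((\<lambda>s. poly (linear_seq j) (1 + lam s)) has_real_derivative
      poly (pderiv (linear_seq j)) (1 + lam t) * (- (lam t * (1 + lam t)))) (at t)"
    using DERIV_chain2[OF poly_DERIV, of "\<lambda>s. 1 + lam s" _ t UNIV "linear_seq j"] lam_has_derivative[OF assms(1)]
    by (auto intro!: derivative_eq_intros)
  from DERIV_add[OF DERIV_cmult_right[OF DERIV_mult[OF lam_has_derivative[OF assms(1)] this], of "x i"]
      DERIV_mult[OF bet_has_derivative[OF assms(1)] Phi_has_derivative_time[OF assms, of j x]]]
  show ?thesis unfolding Lx_field_def by (rule DERIV_imp_deriv[THEN trans]) (simp add: algebra_simps)
qed

text \<open>Transporting x yields half the score. Its part - lam x / 2 returns to the multiple of x,
  which is the subtracted term of \<open>linear_seq\<close>; its part bet m / 2 is bet times an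
  expectation of Y_0 and becomes the polynomial added in \<open>moment_seq\<close>.\<close>

lemma Lx_field_Suc:
  assumes t: "0 < t" and x: "x \<in> Rd d" and i: "i < d"
  shows "- deriv (\<lambda>s. Lx_field j s x i) t + 1/2 * (\<Sum>k<d. mod_score d p t x k * partial k (\<lambda>z. Lx_field j t z i) x)
    = Lx_field (Suc j) t x i"
proof -
  let ?n = "2 * j + 1"
  define l where "l = lam t"
  define b where "b = bet t"
  define h where "h = (\<lambda>k. b * x k)"
  define q where "q = poly (linear_seq j) (1 + l)"
  define q' where "q' = poly (pderiv (linear_seq j)) (1 + l)"
  define m where "m = (\<lambda>k. tilt_mean l h (\<lambda>\<omega>. Y \<omega> k))"
  define T where "T = DPhi j t x i (- (l * (1 + l))) (\<lambda>k. - ((1/2 + l) * h k))"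
  define U where "U = (\<lambda>k. DPhi j t x i 0 (\<lambda>m. if m = k then 1 else 0))"
  define S where "S = (\<Sum>k<d. (- l * x k + b * m k) * (b * U k))"
  define G where "G = replica_mean (Suc (Suc ?n)) l h (\<lambda>ys. Y (ys 0) i * expr_val d l h (\<lambda>i. Y (ys i)) (flow_step ?n (moment_seq j)))"
  have main: "(1/2 + l) * Phi j t x i - T + 1/2 * S = G"
    unfolding Phi_def T_def S_def U_def DPhi_def G_def m_def h_def l_def b_def
    by (rule material_replica_mean[OF replicas_moment_seq _ i]) (simp_all add: bet_square[OF t])
  have sc: "mod_score d p t x k = - l * x k + b * m k" if "k < d" for k
    using score[OF t x that] by (simp add: l_def b_def m_def h_def)
  have "(\<Sum>k<d. mod_score d p t x k * partial k (\<lambda>z. Lx_field j t z i) x)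
    = (\<Sum>k<d. (- l * x k + b * m k) * (l * q * (if k = i then 1 else 0) + b * (b * U k)))"
    by (intro sum.cong refl) (simp add: sc partial_Lx_field i l_def b_def q_def U_def)
  also have "\<dots> = (\<Sum>k<d. if k = i then (- l * x k + b * m k) * (l * q) else 0) + b * S"
    unfolding S_def sum_distrib_left sum.distrib[symmetric] by (intro sum.cong refl) (auto simp: algebra_simps)
  also have "(\<Sum>k<d. if k = i then (- l * x k + b * m k) * (l * q) else 0) = (- l * x i + b * m i) * (l * q)"
    using i by simp
  finally have sum: "(\<Sum>k<d. mod_score d p t x k * partial k (\<lambda>z. Lx_field j t z i) x)
    = (- l * x i + b * m i) * (l * q) + b * S" .
  have der: "deriv (\<lambda>s. Lx_field j s x i) t
    = - (l * (1 + l)) * (q + l * q') * x i - (1/2 + l) * b * Phi j t x i + b * T"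
    unfolding deriv_Lx_field[OF t i] by (simp add: l_def b_def q_def q'_def T_def h_def)
  have Phi': "Phi (Suc j) t x i = G + 1/2 * l * q * m i"
  proof -
    have admG: "admissible (Suc (Suc ?n)) (\<lambda>ys. Y (ys 0) i * expr_val d l h (\<lambda>i. Y (ys i)) (flow_step ?n (moment_seq j)))"
      by (intro admissible_mult admissible_Y i admissible_expr_val replicas_step replicas_moment_seq) simp
    have "Phi (Suc j) t x i = replica_mean (Suc (Suc ?n)) l h
        (\<lambda>ys. Y (ys 0) i * expr_val d l h (\<lambda>i. Y (ys i)) (flow_step ?n (moment_seq j)) + (1/2 * l * q) * Y (ys 0) i)"
      unfolding Phi_def by (simp add: l_def[symmetric] b_def[symmetric] h_def[symmetric] q_def algebra_simps)
    also have "\<dots> = G + (1/2 * l * q) * replica_mean (Suc (Suc ?n)) l h (\<lambda>ys. Y (ys 0) i)"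
      unfolding G_def by (subst replica_mean_add[OF admG]) (auto simp only: replica_mean_cmult intro!: admissible_mult admissible_const admissible_Y i)
    also have "replica_mean (Suc (Suc ?n)) l h (\<lambda>ys. Y (ys 0) i) = m i"
      unfolding m_def by (rule replica_mean_coord[OF bounded_meas_Y[OF i]]) simp
    finally show ?thesis .
  qed
  have coef: "poly (linear_seq (Suc j)) (1 + l) = (1 + l) * q + (1 + l) * l * q' - 1/2 * l * q"
    by (simp add: q_def q'_def algebra_simps add_divide_distrib)
  have "Lx_field (Suc j) t x i = l * ((1 + l) * q + (1 + l) * l * q' - 1/2 * l * q) * x i + b * (G + 1/2 * l * q * m i)"
    unfolding Lx_field_def Phi' l_def[symmetric] b_def[symmetric] coef ..
  also have "\<dots> = - (- (l * (1 + l)) * (q + l * q') * x i - (1/2 + l) * b * Phi j t x i + b * T)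
      + 1/2 * ((- l * x i + b * m i) * (l * q) + b * S)"
    unfolding main[symmetric] by (simp add: algebra_simps add_divide_distrib diff_divide_distrib)
  finally show ?thesis unfolding sum der by simp
qed

lemma Lx_eq_Lx_field:
  assumes "0 < t" "x \<in> Rd d" "i < d"
  shows "Lx d p (Suc j) t x i = Lx_field j t x i"
  using assms
proof (induction j arbitrary: t x i)
  case 0
  have part: "partial k (\<lambda>z. z i) x = (if k = i then 1 else 0)" for k
    unfolding partial_def by (intro DERIV_imp_deriv, cases "k = i") (auto intro!: derivative_eq_intros)
  have "Lx d p (Suc 0) t x i = 1/2 * mod_score d p t x i"
    using 0 by (simp add: Lx_def material_deriv_def part if_distrib cong: if_cong)
  \<comment> \<open>Half of - lam x + bet m gives the initial values -1/2 and 1/2 of the two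
    sequences.\<close>
  also have "\<dots> = Lx_field 0 t x i"
    using 0 replica_mean_cmult[of 1 "lam t" "\<lambda>k. bet t * x k" "1/2" "\<lambda>ys. Y (ys 0) i"]
      replica_mean_coord[OF bounded_meas_Y, of i 0 1 "lam t" "\<lambda>k. bet t * x k"]
    by (simp add: Lx_field_def Phi_def score field_simps)
  finally show ?case .
next
  case (Suc j)
  \<comment> \<open>The closed form is known for positive times only; these form an open set, so it
    may be differentiated at \<open>t\<close>.\<close>
  have "\<forall>\<^sub>F s in nhds t. 0 < s" using Suc.prems by (intro eventually_nhds_in_open[of "{0<..}", simplified]) auto
  then have "\<forall>\<^sub>F s in nhds t. Lx d p (Suc j) s x i = Lx_field j s x i"
    by eventually_elim (rule Suc.IH, use Suc.prems in auto)
  then have 1: "deriv (\<lambda>s. Lx d p (Suc j) s x i) t = deriv (\<lambda>s. Lx_field j s x i) t"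
    by (intro deriv_cong_ev refl)
  have 2: "partial k (\<lambda>z. Lx d p (Suc j) t z i) x = partial k (\<lambda>z. Lx_field j t z i) x" if "k < d" for k
  proof -
    \<comment> \<open>Changing a coordinate below d stays in \<open>Rd d\<close>, so the two
      functions of \<open>r\<close> agree on the whole line.\<close>
    have "Lx d p (Suc j) t (x(k := r)) i = Lx_field j t (x(k := r)) i" for r
      by (intro Suc.IH fun_upd_Rd Suc.prems that)
    then show ?thesis unfolding partial_def by simp
  qed
  have "Lx d p (Suc (Suc j)) t x i = material_deriv d p (Lx d p (Suc j)) t x i"
    by (simp add: Lx_def)
  also have "\<dots> = - deriv (\<lambda>s. Lx_field j s x i) t + 1/2 * (\<Sum>k<d. mod_score d p t x k * partial k (\<lambda>z. Lx_field j t z i) x)"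
    unfolding material_deriv_def using Suc.prems by (simp add: 1 2)
  also have "\<dots> = Lx_field (Suc j) t x i" by (rule Lx_field_Suc) (use Suc.prems in auto)
  finally show ?case .
qed

lemma jacobian_Lx:
  assumes "0 < t" "x \<in> Rd d" "i < d" "k < d"
  shows "jacobian_d (Lx d p (Suc j) t) x i k = lam t * poly (linear_seq j) (1 + lam t) * (if k = i then 1 else 0)
    + bet t * (bet t * DPhi j t x i 0 (\<lambda>m. if m = k then 1 else 0))"
proof -
  have "jacobian_d (Lx d p (Suc j) t) x i k = partial k (\<lambda>z. Lx_field j t z i) x"
  proof -
    have "Lx d p (Suc j) t (x(k := r)) i = Lx_field j t (x(k := r)) i" for r
      by (intro Lx_eq_Lx_field fun_upd_Rd assms)
    then show ?thesis unfolding jacobian_d_def partial_def by simp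
  qed
  then show ?thesis using assms by (simp add: partial_Lx_field)
qed

text \<open>With this the Jacobian applied to a vector is estimated as one directional
  derivative.\<close>

lemma DPhi_sum:
  assumes "i < d"
  shows "(\<Sum>k<d. v k * DPhi j t x i 0 (\<lambda>m. if m = k then 1 else 0)) = DPhi j t x i 0 v"
proof -
  let ?D = "\<lambda>v ys. replica_deriv (2 * j + 1) d (lam t) (\<lambda>k. bet t * x k) 0 v (\<lambda>i. Y (ys i)) (moment_seq j)"
  have "(\<Sum>k<d. v k * DPhi j t x i 0 (\<lambda>m. if m = k then 1 else 0))
    = replica_mean (Suc (2 * j + 1)) (lam t) (\<lambda>k. bet t * x k) (\<lambda>ys. \<Sum>k<d. v k * (Y (ys 0) i * ?D (\<lambda>m. if m = k then 1 else 0) ys))"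
    unfolding DPhi_def replica_mean_cmult[symmetric]
    by (rule replica_mean_sum[symmetric]) (simp, intro admissible_mult admissible_const admissible_Y assms admissible_replica_deriv replicas_moment_seq, simp)
  also have "(\<lambda>ys. \<Sum>k<d. v k * (Y (ys 0) i * ?D (\<lambda>m. if m = k then 1 else 0) ys)) = (\<lambda>ys. Y (ys 0) i * ?D v ys)"
    unfolding replica_deriv_sum[where c = v, symmetric] sum_distrib_left by (simp add: mult_ac)
  finally show ?thesis unfolding DPhi_def .
qed

lemma coef_le:
  assumes t: "0 < t"
  shows "\<bar>lam t * poly (linear_seq j) (1 + lam t)\<bar> \<le> poly_norm (linear_seq j) * (exp (- t) * (1 + lam t) ^ Suc j)"
proof -
  have l: "0 \<le> lam t" by (rule lam_nonneg[OF t])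
  have "\<bar>poly (linear_seq j) (1 + lam t)\<bar> \<le> poly_norm (linear_seq j) * (1 + lam t) ^ j"
    using l by (intro order_trans[OF abs_poly_le] mult_left_mono power_increasing degree_linear_seq poly_norm_nonneg) auto
  then have "\<bar>lam t * poly (linear_seq j) (1 + lam t)\<bar> \<le> lam t * (poly_norm (linear_seq j) * (1 + lam t) ^ j)"
    unfolding abs_mult using l by (simp add: mult_left_mono)
  \<comment> \<open>The decay exp (-t) in front of |x| and the last power of 1 + lam both come from
    this factor lam.\<close>
  also have "lam t = exp (- t) * (1 + lam t)" unfolding one_plus_lam[OF t] by (simp add: lam_def)
  then have "lam t * (poly_norm (linear_seq j) * (1 + lam t) ^ j) = exp (- t) * (1 + lam t) * (poly_norm (linear_seq j) * (1 + lam t) ^ j)"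
    by simp
  also have "\<dots> = poly_norm (linear_seq j) * (exp (- t) * (1 + lam t) ^ Suc j)" by (simp add: mult_ac)
  finally show ?thesis .
qed

lemma moment_const_nonneg: "0 \<le> moment_const D n q"
  using D_ge_1 by (simp add: moment_const_def)

lemma growth_moment_seq_le:
  assumes l: "0 \<le> l"
  shows "(1 + l) ^ deg_eta (moment_seq j) * (1 + l * R\<^sup>2) ^ deg_atom (moment_seq j) \<le> ((1 + R) * (1 + l)) ^ (2 * j)"
proof -
  have "(1 + l) ^ deg_eta (moment_seq j) * (1 + l * R\<^sup>2) ^ deg_atom (moment_seq j) \<le> (1 + l) ^ j * (1 + l * R\<^sup>2) ^ j"
    using l by (intro mult_mono power_increasing deg_eta_moment_seq deg_atom_moment_seq) auto
  also have "\<dots> \<le> ((1 + R) * (1 + l)) ^ (2 * j)" by (rule tilt_growth_le[OF l R_nonneg])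
  finally show ?thesis .
qed

lemma Lx_const_parts:
  shows "poly_norm (linear_seq j) \<le> Lx_const D j"
    and "coef_bd (moment_seq j) * moment_const D (2 * j + 1) (deg_atom (moment_seq j)) \<le> Lx_const D j"
    and "poly_norm (linear_seq j) + (grad_bd (moment_seq j) + 2 * real (2 * j + 1) * coef_bd (moment_seq j)) * moment_const D (Suc (2 * j + 1)) (deg_atom (moment_seq j)) \<le> Lx_const D j"
    and "0 \<le> Lx_const D j"
proof -
  have "0 \<le> poly_norm (linear_seq j)" "0 \<le> coef_bd (moment_seq j) * moment_const D (2 * j + 1) (deg_atom (moment_seq j))"
    "0 \<le> (grad_bd (moment_seq j) + 2 * real (2 * j + 1) * coef_bd (moment_seq j)) * moment_const D (Suc (2 * j + 1)) (deg_atom (moment_seq j))"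
    by (intro poly_norm_nonneg mult_nonneg_nonneg add_nonneg_nonneg coef_bd_nonneg grad_bd_nonneg moment_const_nonneg; simp)+
  then show "poly_norm (linear_seq j) \<le> Lx_const D j"
    and "coef_bd (moment_seq j) * moment_const D (2 * j + 1) (deg_atom (moment_seq j)) \<le> Lx_const D j"
    and "poly_norm (linear_seq j) + (grad_bd (moment_seq j) + 2 * real (2 * j + 1) * coef_bd (moment_seq j)) * moment_const D (Suc (2 * j + 1)) (deg_atom (moment_seq j)) \<le> Lx_const D j"
    and "0 \<le> Lx_const D j"
    unfolding Lx_const_def by linarith+
qed

text \<open>The expectation has size R times the power 2j of (1 + R)(1 + lam); as bet = exp (-t/2)
  (1 + lam), the prefactor and R <= 1 + R supply one power more.\<close>

lemma norm_Lx_le: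
  assumes t: "0 < t" and x: "x \<in> Rd d"
  shows "norm_d d (Lx d p (Suc j) t x)
    \<le> Lx_const D j * (exp (- t) * (1 + lam t) ^ Suc j * norm_d d x
        + exp (- t / 2) * ((1 + R) * (1 + lam t)) ^ (2 * j + 1))"
proof -
  have l: "0 \<le> lam t" by (rule lam_nonneg[OF t])
  let ?g = "((1 + R) * (1 + lam t)) ^ (2 * j)"
  let ?K = "coef_bd (moment_seq j) * moment_const D (2 * j + 1) (deg_atom (moment_seq j))"
  have K: "0 \<le> ?K" by (intro mult_nonneg_nonneg coef_bd_nonneg moment_const_nonneg)
  have Phi: "norm_d d (Phi j t x) \<le> R * (?K * ?g)"
  proof -
    have "norm_d d (Phi j t x) \<le> R * (?K * ((1 + lam t) ^ deg_eta (moment_seq j) * (1 + lam t * R\<^sup>2) ^ deg_atom (moment_seq j)))"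
      unfolding Phi_def using norm_replica_mean_expr_val_le[OF l _ replicas_moment_seq[of j], of "\<lambda>k. bet t * x k"] by simp
    also have "\<dots> \<le> R * (?K * ?g)"
      by (intro mult_left_mono growth_moment_seq_le l R_nonneg K)
    finally show ?thesis .
  qed
  have "norm_d d (Lx d p (Suc j) t x) = norm_d d (\<lambda>i. lam t * poly (linear_seq j) (1 + lam t) * x i + bet t * Phi j t x i)"
    by (intro norm_d_cong) (simp add: Lx_eq_Lx_field t x Lx_field_def)
  also have "\<dots> \<le> \<bar>lam t * poly (linear_seq j) (1 + lam t)\<bar> * norm_d d x + \<bar>bet t\<bar> * norm_d d (Phi j t x)"
    by (rule order_trans[OF norm_d_add_le]) (simp add: norm_d_scale)
  also have "\<bar>lam t * poly (linear_seq j) (1 + lam t)\<bar> * norm_d d x \<le> Lx_const D j * (exp (- t) * (1 + lam t) ^ Suc j) * norm_d d x"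
    using l by (intro mult_right_mono order_trans[OF coef_le[OF t]] Lx_const_parts(1)) auto
  also have "\<bar>bet t\<bar> * norm_d d (Phi j t x) \<le> (exp (- t / 2) * (1 + lam t)) * ((1 + R) * (Lx_const D j * ?g))"
  proof (intro mult_mono)
    show "\<bar>bet t\<bar> \<le> exp (- t / 2) * (1 + lam t)" using l by (simp add: bet_eq[OF t])
    show "norm_d d (Phi j t x) \<le> (1 + R) * (Lx_const D j * ?g)"
      using R_nonneg l K by (intro order_trans[OF Phi] mult_mono Lx_const_parts(2)) (auto simp: Lx_const_parts(4))
  qed (use l in auto)
  also have "\<dots> = Lx_const D j * (exp (- t / 2) * ((1 + R) * (1 + lam t)) ^ (2 * j + 1))" by (simp add: mult_ac)
  finally show ?thesis by (simp add: algebra_simps)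
qed

text \<open>The chain rule for h adds a second bet, giving exp (-t) (1 + lam)^2, and the direction
  adds a second R, so the exponent rises to 2j + 2. The multiple of the identity carries only the
  power j + 1 and is absorbed because the base is at least 1.\<close>

lemma opnorm_jacobian_Lx_le:
  assumes t: "0 < t" and x: "x \<in> Rd d"
  shows "opnorm_d d (jacobian_d (Lx d p (Suc j) t) x)
    \<le> Lx_const D j * exp (- t) * ((1 + R) * (1 + lam t)) ^ (2 * j + 2)"
proof (rule opnorm_d_le)
  fix v assume v: "norm_d d v \<le> 1"
  have l: "0 \<le> lam t" by (rule lam_nonneg[OF t])
  let ?a = "(1 + R) * (1 + lam t)"
  let ?q = "lam t * poly (linear_seq j) (1 + lam t)"
  define K where "K = (grad_bd (moment_seq j) + 2 * real (2 * j + 1) * coef_bd (moment_seq j)) * moment_const D (Suc (2 * j + 1)) (deg_atom (moment_seq j))"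
  have K: "0 \<le> K" unfolding K_def by (intro mult_nonneg_nonneg add_nonneg_nonneg coef_bd_nonneg grad_bd_nonneg moment_const_nonneg) auto
  have "1 * (1 + lam t) \<le> ?a" using l R_nonneg by (intro mult_right_mono) auto
  then have a: "1 + lam t \<le> ?a" by simp
  have a1: "1 \<le> ?a" by (rule order_trans[OF _ a]) (use l in simp)
  note a = a a1
  have D: "norm_d d (\<lambda>i. DPhi j t x i 0 v) \<le> R * (R * (K * ?a ^ (2 * j)))"
  proof -
    have "norm_d d (\<lambda>i. DPhi j t x i 0 v) \<le> R * (1 * R * (K * ((1 + lam t) ^ deg_eta (moment_seq j) * (1 + lam t * R\<^sup>2) ^ deg_atom (moment_seq j))))"
      unfolding DPhi_def K_def by (rule norm_replica_mean_replica_deriv_le[OF l replicas_moment_seq v])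
    also have "\<dots> \<le> R * (1 * R * (K * ?a ^ (2 * j)))"
      using R_nonneg by (intro mult_left_mono growth_moment_seq_le l K) auto
    finally show ?thesis by simp
  qed
  have "norm_d d (\<lambda>i. \<Sum>k<d. jacobian_d (Lx d p (Suc j) t) x i k * v k)
    = norm_d d (\<lambda>i. ?q * v i + (bet t * bet t) * DPhi j t x i 0 v)"
  proof (intro norm_d_cong)
    fix i assume i: "i < d"
    have "(\<Sum>k<d. jacobian_d (Lx d p (Suc j) t) x i k * v k)
      = (\<Sum>k<d. (if k = i then ?q * v k else 0) + (bet t * bet t) * (v k * DPhi j t x i 0 (\<lambda>m. if m = k then 1 else 0)))"
      by (intro sum.cong refl) (simp add: jacobian_Lx t x i algebra_simps)
    also have "\<dots> = ?q * v i + (bet t * bet t) * DPhi j t x i 0 v"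
      unfolding sum.distrib sum_distrib_left[symmetric] DPhi_sum[OF i] using i by simp
    finally show "(\<Sum>k<d. jacobian_d (Lx d p (Suc j) t) x i k * v k) = ?q * v i + (bet t * bet t) * DPhi j t x i 0 v" .
  qed
  also have "\<dots> \<le> \<bar>?q\<bar> * norm_d d v + \<bar>bet t * bet t\<bar> * norm_d d (\<lambda>i. DPhi j t x i 0 v)"
    by (rule order_trans[OF norm_d_add_le]) (simp add: norm_d_scale)
  also have "\<bar>?q\<bar> * norm_d d v \<le> (poly_norm (linear_seq j) * (exp (- t) * ?a ^ (2 * j + 2))) * 1"
  proof (intro mult_mono v)
    have "(1 + lam t) ^ Suc j \<le> ?a ^ Suc j" using a l by (intro power_mono) auto
    also have "\<dots> \<le> ?a ^ (2 * j + 2)" using a by (intro power_increasing) auto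
    finally show "\<bar>?q\<bar> \<le> poly_norm (linear_seq j) * (exp (- t) * ?a ^ (2 * j + 2))"
      by (intro order_trans[OF coef_le[OF t]] mult_left_mono poly_norm_nonneg) auto
  qed (use a poly_norm_nonneg in auto)
  also have "\<bar>bet t * bet t\<bar> * norm_d d (\<lambda>i. DPhi j t x i 0 v)
      \<le> (exp (- t) * ((1 + lam t) * (1 + lam t))) * ((1 + R) * ((1 + R) * (K * ?a ^ (2 * j))))"
  proof (intro mult_mono)
    have "bet t * bet t = (exp (- t / 2) * exp (- t / 2)) * ((1 + lam t) * (1 + lam t))"
      unfolding bet_eq[OF t] by (simp only: mult_ac)
    then show "\<bar>bet t * bet t\<bar> \<le> exp (- t) * ((1 + lam t) * (1 + lam t))" unfolding exp_half_square by simp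
    show "norm_d d (\<lambda>i. DPhi j t x i 0 v) \<le> (1 + R) * ((1 + R) * (K * ?a ^ (2 * j)))"
      using R_nonneg K a by (intro order_trans[OF D] mult_mono) auto
  qed (use l in auto)
  also have "\<dots> = K * (exp (- t) * ?a ^ (2 * j + 2))" by (simp add: mult_ac)
  also have "poly_norm (linear_seq j) * (exp (- t) * ?a ^ (2 * j + 2)) * 1 + K * (exp (- t) * ?a ^ (2 * j + 2))
      = (poly_norm (linear_seq j) + K) * (exp (- t) * ?a ^ (2 * j + 2))" by (simp add: algebra_simps)
  also have "\<dots> \<le> Lx_const D j * (exp (- t) * ?a ^ (2 * j + 2))"
    unfolding K_def using a by (intro mult_right_mono Lx_const_parts(3)) auto
  finally show "norm_d d (\<lambda>i. \<Sum>k<d. jacobian_d (Lx d p (Suc j) t) x i k * v k)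
      \<le> Lx_const D j * exp (- t) * ?a ^ (2 * j + 2)" by (simp add: mult.assoc)
qed

end

subsection \<open>The Ornstein--Uhlenbeck density\<close>

lemma tendsto_fun_coordinatewise:
  fixes u :: "nat \<Rightarrow> nat \<Rightarrow> real"
  assumes "\<And>i. (\<lambda>n. u n i) \<longlonglongrightarrow> x i" shows "u \<longlonglongrightarrow> x"
proof -
  have "limitin (product_topology (\<lambda>i::nat. euclidean :: real topology) UNIV) u x sequentially"
    unfolding limitin_componentwise using assms by (simp add: eventually_sequentially)
  then show ?thesis by (simp add: euclidean_product_topology)
qed

lemma closed_Rd: "closed (Rd d :: (nat \<Rightarrow> real) set)"
proof -
  have "Rd d = (\<Inter>i\<in>{d..}. {x. x i = (undefined :: real)})"
    by (auto simp: PiE_def extensional_def)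
  moreover have "closed {x. x i = (undefined :: real)}" for i :: nat
    by (intro closed_Collect_eq continuous_on_product_coordinates continuous_on_const)
  ultimately show ?thesis by auto
qed

text \<open>Continuity refers to the product topology on all of \<open>nat => real\<close>. The
  inclusion of \<open>Rd d\<close> there is measurable, its coordinates from d on being constant,
  and \<open>Rd d\<close> is closed.\<close>

lemma borel_measurable_leb_continuous_on:
  assumes "continuous_on (Rd d) f"
  shows "(f :: (nat \<Rightarrow> real) \<Rightarrow> real) \<in> borel_measurable (leb d)"
proof -
  have "(\<lambda>x. x) \<in> measurable (leb d) (borel :: (nat \<Rightarrow> real) measure)"
  proof (rule measurable_coordinatewise_then_product)
    fix i
    show "(\<lambda>x. x i) \<in> borel_measurable (leb d)"
    proof (cases "i < d")
      case False
      have "(\<lambda>x. x i) \<in> borel_measurable (leb d) \<longleftrightarrow> (\<lambda>_. undefined :: real) \<in> borel_measurable (leb d)"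
        by (rule measurable_cong) (use False in \<open>auto simp: space_PiM PiE_def extensional_def\<close>)
      then show ?thesis by simp
    qed simp
  qed
  then have "(\<lambda>x. indicator (Rd d) x *\<^sub>R f x) \<in> borel_measurable (leb d)"
    by (rule measurable_compose[OF _ borel_measurable_continuous_on_indicator])
      (use assms closed_Rd in auto)
  moreover have "f \<in> borel_measurable (leb d) \<longleftrightarrow> (\<lambda>x. indicator (Rd d) x *\<^sub>R f x) \<in> borel_measurable (leb d)"
    by (rule measurable_cong) (simp add: space_PiM)
  ultimately show ?thesis by (simp only:)
qed

text \<open>Every open box around x has positive volume and so contains a point where f and g agree;
  shrinking the boxes gives a sequence tending to x.\<close>

lemma AE_eq_continuous_imp_eq:
  assumes f: "continuous_on (Rd d) f" and g: "continuous_on (Rd d) (g :: (nat \<Rightarrow> real) \<Rightarrow> real)"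
    and ae: "AE x in leb d. f x = g x" and x: "x \<in> Rd d"
  shows "f x = g x"
proof -
  interpret B: product_sigma_finite "\<lambda>_::nat. lborel :: real measure" ..
  have "\<exists>y\<in>Rd d. (\<forall>i<d. \<bar>y i - x i\<bar> < \<epsilon>) \<and> f y = g y" if \<epsilon>: "0 < \<epsilon>" for \<epsilon> :: real
  proof (rule ccontr)
    assume neg: "\<not> ?thesis"
    define A where "A = Pi\<^sub>E {..<d} (\<lambda>i. {x i - \<epsilon><..<x i + \<epsilon>})"
    have A: "A \<in> sets (leb d)" unfolding A_def by (rule sets_PiM_I_finite) auto
    have "AE y in leb d. y \<notin> A"
      using ae
    proof eventually_elim
      case (elim y)
      show ?case
      proof
        assume yA: "y \<in> A"
        then have mem: "y i \<in> {x i - \<epsilon><..<x i + \<epsilon>}" if "i < d" for i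
          using PiE_mem[of y "{..<d}" "\<lambda>i. {x i - \<epsilon><..<x i + \<epsilon>}" i] yA that
          by (simp only: A_def lessThan_iff)
        have "A \<subseteq> Rd d" unfolding A_def by (rule PiE_mono) simp
        then have "y \<in> Rd d" using yA by (rule subsetD)
        moreover have "\<forall>i<d. \<bar>y i - x i\<bar> < \<epsilon>" using mem by (simp add: abs_less_iff algebra_simps)
        ultimately show False using neg elim by blast
      qed
    qed
    then have "emeasure (leb d) A = 0" using AE_iff_null_sets[OF A] by auto
    moreover have "emeasure (leb d) A = (\<Prod>i<d. ennreal (2 * \<epsilon>))"
      unfolding A_def using \<epsilon> by (subst B.emeasure_PiM) auto
    ultimately show False using \<epsilon> by simp
  qed
  then have "\<forall>n. \<exists>y\<in>Rd d. (\<forall>i<d. \<bar>y i - x i\<bar> < inverse (real (Suc n))) \<and> f y = g y" by simp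
  then obtain u where u: "\<And>n. u n \<in> Rd d" "\<And>n i. i < d \<Longrightarrow> \<bar>u n i - x i\<bar> < inverse (real (Suc n))" "\<And>n. f (u n) = g (u n)"
    by metis
  have "u \<longlonglongrightarrow> x"
  proof (rule tendsto_fun_coordinatewise)
    fix i show "(\<lambda>n. u n i) \<longlonglongrightarrow> x i"
    proof (cases "i < d")
      case True
      have "(\<lambda>n. u n i - x i) \<longlonglongrightarrow> 0"
        by (rule Lim_null_comparison[OF _ LIMSEQ_inverse_real_of_nat]) (use u(2)[OF True] in \<open>auto intro!: always_eventually less_imp_le\<close>)
      then show ?thesis by (simp add: LIM_zero_iff)
    next
      case False
      then have "u n i = x i" for n using u(1)[of n] x by (auto simp: PiE_def extensional_def)
      then show ?thesis by simp
    qed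
  qed
  then have "(\<lambda>n. f (u n)) \<longlonglongrightarrow> f x" "(\<lambda>n. g (u n)) \<longlonglongrightarrow> g x"
    using u(1) by (auto intro!: continuous_on_tendsto_compose[OF f _ x] continuous_on_tendsto_compose[OF g _ x])
  then show ?thesis using u(3) by (simp add: LIMSEQ_unique)
qed

lemma ou_density_eq_ou_pdf:
  assumes "borel_prob d P0" "ou_density d P0 p" "0 < t" "x \<in> Rd d"
  shows "p t x = ou_pdf d P0 t x"
proof -
  interpret B: product_sigma_finite "\<lambda>_::nat. lborel :: real measure" ..
  interpret leb: sigma_finite_measure "leb d" by (rule B.sigma_finite) simp
  have q: "ou_density d P0 (ou_pdf d P0)" by (rule ou_density_exists[OF assms(1)])
  have c: "continuous_on (Rd d) (p t)" "continuous_on (Rd d) (ou_pdf d P0 t)"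
    and pos: "\<And>x. x \<in> Rd d \<Longrightarrow> 0 < p t x" "\<And>x. x \<in> Rd d \<Longrightarrow> 0 < ou_pdf d P0 t x"
    and eq: "density (leb d) (\<lambda>x. ennreal (p t x)) = density (leb d) (\<lambda>x. ennreal (ou_pdf d P0 t x))"
    using assms(2,3) q unfolding ou_density_def by auto
  have [measurable]: "p t \<in> borel_measurable (leb d)" "ou_pdf d P0 t \<in> borel_measurable (leb d)"
    by (rule borel_measurable_leb_continuous_on[OF c(1)] borel_measurable_leb_continuous_on[OF c(2)])+
  have "AE x in leb d. ennreal (p t x) = ennreal (ou_pdf d P0 t x)"
    by (rule leb.density_unique[OF _ _ eq]) measurable
  then have "AE x in leb d. p t x = ou_pdf d P0 t x"
    using AE_space
  proof eventually_elim
    case (elim x)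
    then have "x \<in> Rd d" by (simp add: space_PiM)
    then show ?case using elim(1) pos[of x] by (simp add: less_imp_le)
  qed
  then show ?thesis by (rule AE_eq_continuous_imp_eq[OF c]) (rule assms(4))
qed

section \<open>The support carries the law\<close>

lemma borel_prob_space: "borel_prob d P0 \<Longrightarrow> space P0 = Rd d"
  using sets_eq_imp_space_eq[of P0 "leb d"] by (simp add: borel_prob_def space_PiM)

lemma measurable_component_borel_prob:
  assumes "borel_prob d P0" "k < d" shows "(\<lambda>y. y k) \<in> borel_measurable P0"
proof -
  have "sets P0 = sets (leb d)" using assms(1) by (simp add: borel_prob_def)
  then show ?thesis using assms(2) by (subst measurable_cong_sets[OF _ refl]) auto
qed

lemma ball_borel_prob:
  assumes "borel_prob d P0"
  shows "{y \<in> Rd d. norm_d d (\<lambda>i. y i - x i) < r} \<in> sets P0"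
proof -
  have [measurable_cong]: "sets P0 = sets (leb d)" using assms by (simp add: borel_prob_def)
  have [measurable]: "(\<lambda>y. norm_d d (\<lambda>i. y i - x i)) \<in> borel_measurable P0"
    unfolding norm_d_def L2_set_def by measurable
  then have "{y \<in> space P0. norm_d d (\<lambda>i. y i - x i) < r} \<in> sets P0" by measurable
  then show ?thesis by (simp add: borel_prob_space[OF assms])
qed

lemma rational_point_near:
  assumes "0 < r"
  shows "\<exists>q\<in>{..<d} \<rightarrow>\<^sub>E \<rat>. norm_d d (\<lambda>i. x i - q i) < r"
proof -
  \<comment> \<open>The Euclidean norm is at most the sum of the d coordinate errors, and d / (d +
    1) < 1 makes the inequality strict, also for d = 0.\<close>
  define \<delta> where "\<delta> = r / (real d + 1)"
  have \<delta>: "0 < \<delta>" using assms by (simp add: \<delta>_def)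
  have "\<exists>s\<in>\<rat>. x i < s \<and> s < x i + \<delta>" for i using Rats_dense_in_real[of "x i" "x i + \<delta>"] \<delta> by auto
  then obtain s where s: "\<And>i. s i \<in> \<rat>" "\<And>i. x i < s i" "\<And>i. s i < x i + \<delta>" by metis
  have "norm_d d (\<lambda>i. x i - restrict s {..<d} i) \<le> (\<Sum>i<d. \<bar>x i - restrict s {..<d} i\<bar>)"
    unfolding norm_d_def by (rule L2_set_le_sum_abs)
  also have "\<dots> \<le> real (card {..<d}) * \<delta>"
  proof (rule sum_bounded_above)
    fix i assume "i \<in> {..<d}"
    then show "\<bar>x i - restrict s {..<d} i\<bar> \<le> \<delta>" using s(2)[of i] s(3)[of i] by simp
  qed
  also have "\<dots> < r" using assms by (simp add: \<delta>_def field_simps)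
  finally show ?thesis using s(1) by (intro bexI[of _ "restrict s {..<d}"]) auto
qed

text \<open>Each point outside the support has a null ball around it, and inside that a null ball
  with rational centre and radius 1 / (n + 1) that still contains the point. There are countably
  many of the latter.\<close>

lemma supp_conull:
  assumes P0: "borel_prob d P0"
  shows "\<exists>N\<in>null_sets P0. Rd d - supp d P0 \<subseteq> N"
proof -
  define ball where "ball = (\<lambda>x r. {y \<in> Rd d. norm_d d (\<lambda>i. y i - x i) < r})"
  define I where "I = {qn \<in> ({..<d} \<rightarrow>\<^sub>E \<rat>) \<times> (UNIV :: nat set). emeasure P0 (ball (fst qn) (inverse (real (Suc (snd qn))))) = 0}"
  define N where "N = (\<Union>qn\<in>I. ball (fst qn) (inverse (real (Suc (snd qn)))))"
  have ball_sets: "ball x r \<in> sets P0" for x r unfolding ball_def by (rule ball_borel_prob[OF P0])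
  have tri: "norm_d d (\<lambda>i. y i - x i) \<le> norm_d d (\<lambda>i. y i - q i) + norm_d d (\<lambda>i. q i - x i)" for x y q :: "nat \<Rightarrow> real"
    using norm_d_add_le[of d "\<lambda>i. y i - q i" "\<lambda>i. q i - x i"] by simp
  have sym: "norm_d d (\<lambda>i. y i - x i) = norm_d d (\<lambda>i. x i - y i)" for x y :: "nat \<Rightarrow> real"
    using norm_d_scale[of d "-1" "\<lambda>i. x i - y i"] by simp
  have "countable (({..<d} \<rightarrow>\<^sub>E \<rat>) \<times> (UNIV :: nat set))"
    by (intro countable_SIGMA countable_PiE countable_rat) auto
  then have "countable I" by (rule countable_subset[rotated]) (auto simp: I_def)
  then have "N \<in> null_sets P0"
    unfolding N_def by (rule null_sets_UN') (auto simp: I_def ball_sets null_sets_def)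
  moreover have "Rd d - supp d P0 \<subseteq> N"
  proof
    fix x assume "x \<in> Rd d - supp d P0"
    then obtain \<epsilon> where x: "x \<in> Rd d" and \<epsilon>: "0 < \<epsilon>" "emeasure P0 (ball x \<epsilon>) = 0"
      by (auto simp: supp_def ball_def)
    obtain n where n: "inverse (real (Suc n)) < \<epsilon> / 2" using reals_Archimedean[of "\<epsilon> / 2"] \<epsilon>(1) by auto
    obtain q where q: "q \<in> {..<d} \<rightarrow>\<^sub>E \<rat>" "norm_d d (\<lambda>i. x i - q i) < inverse (real (Suc n))"
      using rational_point_near[of "inverse (real (Suc n))" d x] by auto
    have "ball q (inverse (real (Suc n))) \<subseteq> ball x \<epsilon>"
    proof
      fix y assume "y \<in> ball q (inverse (real (Suc n)))"
      then show "y \<in> ball x \<epsilon>"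
        unfolding ball_def using tri[of y x q] sym[of q x] q(2) n by auto
    qed
    then have "emeasure P0 (ball q (inverse (real (Suc n)))) \<le> emeasure P0 (ball x \<epsilon>)"
      by (intro emeasure_mono ball_sets)
    then have "(q, n) \<in> I" using q(1) \<epsilon>(2) by (simp add: I_def)
    moreover have "x \<in> ball q (inverse (real (Suc n)))" using x q(2) by (simp add: ball_def)
    ultimately show "x \<in> N" unfolding N_def by force
  qed
  ultimately show ?thesis by blast
qed

text \<open>Expanding the square: with a = exp (-t/2) and s = 1 - exp (-t) the coefficients are a^2
  / s = lam, a / s = bet and 1 / s = 1 + lam.\<close>

lemma normal_density_tilt:
  assumes "0 < t"
  shows "(\<Prod>i<d. normal_density (exp (- t / 2) * y i) (sqrt (1 - exp (- t))) (z i))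
    = (1 / sqrt (2 * pi * (1 - exp (- t)))) ^ d * exp (- (\<Sum>i<d. (z i)\<^sup>2) * (1 + lam t) / 2)
      * exp (inner_d d (\<lambda>k. bet t * z k) y - lam t / 2 * inner_d d y y)"
proof -
  define s where "s = 1 - exp (- t)"
  define a where "a = exp (- t / 2)"
  have s: "0 < s" using assms by (simp add: s_def)
  have a: "lam t = a * a / s" "1 + lam t = 1 / s" "bet t = a / s"
    using one_plus_lam[OF assms] exp_half_square[of t] by (simp_all add: lam_def bet_def s_def a_def)
  have "normal_density (a * y i) (sqrt s) (z i)
      = 1 / sqrt (2 * pi * s) * exp (- ((z i)\<^sup>2 * (1 + lam t) / 2) + (bet t * z i * y i - lam t / 2 * (y i * y i)))" for i
  proof -
    have "- (z i - a * y i)\<^sup>2 / (2 * s) = - ((z i)\<^sup>2 * (1 + lam t) / 2) + (bet t * z i * y i - lam t / 2 * (y i * y i))"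
      unfolding a(2) unfolding a(1,3) using s by (simp add: field_simps power2_eq_square)
    then show ?thesis unfolding normal_density_def using s by simp
  qed
  then have "(\<Prod>i<d. normal_density (a * y i) (sqrt s) (z i))
      = (1 / sqrt (2 * pi * s)) ^ d * exp (\<Sum>i<d. - ((z i)\<^sup>2 * (1 + lam t) / 2) + (bet t * z i * y i - lam t / 2 * (y i * y i)))"
    by (simp only: prod.distrib prod_constant card_lessThan exp_sum finite_lessThan)
  also have "(\<Sum>i<d. - ((z i)\<^sup>2 * (1 + lam t) / 2) + (bet t * z i * y i - lam t / 2 * (y i * y i)))
    = - (\<Sum>i<d. (z i)\<^sup>2) * (1 + lam t) / 2 + (inner_d d (\<lambda>k. bet t * z k) y - lam t / 2 * inner_d d y y)"
    by (simp add: inner_d_def sum.distrib sum_subtractf sum_negf sum_distrib_left sum_distrib_right sum_divide_distrib)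
  also have "(1 / sqrt (2 * pi * s)) ^ d * exp (- (\<Sum>i<d. (z i)\<^sup>2) * (1 + lam t) / 2 + (inner_d d (\<lambda>k. bet t * z k) y - lam t / 2 * inner_d d y y))
    = (1 / sqrt (2 * pi * s)) ^ d * exp (- (\<Sum>i<d. (z i)\<^sup>2) * (1 + lam t) / 2) * exp (inner_d d (\<lambda>k. bet t * z k) y - lam t / 2 * inner_d d y y)"
    unfolding exp_add by (simp only: mult.assoc)
  finally show ?thesis unfolding s_def a_def .
qed

text \<open>The log density is a constant minus (1 + lam) |x|^2 / 2 plus the logarithm of the
  partition function at h = bet x. The gradient of the latter is bet times the tilted mean, and the
  x added in the modified score reduces 1 + lam to lam.\<close>

lemma score_eq:
  assumes P0: "borel_prob d P0" and p: "ou_density d P0 p" and Y: "tilt P0 Y d R"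
    and ae: "AE y in P0. Y y = y" and t: "0 < t" and x: "x \<in> Rd d" and i: "i < d"
  shows "mod_score d p t x i = - lam t * x i + bet t * tilt.tilt_mean P0 Y d (lam t) (\<lambda>k. bet t * x k) (\<lambda>\<omega>. Y \<omega> i)"
proof -
  interpret tilt P0 Y d R by (rule Y)
  define c where "c = (1 / sqrt (2 * pi * (1 - exp (- t)))) ^ d"
  have c: "0 < c" unfolding c_def using t by (intro zero_less_power divide_pos_pos) auto
  have pdf: "ou_pdf d P0 t z = c * exp (- (\<Sum>i<d. (z i)\<^sup>2) * (1 + lam t) / 2) * partition_fn (lam t) (\<lambda>k. bet t * z k)" for z
  proof -
    have meas: "(\<lambda>y. log_tilt d l h y) \<in> borel_measurable P0" for l h
      unfolding log_tilt_def inner_d_def by (intro borel_measurable_diff borel_measurable_times borel_measurable_sum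
          borel_measurable_const measurable_component_borel_prob[OF P0]) auto
    have "ou_pdf d P0 t z = c * exp (- (\<Sum>i<d. (z i)\<^sup>2) * (1 + lam t) / 2)
        * (\<integral>y. exp (log_tilt d (lam t) (\<lambda>k. bet t * z k) y) \<partial>P0)"
      unfolding ou_pdf_def normal_density_tilt[OF t] c_def log_tilt_def by simp
    also have "(\<integral>y. exp (log_tilt d (lam t) (\<lambda>k. bet t * z k) y) \<partial>P0) = partition_fn (lam t) (\<lambda>k. bet t * z k)"
      unfolding partition_fn_def
    proof (rule integral_cong_AE)
      show "AE y in P0. exp (log_tilt d (lam t) (\<lambda>k. bet t * z k) y) = wt (lam t) (\<lambda>k. bet t * z k) y"
        using ae by eventually_elim (simp add: wt_def logw_log_tilt)
      show "wt (lam t) (\<lambda>k. bet t * z k) \<in> borel_measurable P0" using bounded_meas_wt by (simp add: bounded_meas_def)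
      show "(\<lambda>y. exp (log_tilt d (lam t) (\<lambda>k. bet t * z k) y)) \<in> borel_measurable P0"
        by (rule measurable_compose[OF meas borel_measurable_exp])
    qed
    finally show ?thesis .
  qed
  have "ln (p t (x(i := r))) = ln c + (- (\<Sum>k<d. ((x(i := r)) k)\<^sup>2) * (1 + lam t) / 2) + ln (partition_fn (lam t) (\<lambda>k. bet t * (x(i := r)) k))" for r
  proof -
    have "p t (x(i := r)) = ou_pdf d P0 t (x(i := r))"
      by (rule ou_density_eq_ou_pdf[OF P0 p t]) (rule fun_upd_Rd[OF x i])
    then show ?thesis unfolding pdf using c partition_fn_pos by (simp only: ln_mult_pos mult_pos_pos exp_gt_zero ln_exp)
  qed
  moreover have "((\<lambda>r. ln c + (- (\<Sum>k<d. ((x(i := r)) k)\<^sup>2) * (1 + lam t) / 2) + ln (partition_fn (lam t) (\<lambda>k. bet t * (x(i := r)) k)))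
      has_real_derivative - (1 + lam t) * x i + bet t * tilt_mean (lam t) (\<lambda>k. bet t * x k) (\<lambda>\<omega>. Y \<omega> i)) (at (x i))"
  proof -
    have H: "((\<lambda>r. bet t * (x(i := r)) m) has_real_derivative bet t * (if m = i then 1 else 0)) (at (x i))" for m
      by (cases "m = i") (auto intro!: derivative_eq_intros)
    have lw: "logw 0 (\<lambda>m. bet t * (if m = i then 1 else 0)) \<omega> = bet t * Y \<omega> i" for \<omega>
      using i by (simp add: logw_def inner_d_def mult.assoc if_distrib[of "\<lambda>x. x * _"] sum_distrib_left[symmetric] cong: if_cong)
    have dZ: "((\<lambda>r. partition_fn (lam t) (\<lambda>k. bet t * (x(i := r)) k)) has_real_derivative
        bet t * (\<integral>\<omega>. Y \<omega> i * wt (lam t) (\<lambda>k. bet t * x k) \<omega> \<partial>P0)) (at (x i))"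
      using partition_fn_has_derivative[where L = "\<lambda>_. lam t" and H = "\<lambda>r k. bet t * (x(i := r)) k", OF DERIV_const H]
      by (simp add: lw mult.assoc)
    have "((\<lambda>r. ln (partition_fn (lam t) (\<lambda>k. bet t * (x(i := r)) k))) has_real_derivative
        bet t * tilt_mean (lam t) (\<lambda>k. bet t * x k) (\<lambda>\<omega>. Y \<omega> i)) (at (x i))"
      using DERIV_chain2[OF DERIV_ln_divide[OF partition_fn_pos] dZ] by (simp add: tilt_mean_def)
    moreover have "((\<lambda>r. \<Sum>k<d. ((x(i := r)) k)\<^sup>2) has_real_derivative (\<Sum>k<d. if k = i then 2 * x i else 0)) (at (x i))"
    proof (rule DERIV_sum)
      fix k show "((\<lambda>r. ((x(i := r)) k)\<^sup>2) has_real_derivative (if k = i then 2 * x i else 0)) (at (x i))"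
        by (cases "k = i") (auto intro!: derivative_eq_intros)
    qed
    ultimately have "((\<lambda>r. ln c + (- (\<Sum>k<d. ((x(i := r)) k)\<^sup>2) * (1 + lam t) / 2) + ln (partition_fn (lam t) (\<lambda>k. bet t * (x(i := r)) k)))
        has_real_derivative 0 + - (\<Sum>k<d. if k = i then 2 * x i else 0) * (1 + lam t) / 2
          + bet t * tilt_mean (lam t) (\<lambda>k. bet t * x k) (\<lambda>\<omega>. Y \<omega> i)) (at (x i))"
      by (intro DERIV_add DERIV_const DERIV_cdivide DERIV_cmult_right DERIV_minus)
    then show ?thesis by (rule DERIV_cong) (use i in \<open>simp add: field_simps\<close>)
  qed
  ultimately have "partial i (\<lambda>z. ln (p t z)) x = - (1 + lam t) * x i + bet t * tilt_mean (lam t) (\<lambda>k. bet t * x k) (\<lambda>\<omega>. Y \<omega> i)"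
    unfolding partial_def by (simp only:) (rule DERIV_imp_deriv)
  then show ?thesis using i by (simp add: mod_score_def algebra_simps)
qed

lemma ou_tilt_exists:
  assumes P0: "borel_prob d P0" and R: "supp d P0 \<subseteq> cball_d d R" and UD: "UD d P0 D" and p: "ou_density d P0 p"
  shows "\<exists>Y. ou_tilt P0 Y d R D p"
proof -
  interpret prob_space P0 using P0 by (simp add: borel_prob_def)
  have space: "space P0 = Rd d" by (rule borel_prob_space[OF P0])
  obtain N where N: "N \<in> null_sets P0" "Rd d - supp d P0 \<subseteq> N" using supp_conull[OF P0] by auto
  have "space P0 - N \<noteq> {}"
  proof
    assume "space P0 - N = {}"
    then have "emeasure P0 (space P0) \<le> emeasure P0 N" using N by (intro emeasure_mono) auto
    then show False using null_setsD1[OF N(1)] emeasure_space_1 by simp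
  qed
  then obtain y0 where y0: "y0 \<in> supp d P0" using N(2) space by auto
  \<comment> \<open>Moving the null set \<open>N\<close> to a point of the support makes all bounds hold everywhere.\<close>
  define Y where "Y = (\<lambda>y. if y \<in> space P0 - N then y else y0)"
  have Y_supp: "Y y \<in> supp d P0" for y using y0 N(2) by (auto simp: Y_def space)
  have Y_R: "norm_d d (Y y) \<le> R" for y using R Y_supp[of y] by (auto simp: cball_d_def)
  have ae: "AE y in P0. Y y = y"
    using AE_not_in[OF N(1)] AE_space by eventually_elim (simp add: Y_def)
  have Y_meas: "(\<lambda>y. Y y k) \<in> borel_measurable P0" if "k < d" for k
  proof -
    have "(\<lambda>y. if y \<in> space P0 - N then y k else y0 k) \<in> borel_measurable P0"
      by (rule measurable_If_set) (use N measurable_component_borel_prob[OF P0 that] in \<open>auto simp: Int_absorb2\<close>)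
    then show ?thesis by (simp add: Y_def if_distrib[of "\<lambda>f. f k"])
  qed
  have tilt: "tilt P0 Y d R"
    by unfold_locales (use Y_meas Y_R in auto)
  interpret tilt P0 Y d R by (rule tilt)
  have D: "1 \<le> D" using UD by (simp add: UD_def)
  have doubling: "\<exists>S. (\<forall>\<omega>. inner_d d h (Y \<omega>) \<le> S) \<and>
      (\<forall>u>0. prob {\<omega> \<in> space P0. S - inner_d d h (Y \<omega>) \<le> 2 * u}
             \<le> D * prob {\<omega> \<in> space P0. S - inner_d d h (Y \<omega>) \<le> u})" for h
  \<comment> \<open>(UD) says nothing without a direction; here both events are the whole space and
    doubling is just 1 <= D.\<close>
  proof (cases "norm_d d h = 0")
    case True
    then have "inner_d d h (Y \<omega>) = 0" for \<omega> using abs_inner_Y_le[of h \<omega>] by simp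
    then show ?thesis using D by (intro exI[of _ 0]) (simp add: prob_space)
  next
    case False
    define \<nu> where "\<nu> = norm_d d h"
    define \<theta> where "\<theta> = restrict (\<lambda>i. inverse \<nu> * h i) {..<d}"
    have \<nu>: "0 < \<nu>" using False norm_d_nonneg[of d h] unfolding \<nu>_def by linarith
    have "norm_d d \<theta> = norm_d d (\<lambda>i. inverse \<nu> * h i)" by (intro norm_d_cong) (simp add: \<theta>_def)
    then have "norm_d d \<theta> = 1" unfolding norm_d_scale using \<nu> by (simp add: \<nu>_def)
    then have \<theta>: "\<theta> \<in> sphere_d d" by (simp add: sphere_d_def \<theta>_def)
    have h: "inner_d d h y = \<nu> * inner_d d \<theta> y" for y
      using \<nu> by (simp add: inner_d_def \<theta>_def sum_distrib_left mult.assoc[symmetric])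
    define s where "s = (SUP y'\<in>supp d P0. inner_d d \<theta> y')"
    have "bdd_above ((\<lambda>y'. inner_d d \<theta> y') ` supp d P0)"
    proof (rule bdd_aboveI2)
      fix y assume "y \<in> supp d P0"
      then have "norm_d d y \<le> R" using R by (auto simp: cball_d_def)
      then have "norm_d d \<theta> * norm_d d y \<le> 1 * R" using \<open>norm_d d \<theta> = 1\<close> by simp
      then show "inner_d d \<theta> y \<le> R" using abs_inner_d_le[of d \<theta> y] by linarith
    qed
    then have sup: "inner_d d \<theta> (Y \<omega>) \<le> s" for \<omega>
      unfolding s_def using Y_supp by (rule cSUP_upper[rotated])
    \<comment> \<open>The depth for h is \<nu> times the depth for the unit vector, so level
      \<open>u\<close> becomes level \<open>u / \<nu>\<close>, where (UD) applies with the same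
      constant.\<close>
    have cap: "prob {\<omega> \<in> space P0. \<nu> * s - inner_d d h (Y \<omega>) \<le> u} = cap_mass d P0 \<theta> (u / \<nu>)" for u
      unfolding cap_mass_def
    proof (rule measure_eq_AE)
      have iff: "\<nu> * s - inner_d d h y \<le> u \<longleftrightarrow> cap_depth d P0 \<theta> y \<le> u / \<nu>" for y
        unfolding cap_depth_def s_def[symmetric] h using \<nu> by (simp add: field_simps)
      show "AE y in P0. y \<in> {\<omega> \<in> space P0. \<nu> * s - inner_d d h (Y \<omega>) \<le> u} \<longleftrightarrow> y \<in> {y \<in> Rd d. cap_depth d P0 \<theta> y \<le> u / \<nu>}"
        using ae by eventually_elim (simp add: space iff)
      have [measurable]: "(\<lambda>\<omega>. inner_d d h (Y \<omega>)) \<in> borel_measurable P0" using bounded_meas_inner by (simp add: bounded_meas_def)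
      show "{\<omega> \<in> space P0. \<nu> * s - inner_d d h (Y \<omega>) \<le> u} \<in> sets P0" by measurable
      have [measurable]: "(\<lambda>y. inner_d d \<theta> y) \<in> borel_measurable P0"
        unfolding inner_d_def by (intro borel_measurable_times borel_measurable_sum
          borel_measurable_const measurable_component_borel_prob[OF P0]) auto
      have "{y \<in> space P0. s - inner_d d \<theta> y \<le> u / \<nu>} \<in> sets P0" by measurable
      then show "{y \<in> Rd d. cap_depth d P0 \<theta> y \<le> u / \<nu>} \<in> sets P0"
        by (simp add: cap_depth_def s_def space)
    qed
    have dbl: "cap_mass d P0 \<theta> (2 * u) \<le> D * cap_mass d P0 \<theta> u" if "0 < u" for u
      using UD \<theta> that by (simp add: UD_def)
    show ?thesis
    proof (intro exI[of _ "\<nu> * s"] conjI allI impI)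
      show "inner_d d h (Y \<omega>) \<le> \<nu> * s" for \<omega> unfolding h using sup \<nu> by (intro mult_left_mono) auto
      fix u :: real assume u: "0 < u"
      have "cap_mass d P0 \<theta> (2 * (u / \<nu>)) \<le> D * cap_mass d P0 \<theta> (u / \<nu>)" using u \<nu> by (intro dbl) simp
      then show "prob {\<omega> \<in> space P0. \<nu> * s - inner_d d h (Y \<omega>) \<le> 2 * u}
             \<le> D * prob {\<omega> \<in> space P0. \<nu> * s - inner_d d h (Y \<omega>) \<le> u}" unfolding cap by simp
    qed
  qed
  have "ou_tilt P0 Y d R D p"
    by unfold_locales (use D doubling score_eq[OF P0 p tilt ae] in auto)
  then show ?thesis by (rule exI[of _ Y])
qed

theorem theorem3p13:
  fixes j :: nat and D :: real
  assumes "j \<ge> 1" and "D \<ge> 1"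
  shows "\<exists>C C'. \<forall>(d::nat) (R::real) (P0 :: (nat \<Rightarrow> real) measure) p.
     d \<ge> 1 \<and> borel_prob d P0 \<and> supp d P0 \<subseteq> cball_d d R \<and> UD d P0 D \<and> ou_density d P0 p \<longrightarrow>
       (\<forall>t>0. \<forall>x\<in>Rd d.
          norm_d d (Lx d p j t x)
            \<le> C * (exp (- t) / (1 - exp (- t)) ^ j * norm_d d x
                   + exp (- t / 2) * ((1 + R) / (1 - exp (- t))) ^ (2 * j - 1)) \<and>
          opnorm_d d (jacobian_d (Lx d p j t) x)
            \<le> C * exp (- t) * ((1 + R) / (1 - exp (- t))) ^ (2 * j)) \<and>
       (\<forall>\<delta>>0. \<forall>t\<ge>\<delta>. \<forall>x\<in>Rd d.
          norm_d d (Lx d p j t x)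
            \<le> C * (exp (- t) / (1 - exp (- \<delta>)) ^ j * norm_d d x
                   + exp (- t / 2) * ((1 + R) / (1 - exp (- \<delta>))) ^ (2 * j - 1)) \<and>
          opnorm_d d (jacobian_d (Lx d p j t) x)
            \<le> C * exp (- t) * ((1 + R) / (1 - exp (- \<delta>))) ^ (2 * j)) \<and>
       (\<forall>\<delta>. 0 < \<delta> \<and> \<delta> \<le> 1 \<longrightarrow> (\<forall>t\<ge>\<delta>. \<forall>x\<in>Rd d.
          norm_d d (Lx d p j t x)
            \<le> C' * (exp (- t) / \<delta> ^ j * norm_d d x
                    + exp (- t / 2) * ((1 + R) / \<delta>) ^ (2 * j - 1)) \<and>
          opnorm_d d (jacobian_d (Lx d p j t) x)
            \<le> C' * exp (- t) * ((1 + R) / \<delta>) ^ (2 * j)))"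
proof -
  define i where "i = j - 1"
  have j: "j = Suc i" "2 * j - 1 = 2 * i + 1" "2 * j = 2 * i + 2" using assms(1) by (auto simp: i_def)
  define C where "C = Lx_const D i"
  show ?thesis
  \<comment> \<open>The second constant pays for replacing 1 - exp (-\<delta>) by \<delta> / 2: no
    exponent in the bounds exceeds 2j.\<close>
  proof (rule exI[of _ C], rule exI[of _ "C * 2 ^ (2 * j)"], intro allI impI)
    fix d :: nat and R :: real and P0 :: "(nat \<Rightarrow> real) measure" and p
    assume "1 \<le> d \<and> borel_prob d P0 \<and> supp d P0 \<subseteq> cball_d d R \<and> UD d P0 D \<and> ou_density d P0 p"
    then obtain Y where "ou_tilt P0 Y d R D p" using ou_tilt_exists by blast
    then interpret ou_tilt P0 Y d R D p .
    have C: "0 \<le> C" unfolding C_def by (rule Lx_const_parts(4))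
    \<comment> \<open>The right-hand sides decrease in \<open>s\<close>, so any \<open>s\<close> up
      to 1 - exp (-t) is allowed; the three claims take 1 - exp (-t), 1 - exp (-\<delta>) and
      \<delta> / 2.\<close>
    have bound: "norm_d d (Lx d p j t x)
            \<le> C * (exp (- t) / s ^ j * norm_d d x + exp (- t / 2) * ((1 + R) / s) ^ (2 * j - 1)) \<and>
          opnorm_d d (jacobian_d (Lx d p j t) x) \<le> C * exp (- t) * ((1 + R) / s) ^ (2 * j)"
      if t: "0 < t" and x: "x \<in> Rd d" and s: "0 < s" "s \<le> 1 - exp (- t)" for t x s
    proof -
      have "0 < 1 - exp (- t)" using s by linarith
      then have le: "1 + lam t \<le> 1 / s"
        unfolding one_plus_lam[OF t] using s by (intro divide_left_mono mult_pos_pos) auto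
      have l: "0 \<le> 1 + lam t" using lam_nonneg[OF t] by simp
      have pow: "(1 + lam t) ^ Suc i \<le> 1 / s ^ j" unfolding j(1) power_one_over[symmetric] by (intro power_mono le l)
      have "(1 + R) * (1 + lam t) \<le> (1 + R) * (1 / s)" using R_nonneg by (intro mult_left_mono le) auto
      then have pow': "((1 + R) * (1 + lam t)) ^ m \<le> ((1 + R) / s) ^ m" for m
        using R_nonneg l by (intro power_mono) auto
      have "norm_d d (Lx d p j t x) \<le> C * (exp (- t) * (1 + lam t) ^ Suc i * norm_d d x
        + exp (- t / 2) * ((1 + R) * (1 + lam t)) ^ (2 * i + 1))"
        unfolding C_def j(1) by (rule norm_Lx_le[OF t x])
      also have "\<dots> \<le> C * (exp (- t) * (1 / s ^ j) * norm_d d x + exp (- t / 2) * ((1 + R) / s) ^ (2 * i + 1))"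
        by (intro mult_left_mono add_mono mult_right_mono pow pow' C) auto
      finally have 1: "norm_d d (Lx d p j t x) \<le> C * (exp (- t) / s ^ j * norm_d d x + exp (- t / 2) * ((1 + R) / s) ^ (2 * j - 1))"
        unfolding j(2) by simp
      have "opnorm_d d (jacobian_d (Lx d p j t) x) \<le> C * exp (- t) * ((1 + R) * (1 + lam t)) ^ (2 * j)"
        unfolding C_def j(3) unfolding j(1) by (rule opnorm_jacobian_Lx_le[OF t x])
      also have "\<dots> \<le> C * exp (- t) * ((1 + R) / s) ^ (2 * j)"
        using C by (intro mult_left_mono pow') auto
      finally show ?thesis using 1 by blast
    qed
    have half: "\<delta> / 2 \<le> 1 - exp (- \<delta>)" if "0 < \<delta>" "\<delta> \<le> 1" for \<delta> :: real
    proof -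
      have "(1 + \<delta>) * exp (- \<delta>) \<le> exp \<delta> * exp (- \<delta>)" by (intro mult_right_mono exp_ge_add_one_self) auto
      then have "exp (- \<delta>) \<le> 1 / (1 + \<delta>)" using that by (simp add: exp_add[symmetric] field_simps)
      \<comment> \<open>Here \<delta> <= 1 enters: (1 + \<delta>)(1 - \<delta> / 2) = 1 + \<delta>
        (1 - \<delta>) / 2.\<close>
      also have "\<dots> \<le> 1 - \<delta> / 2" using that by (simp add: field_simps)
      finally show ?thesis by simp
    qed
    have scale: "norm_d d (Lx d p j t x)
            \<le> C * 2 ^ (2 * j) * (exp (- t) / \<delta> ^ j * norm_d d x + exp (- t / 2) * ((1 + R) / \<delta>) ^ (2 * j - 1)) \<and>
          opnorm_d d (jacobian_d (Lx d p j t) x) \<le> C * 2 ^ (2 * j) * exp (- t) * ((1 + R) / \<delta>) ^ (2 * j)"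
      if d: "0 < \<delta>" "\<delta> \<le> 1" and t: "\<delta> \<le> t" and x: "x \<in> Rd d" for \<delta> t x
    proof -
      have "\<delta> / 2 \<le> 1 - exp (- t)" using half[OF d] t by (intro order_trans[OF half[OF d]]) simp
      from bound[OF _ x _ this] d t have b: "norm_d d (Lx d p j t x)
            \<le> C * (exp (- t) / (\<delta> / 2) ^ j * norm_d d x + exp (- t / 2) * ((1 + R) / (\<delta> / 2)) ^ (2 * j - 1))"
          "opnorm_d d (jacobian_d (Lx d p j t) x) \<le> C * exp (- t) * ((1 + R) / (\<delta> / 2)) ^ (2 * j)" by auto
      have "exp (- t) / (\<delta> / 2) ^ j * norm_d d x = 2 ^ j * (exp (- t) / \<delta> ^ j * norm_d d x)"
        by (simp add: power_divide)
      also have "\<dots> \<le> 2 ^ (2 * j) * (exp (- t) / \<delta> ^ j * norm_d d x)"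
        using d by (intro mult_right_mono power_increasing) auto
      finally have 1: "exp (- t) / (\<delta> / 2) ^ j * norm_d d x \<le> 2 ^ (2 * j) * (exp (- t) / \<delta> ^ j * norm_d d x)" .
      have e: "((1 + R) / (\<delta> / 2)) ^ m = 2 ^ m * ((1 + R) / \<delta>) ^ m" for m
        by (simp add: power_mult_distrib[symmetric] mult.commute)
      have "exp (- t / 2) * ((1 + R) / (\<delta> / 2)) ^ (2 * j - 1) = 2 ^ (2 * j - 1) * (exp (- t / 2) * ((1 + R) / \<delta>) ^ (2 * j - 1))"
        unfolding e by (simp add: mult_ac)
      also have "\<dots> \<le> 2 ^ (2 * j) * (exp (- t / 2) * ((1 + R) / \<delta>) ^ (2 * j - 1))"
        using d R_nonneg by (intro mult_right_mono power_increasing) auto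
      finally have "C * (exp (- t) / (\<delta> / 2) ^ j * norm_d d x + exp (- t / 2) * ((1 + R) / (\<delta> / 2)) ^ (2 * j - 1))
          \<le> C * (2 ^ (2 * j) * (exp (- t) / \<delta> ^ j * norm_d d x) + 2 ^ (2 * j) * (exp (- t / 2) * ((1 + R) / \<delta>) ^ (2 * j - 1)))"
        using 1 C by (intro mult_left_mono add_mono) auto
      then show ?thesis using b unfolding e by (simp add: algebra_simps)
    qed
    have first: "\<forall>t>0. \<forall>x\<in>Rd d.
          norm_d d (Lx d p j t x)
            \<le> C * (exp (- t) / (1 - exp (- t)) ^ j * norm_d d x
                   + exp (- t / 2) * ((1 + R) / (1 - exp (- t))) ^ (2 * j - 1)) \<and>
          opnorm_d d (jacobian_d (Lx d p j t) x)
            \<le> C * exp (- t) * ((1 + R) / (1 - exp (- t))) ^ (2 * j)"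
      by (intro allI impI ballI bound) auto
    have second: "\<forall>\<delta>>0. \<forall>t\<ge>\<delta>. \<forall>x\<in>Rd d.
          norm_d d (Lx d p j t x)
            \<le> C * (exp (- t) / (1 - exp (- \<delta>)) ^ j * norm_d d x
                   + exp (- t / 2) * ((1 + R) / (1 - exp (- \<delta>))) ^ (2 * j - 1)) \<and>
          opnorm_d d (jacobian_d (Lx d p j t) x)
            \<le> C * exp (- t) * ((1 + R) / (1 - exp (- \<delta>))) ^ (2 * j)"
      by (intro allI impI ballI bound) auto
    show "(\<forall>t>0. \<forall>x\<in>Rd d.
          norm_d d (Lx d p j t x)
            \<le> C * (exp (- t) / (1 - exp (- t)) ^ j * norm_d d x
                   + exp (- t / 2) * ((1 + R) / (1 - exp (- t))) ^ (2 * j - 1)) \<and>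
          opnorm_d d (jacobian_d (Lx d p j t) x)
            \<le> C * exp (- t) * ((1 + R) / (1 - exp (- t))) ^ (2 * j)) \<and>
       (\<forall>\<delta>>0. \<forall>t\<ge>\<delta>. \<forall>x\<in>Rd d.
          norm_d d (Lx d p j t x)
            \<le> C * (exp (- t) / (1 - exp (- \<delta>)) ^ j * norm_d d x
                   + exp (- t / 2) * ((1 + R) / (1 - exp (- \<delta>))) ^ (2 * j - 1)) \<and>
          opnorm_d d (jacobian_d (Lx d p j t) x)
            \<le> C * exp (- t) * ((1 + R) / (1 - exp (- \<delta>))) ^ (2 * j)) \<and>
       (\<forall>\<delta>. 0 < \<delta> \<and> \<delta> \<le> 1 \<longrightarrow> (\<forall>t\<ge>\<delta>. \<forall>x\<in>Rd d.
          norm_d d (Lx d p j t x)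
            \<le> C * 2 ^ (2 * j) * (exp (- t) / \<delta> ^ j * norm_d d x
                    + exp (- t / 2) * ((1 + R) / \<delta>) ^ (2 * j - 1)) \<and>
          opnorm_d d (jacobian_d (Lx d p j t) x)
            \<le> C * 2 ^ (2 * j) * exp (- t) * ((1 + R) / \<delta>) ^ (2 * j)))"
      using first second scale by blast
  qed
qed

end
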